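(* Let $(\Pi,c)$ be a complete, separable, locally compact semimetric space such that $c$ is jointly (sequentially) continuous and, for some $B\ge 1$, $c(x,y)\le B[c(x,z)+c(z,y)]$ for all $x,y,z\in\Pi$. Let $\mathcal A:\mathcal P_c(\Pi)\to\mathcal G_c^0(\Pi)$ be a map (a mean-field generator) for which there exist $\alpha,\beta\ge0$ such that for all $\mu,\nu,\mu',\nu'\in\mathcal P_c(\Pi)$, $$\omega_c(\mu,\nu;\mathcal A(\mu'),\mathcal A(\nu'))\le\alpha\,\mathcal C_c(\mu',\nu')+\beta\,\mathcal C_c(\mu,\nu).$$ Then for every initial condition $\bar\rho_0\in\mathcal P_c(\Pi)$ there exists a unique $c$-stable solution $\{\bar\rho_t\}_{t\ge0}\in C([0,\infty);\mathcal P_c(\Pi))$ of the mean-field problem $$\partial_t\bar\rho_t=\bar\rho_t\,\mathcal A(\bar\rho_t),\quad t\in(0,\infty),$$ with initial value $\bar\rho_0$.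
   Context: A semimetric on a set $\Pi$ is a map $c:\Pi\times\Pi\to[0,\infty)$ with $c(x,y)=c(y,x)$ and $c(x,y)=0$ iff $x=y$; $x_n\to x$ means $c(x_n,x)\to0$, and $\Pi$ carries the topology generated by the balls $\{y:c(x,y)<r\}$. Complete: every sequence with $\lim_n\sup_{m\ge n}c(x_n,x_m)=0$ converges. Continuity of $c$: $x_n\to x$, $y_n\to y$ imply $c(x_n,y_n)\to c(x,y)$. $\mathcal P(\Pi)$: Borel probability measures; $\langle\mu,\phi\rangle=\int\phi\,d\mu$. $\mathcal C_c(\mu,\nu)=\inf_\gamma\int c\,d\gamma$ over couplings $\gamma$ of $\mu,\nu$. $\mathcal P_c(\Pi)$: those $\mu\in\mathcal P(\Pi)$ with $\int c(z,x)\,d\mu(x)<\infty$ for some (equivalently all) $z$. For an interval $I$, $C(I;\mathcal P_c(\Pi))$ is the set of curves $\rho:I\to\mathcal P_c(\Pi)$ with $\lim_{s\to t}\mathcal C_c(\rho_t,\rho_s)=0$ for all $t$. A probability semigroup is a family $T_t\phi(x)=\int\phi(y)\,\kappa_t(x,dy)$, $t\ge0$, with $\kappa_t(x,\cdot)\in\mathcal P(\Pi)$ weakly continuous in $x$, $T_t$ preserving $C_0(\Pi)$ (continuous functions vanishing at infinity), $T_0=I$, $T_{t+s}=T_tT_s$, $\|T_t\phi-\phi\|_\infty\to0$ as $t\searrow0$ for $\phi\in C_0(\Pi)$. Its generator $\mathcal A\phi=\lim_{t\searrow0}(T_t\phi-\phi)/t$ (uniform limit) has domain $D(\mathcal A)\subset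 C_0(\Pi)$ where the limit exists; write $T_t=e^{t\mathcal A}$, and $\mu e^{t\mathcal A}$ for the measure with $\langle\mu e^{t\mathcal A},\phi\rangle=\langle\mu,e^{t\mathcal A}\phi\rangle$. $\mathcal G_c^0(\Pi)$: generators $\mathcal A$ such that for all $\mu\in\mathcal P_c(\Pi)$, $\mu e^{t\mathcal A}\in\mathcal P_c(\Pi)$ for all $t$ and $t\mapsto\mu e^{t\mathcal A}$ is $\mathcal C_c$-continuous. For $\mathcal A,\mathcal B\in\mathcal G_c^0(\Pi)$, $\omega_c(\mu,\nu;\mathcal A,\mathcal B)=\limsup_{t\searrow0}\frac1t[\mathcal C_c(\mu e^{t\mathcal A},\nu e^{t\mathcal B})-\mathcal C_c(\mu,\nu)]$. $c$-stable solutions. For a curve $\boldsymbol{\mathcal A}=\{\mathcal A_t\}_{t\in[0,T]}$ in $\mathcal G_c^0(\Pi)$ that is constant on each $[t_{k-1},t_k)$ of a partition $0=t_0<\dots<t_K=T$, let $\mathbb S_0(\rho_0;\boldsymbol{\mathcal A})$ be the curve given recursively by $\rho_t=\rho_{t_{k-1}}e^{(t-t_{k-1})\mathcal A(t_{k-1})}$ for $t\in[t_{k-1},t_k]$, starting from $\rho_0$. For general $\boldsymbol{\mathcal A}$ and a partition $\Delta=\{0=t_0<\dots<t_n=T\}$ put $\mathcal A^\Delta(t)=\mathcal A(t_k)$ for $t\in[t_{k-1},t_k)$; a piecewise constant approximating sequence of $\boldsymbol{\mathcal A}$ is $\boldsymbol{\mathcal A}^{(n)}=\boldsymbol{\mathcal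 A}^{\Delta_n}$ with mesh sizes of $\Delta_n$ tending to $0$. A curve $\rho\in C([0,T];\mathcal P_c(\Pi))$ is a $c$-stable solution of $\partial_t\rho_t=\rho_t\mathcal A_t$ with initial value $\rho_0$ if for every piecewise constant approximating sequence $\{\boldsymbol{\mathcal A}^{(n)}\}$ of $\boldsymbol{\mathcal A}$ one has $\sup_{t\in[0,T]}\mathcal C_c(\rho_t,\rho^{(n)}_t)\to0$ where $\rho^{(n)}=\mathbb S_0(\rho_0;\boldsymbol{\mathcal A}^{(n)})$. A $c$-stable solution of the mean-field problem is a curve $\bar\rho\in C([0,\infty);\mathcal P_c(\Pi))$ which, on every $[0,T]$, is a $c$-stable solution of the linear equation with generators $\mathcal A_t=\mathcal A(\bar\rho_t)$ and initial value $\bar\rho_0$. *)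

theory Defs
  imports "HOL-Probability.Probability"
begin

section \<open>Semimetric spaces\<close>

definition semimetric :: "('a \<Rightarrow> 'a \<Rightarrow> real) \<Rightarrow> bool" where
  "semimetric c \<longleftrightarrow>
     (\<forall>x y. 0 \<le> c x y) \<and> (\<forall>x y. c x y = c y x) \<and> (\<forall>x y. c x y = 0 \<longleftrightarrow> x = y)"

definition generates_topology :: "('a::topological_space \<Rightarrow> 'a \<Rightarrow> real) \<Rightarrow> bool" where
  "generates_topology c \<longleftrightarrow>
     (\<forall>U::'a set. open U \<longleftrightarrow> generate_topology {{y. c x y < r} |x r. 0 < r} U)"

definition sm_converges :: "('a \<Rightarrow> 'a \<Rightarrow> real) \<Rightarrow> (nat \<Rightarrow> 'a) \<Rightarrow> 'a \<Rightarrow> bool" where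
  "sm_converges c X x \<longleftrightarrow> (\<lambda>n. c (X n) x) \<longlonglongrightarrow> 0"

definition sm_complete :: "('a \<Rightarrow> 'a \<Rightarrow> real) \<Rightarrow> bool" where
  "sm_complete c \<longleftrightarrow>
     (\<forall>X. (\<lambda>n. SUP m\<in>{n..}. ennreal (c (X n) (X m))) \<longlonglongrightarrow> 0 \<longrightarrow> (\<exists>x. sm_converges c X x))"

definition sm_continuous :: "('a \<Rightarrow> 'a \<Rightarrow> real) \<Rightarrow> bool" where
  "sm_continuous c \<longleftrightarrow>
     (\<forall>X Y x y. sm_converges c X x \<and> sm_converges c Y y \<longrightarrow>
        (\<lambda>n. c (X n) (Y n)) \<longlonglongrightarrow> c x y)"


section \<open>Transport cost\<close>

definition borel_probs :: "'a::topological_space measure set" where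
  "borel_probs = {\<mu>. prob_space \<mu> \<and> sets \<mu> = sets borel}"

definition couplings ::
  "'a::topological_space measure \<Rightarrow> 'a measure \<Rightarrow> ('a \<times> 'a) measure set" where
  "couplings \<mu> \<nu> = {\<gamma>. prob_space \<gamma> \<and> sets \<gamma> = sets (borel \<Otimes>\<^sub>M borel) \<and>
     distr \<gamma> borel fst = \<mu> \<and> distr \<gamma> borel snd = \<nu>}"

definition transport_cost ::
  "('a::topological_space \<Rightarrow> 'a \<Rightarrow> real) \<Rightarrow> 'a measure \<Rightarrow> 'a measure \<Rightarrow> ennreal" where
  "transport_cost c \<mu> \<nu> = (INF \<gamma>\<in>couplings \<mu> \<nu>. \<integral>\<^sup>+ p. ennreal (c (fst p) (snd p)) \<partial>\<gamma>)"

definition Pc :: "('a::topological_space \<Rightarrow> 'a \<Rightarrow> real) \<Rightarrow> 'a measure set" where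
  "Pc c = {\<mu> \<in> borel_probs. \<exists>z. (\<integral>\<^sup>+ x. ennreal (c z x) \<partial>\<mu>) < \<infinity>}"

definition Pc_curves ::
  "('a::topological_space \<Rightarrow> 'a \<Rightarrow> real) \<Rightarrow> real set \<Rightarrow> (real \<Rightarrow> 'a measure) set" where
  "Pc_curves c I = {\<rho>. (\<forall>t\<in>I. \<rho> t \<in> Pc c) \<and>
     (\<forall>t\<in>I. ((\<lambda>s. transport_cost c (\<rho> t) (\<rho> s)) \<longlongrightarrow> 0) (at t within I))}"


section \<open>Probability semigroups and their generators\<close>

definition C0 :: "('a::topological_space \<Rightarrow> real) set" where
  "C0 = {\<phi>. continuous_on UNIV \<phi> \<and> (\<forall>\<epsilon>>0. \<exists>K. compact K \<and> (\<forall>x. x \<notin> K \<longrightarrow> \<bar>\<phi> x\<bar> < \<epsilon>))}"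

definition kernel_op ::
  "(real \<Rightarrow> 'a \<Rightarrow> 'a measure) \<Rightarrow> real \<Rightarrow> ('a \<Rightarrow> real) \<Rightarrow> 'a \<Rightarrow> real" where
  "kernel_op \<kappa> t \<phi> x = (\<integral>y. \<phi> y \<partial>\<kappa> t x)"

definition prob_semigroup :: "(real \<Rightarrow> 'a::topological_space \<Rightarrow> 'a measure) \<Rightarrow> bool" where
  "prob_semigroup \<kappa> \<longleftrightarrow>
     (\<forall>t\<ge>0. \<forall>x. \<kappa> t x \<in> borel_probs) \<and>
     (\<forall>t\<ge>0. \<forall>\<phi>. continuous_on UNIV \<phi> \<and> bounded (range \<phi>) \<longrightarrow>
        continuous_on UNIV (kernel_op \<kappa> t \<phi>)) \<and>
     (\<forall>t\<ge>0. \<forall>\<phi>\<in>C0. kernel_op \<kappa> t \<phi> \<in> C0) \<and>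
     (\<forall>\<phi>\<in>C0. kernel_op \<kappa> 0 \<phi> = \<phi>) \<and>
     (\<forall>s\<ge>0. \<forall>t\<ge>0. \<forall>\<phi>\<in>C0. kernel_op \<kappa> (t + s) \<phi> = kernel_op \<kappa> t (kernel_op \<kappa> s \<phi>)) \<and>
     (\<forall>\<phi>\<in>C0. uniform_limit UNIV (\<lambda>t. kernel_op \<kappa> t \<phi>) \<phi> (at_right 0))"

text \<open>An unbounded operator is represented by its graph, so that its domain is part of it.\<close>

type_synonym 'a operator = "(('a \<Rightarrow> real) \<times> ('a \<Rightarrow> real)) set"

definition generator_of :: "(real \<Rightarrow> 'a::topological_space \<Rightarrow> 'a measure) \<Rightarrow> 'a operator" where
  "generator_of \<kappa> = {(\<phi>, \<psi>). \<phi> \<in> C0 \<and>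
     uniform_limit UNIV (\<lambda>t x. (kernel_op \<kappa> t \<phi> x - \<phi> x) / t) \<psi> (at_right 0)}"

text \<open>
  A generator determines its semigroup on \<open>C0\<close> (Hille--Yosida), so the choice of the
  kernel below is immaterial.
\<close>

definition exp_op ::
  "'a::topological_space operator \<Rightarrow> real \<Rightarrow> ('a \<Rightarrow> real) \<Rightarrow> 'a \<Rightarrow> real" where
  "exp_op A t = kernel_op (SOME \<kappa>. prob_semigroup \<kappa> \<and> generator_of \<kappa> = A) t"

definition evolve ::
  "'a::topological_space operator \<Rightarrow> real \<Rightarrow> 'a measure \<Rightarrow> 'a measure" where
  "evolve A t \<mu> = (THE \<nu>. \<nu> \<in> borel_probs \<and>
     (\<forall>\<phi>\<in>C0. (\<integral>x. \<phi> x \<partial>\<nu>) = (\<integral>x. exp_op A t \<phi> x \<partial>\<mu>)))"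

definition Gc0 :: "('a::topological_space \<Rightarrow> 'a \<Rightarrow> real) \<Rightarrow> 'a operator set" where
  "Gc0 c = {A. (\<exists>\<kappa>. prob_semigroup \<kappa> \<and> A = generator_of \<kappa>) \<and>
     (\<forall>\<mu>\<in>Pc c. (\<lambda>t. evolve A t \<mu>) \<in> Pc_curves c {0..})}"

text \<open>
  The transport cost is finite between elements of \<^term>\<open>Pc c\<close> (for \<open>c\<close> with a relaxed
  triangle inequality), so the conversion to \<open>real\<close> loses nothing there.
\<close>

definition omega ::
  "('a::topological_space \<Rightarrow> 'a \<Rightarrow> real) \<Rightarrow> 'a measure \<Rightarrow> 'a measure \<Rightarrow>
   'a operator \<Rightarrow> 'a operator \<Rightarrow> ereal" where
  "omega c \<mu> \<nu> A B = Limsup (at_right 0) (\<lambda>t. ereal (1 / t *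
     (enn2real (transport_cost c (evolve A t \<mu>) (evolve B t \<nu>)) -
      enn2real (transport_cost c \<mu> \<nu>))))"


section \<open>Stable solutions\<close>

text \<open>Partitions are represented by the strictly increasing list of their points.\<close>

definition is_partition :: "real \<Rightarrow> real list \<Rightarrow> bool" where
  "is_partition T \<Delta> \<longleftrightarrow> \<Delta> \<noteq> [] \<and> sorted_wrt (<) \<Delta> \<and> hd \<Delta> = 0 \<and> last \<Delta> = T"

definition mesh :: "real list \<Rightarrow> real" where
  "mesh \<Delta> = Max {\<Delta> ! Suc k - \<Delta> ! k |k. Suc k < length \<Delta>}"

text \<open>
  On \<open>[t\<^sub>k\<^sub>-\<^sub>1, t\<^sub>k)\<close> the approximation takes the value at the right end point \<open>t\<^sub>k\<close>;
  its value at or after the last point of the partition is irrelevant.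
\<close>

definition pc_approx :: "real list \<Rightarrow> (real \<Rightarrow> 'b) \<Rightarrow> real \<Rightarrow> 'b" where
  "pc_approx \<Delta> A t = A (Min {u \<in> set \<Delta>. t < u})"

text \<open>The curve started at time \<open>hd \<Delta>\<close> in \<open>\<rho>\<^sub>0\<close>, for \<open>A\<close> constant between the points of \<open>\<Delta>\<close>.\<close>

fun S0 ::
  "real list \<Rightarrow> 'a::topological_space measure \<Rightarrow> (real \<Rightarrow> 'a operator) \<Rightarrow> real \<Rightarrow> 'a measure" where
  "S0 (a # b # \<Delta>) \<rho>\<^sub>0 A t =
     (if t \<le> b then evolve (A a) (t - a) \<rho>\<^sub>0 else S0 (b # \<Delta>) (evolve (A a) (b - a) \<rho>\<^sub>0) A t)"
| "S0 _ \<rho>\<^sub>0 A t = \<rho>\<^sub>0"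

definition stable_solution ::
  "('a::topological_space \<Rightarrow> 'a \<Rightarrow> real) \<Rightarrow> real \<Rightarrow> (real \<Rightarrow> 'a operator) \<Rightarrow> 'a measure \<Rightarrow>
   (real \<Rightarrow> 'a measure) \<Rightarrow> bool" where
  "stable_solution c T A \<rho>\<^sub>0 \<rho> \<longleftrightarrow>
     \<rho> \<in> Pc_curves c {0..T} \<and>
     (\<forall>\<Delta>::nat \<Rightarrow> real list.
        (\<forall>n. is_partition T (\<Delta> n)) \<and> (\<lambda>n. mesh (\<Delta> n)) \<longlonglongrightarrow> 0 \<longrightarrow>
        (\<lambda>n. SUP t\<in>{0..T}. transport_cost c (\<rho> t) (S0 (\<Delta> n) \<rho>\<^sub>0 (pc_approx (\<Delta> n) A) t))
          \<longlonglongrightarrow> 0)"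

definition mean_field_solution ::
  "('a::topological_space \<Rightarrow> 'a \<Rightarrow> real) \<Rightarrow> ('a measure \<Rightarrow> 'a operator) \<Rightarrow>
   (real \<Rightarrow> 'a measure) \<Rightarrow> bool" where
  "mean_field_solution c \<A> \<rho> \<longleftrightarrow>
     \<rho> \<in> Pc_curves c {0..} \<and>
     (\<forall>T>0. stable_solution c T (\<lambda>t. \<A> (\<rho> t)) (\<rho> 0) \<rho>)"

end

theory Submission
  imports Defs
begin

text \<open>
  Conditioning a coupling only on the cell of a countable partition of small cells containing its
  first coordinate replaces the disintegration theorem. It turns a coupling into a Markov kernel
  at the price of a constant factor in the cost. Composing such kernels shows that the transport
  cost satisfies a relaxed triangle inequality with constant \<open>B^3\<close> and is lower semicontinuous, and
  running the Markov chain of a rapidly Cauchy sequence of measures (Ionescu-Tulcea) gives its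
  limit as the law of the almost sure limit of the chain. Exact lower semicontinuity is what
  the comparison of the transport cost between two schemes needs: the hypothesis bounds its
  upper right Dini derivative, and lower semicontinuity excludes upward jumps from the left.
  The resulting Gronwall estimate, in the norm weighted by \<open>exp (\<omega> t)\<close> with \<open>\<omega>\<close> large, is a
  contraction strong enough to beat the constants of the relaxed triangle inequality. The solution
  is the limit of Picard iterates in which every linear equation is replaced at once by
  a piecewise constant scheme whose partition is fine for the previous iterate.
\<close>

section \<open>Kernels and Markov chains\<close>

text \<open>Every use of a relaxed triangle inequality costs a factor, so it may enter an estimate
  only a bounded number of times. This rules out adding up local errors over the intervals of a
  partition: n intervals would cost the n-th power of the constant. Two schemes are therefore
  compared by an exact differential inequality, and \<open>W_triangle3\<close> serves only to pass
  between a curve, its sample at the next partition point and its approximation; its factor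
  \<open>b^2\<close> is absorbed once, by the choice of \<open>\<omega>\<close>. Lower
  semicontinuity must hold with factor 1 for the same reason, since it is used at every time. Where
  long chains are unavoidable, in the completeness proof, the factors \<open>B^i\<close> are beaten
  by a geometric rate \<open>\<theta>^i\<close>. Discretising within the Picard iteration saves an
  inner limit for the linear equation at each stage, and horizons that grow with the stage let one
  sequence of iterates serve all of \<open>[0, \<infinity>)\<close>.\<close>

lemma C0_measurable: "\<phi> \<in> C0 \<Longrightarrow> \<phi> \<in> borel_measurable borel"
  by (auto simp: C0_def intro: borel_measurable_continuous_onI)

lemma C0_bounded:
  assumes "\<phi> \<in> C0"
  obtains b where "\<And>x. \<bar>\<phi> x\<bar> \<le> b"
proof -
  obtain K where K: "compact K" "\<And>x. x \<notin> K \<Longrightarrow> \<bar>\<phi> x\<bar> < 1"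
    using assms unfolding C0_def by (auto dest: spec[of _ 1])
  have "continuous_on K \<phi>" using assms by (auto simp: C0_def intro: continuous_on_subset)
  then have "bounded (\<phi> ` K)" by (intro compact_imp_bounded compact_continuous_image K)
  then obtain b where "\<And>x. x \<in> K \<Longrightarrow> \<bar>\<phi> x\<bar> \<le> b" by (auto simp: bounded_iff)
  then have "\<bar>\<phi> x\<bar> \<le> max b 1" for x using K(2)[of x] by (cases "x \<in> K") force+
  then show ?thesis using that by blast
qed

lemma borel_probsD:
  assumes "\<mu> \<in> borel_probs"
  shows "prob_space \<mu>" "sets \<mu> = sets borel" "space \<mu> = UNIV"
  using assms sets_eq_imp_space_eq[of \<mu> borel] by (auto simp: borel_probs_def)

lemma space_prob_algebra_borel: "space (prob_algebra (borel :: 'a::topological_space measure)) = borel_probs"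
  by (auto simp: space_prob_algebra borel_probs_def)

lemma couplingsD:
  assumes "\<gamma> \<in> couplings \<mu> \<nu>"
  shows "prob_space \<gamma>" "sets \<gamma> = sets (borel \<Otimes>\<^sub>M borel)"
    "distr \<gamma> borel fst = \<mu>" "distr \<gamma> borel snd = \<nu>"
  using assms by (auto simp: couplings_def)

lemma nn_integral_eq_suminf_index:
  fixes F :: "nat \<Rightarrow> 'b \<Rightarrow> ennreal"
  assumes [measurable]: "J \<in> measurable M (count_space UNIV)" "\<And>i. F i \<in> borel_measurable M"
  shows "(\<integral>\<^sup>+p. F (J p) p \<partial>M) = (\<Sum>i. \<integral>\<^sup>+p. F i p * indicator {p\<in>space M. J p = i} p \<partial>M)"
proof -
  have "(\<integral>\<^sup>+p. F (J p) p \<partial>M) = (\<integral>\<^sup>+p. (\<Sum>i. F i p * indicator {p\<in>space M. J p = i} p) \<partial>M)"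
  proof (rule nn_integral_cong)
    fix p assume "p \<in> space M"
    then have "(\<Sum>i. F i p * indicator {p\<in>space M. J p = i} p)
        = (\<Sum>i\<in>{J p}. F i p * indicator {p\<in>space M. J p = i} p)"
      by (intro suminf_finite) (auto simp: indicator_def)
    then show "F (J p) p = (\<Sum>i. F i p * indicator {p\<in>space M. J p = i} p)"
      using \<open>p \<in> space M\<close> by simp
  qed
  also have "\<dots> = (\<Sum>i. \<integral>\<^sup>+p. F i p * indicator {p\<in>space M. J p = i} p \<partial>M)"
    by (rule nn_integral_suminf) measurable
  finally show ?thesis .
qed

text \<open>The elementary conditional law of the second coordinate given the cell of the first. On
  a null cell any probability measure would serve; the second marginal keeps every value in
  \<open>borel_probs\<close>, so that no exceptional cells have to be carried along.\<close>

definition cell_kernel :: "('a::topological_space \<times> 'a) measure \<Rightarrow> ('a \<Rightarrow> nat) \<Rightarrow> nat \<Rightarrow> 'a measure" where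
  "cell_kernel \<gamma> J i =
     (if emeasure \<gamma> {p\<in>space \<gamma>. J (fst p) = i} = 0 then distr \<gamma> borel snd
      else distr (uniform_measure \<gamma> {p\<in>space \<gamma>. J (fst p) = i}) borel snd)"

lemma cell_kernel_space:
  assumes "\<gamma> \<in> couplings \<mu> \<nu>"
  shows "cell_kernel \<gamma> J i \<in> borel_probs"
proof -
  note \<gamma> = couplingsD[OF assms]
  note \<gamma>(2)[measurable_cong]
  interpret prob_space \<gamma> by fact
  let ?A = "{p\<in>space \<gamma>. J (fst p) = i}"
  have "prob_space (distr (uniform_measure \<gamma> ?A) borel snd)" if "emeasure \<gamma> ?A \<noteq> 0"
    using that by (intro prob_space.prob_space_distr prob_space_uniform_measure) auto
  then show ?thesis
    by (auto simp: cell_kernel_def borel_probs_def intro!: prob_space_distr)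
qed

text \<open>The identity is exact because the integrand sees the first coordinate only through its
  cell. The cost \<open>c x y\<close> is not of this form: x must first be rounded to a dense point
  attached to its cell, which is where \<open>coupling_kernel\<close> loses its factor.\<close>

lemma nn_integral_cell_kernel:
  assumes "\<gamma> \<in> couplings \<mu> \<nu>" and [measurable]: "J \<in> measurable borel (count_space UNIV)"
    and [measurable]: "\<And>i. g i \<in> borel_measurable borel"
  shows "(\<integral>\<^sup>+x. \<integral>\<^sup>+y. g (J x) y \<partial>cell_kernel \<gamma> J (J x) \<partial>\<mu>) = (\<integral>\<^sup>+p. g (J (fst p)) (snd p) \<partial>\<gamma>)"
proof -
  note \<gamma> = couplingsD[OF assms(1)]
  note \<gamma>(2)[measurable_cong]
  interpret prob_space \<gamma> by fact
  define A where "A i = {p\<in>space \<gamma>. J (fst p) = i}" for i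
  have [measurable]: "A i \<in> sets \<gamma>" for i unfolding A_def by measurable
  define h where "h i = (\<integral>\<^sup>+y. g i y \<partial>cell_kernel \<gamma> J i)" for i
  have cell: "(\<integral>\<^sup>+p. h i * indicator (A i) p \<partial>\<gamma>) = (\<integral>\<^sup>+p. g i (snd p) * indicator (A i) p \<partial>\<gamma>)" for i
  proof (cases "emeasure \<gamma> (A i) = 0")
    case True
    then have "AE p in \<gamma>. p \<notin> A i" by (intro AE_not_in) (auto simp: null_sets_def)
    then show ?thesis by (intro nn_integral_cong_AE) (auto elim: eventually_mono)
  next
    case False
    then have "h i = (\<integral>\<^sup>+p. g i (snd p) \<partial>uniform_measure \<gamma> (A i))"
      unfolding h_def cell_kernel_def A_def[symmetric] by (simp add: nn_integral_distr)
    also have "\<dots> = (\<integral>\<^sup>+p. g i (snd p) * indicator (A i) p \<partial>\<gamma>) / emeasure \<gamma> (A i)"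
      by (rule nn_integral_uniform_measure) measurable
    finally have "h i * emeasure \<gamma> (A i) = (\<integral>\<^sup>+p. g i (snd p) * indicator (A i) p \<partial>\<gamma>)"
      using False by (simp add: ennreal_divide_times ennreal_divide_self emeasure_eq_measure)
    then show ?thesis by (simp add: nn_integral_cmult_indicator)
  qed
  have "(\<integral>\<^sup>+x. \<integral>\<^sup>+y. g (J x) y \<partial>cell_kernel \<gamma> J (J x) \<partial>\<mu>) = (\<integral>\<^sup>+x. h (J x) \<partial>distr \<gamma> borel fst)"
    by (simp add: \<gamma>(3) h_def)
  also have "\<dots> = (\<integral>\<^sup>+p. h (J (fst p)) \<partial>\<gamma>)"
    by (subst nn_integral_distr) auto
  also have "\<dots> = (\<Sum>i. \<integral>\<^sup>+p. h i * indicator (A i) p \<partial>\<gamma>)"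
    unfolding A_def by (rule nn_integral_eq_suminf_index[where F="\<lambda>i p. h i"]) measurable
  also have "\<dots> = (\<Sum>i. \<integral>\<^sup>+p. g i (snd p) * indicator (A i) p \<partial>\<gamma>)"
    by (simp add: cell)
  also have "\<dots> = (\<integral>\<^sup>+p. g (J (fst p)) (snd p) \<partial>\<gamma>)"
    unfolding A_def
    by (rule nn_integral_eq_suminf_index[symmetric, where F="\<lambda>i p. g i (snd p)"]) measurable
  finally show ?thesis .
qed

lemma measurable_cell_kernel:
  assumes "\<gamma> \<in> couplings \<mu> \<nu>" and [measurable]: "J \<in> measurable borel (count_space UNIV)"
  shows "(\<lambda>x. cell_kernel \<gamma> J (J x)) \<in> borel \<rightarrow>\<^sub>M prob_algebra borel"
  by (rule measurable_compose[OF assms(2)])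
    (auto simp: space_prob_algebra_borel cell_kernel_space[OF assms(1)])

lemma kernel_subprob:
  "K \<in> M \<rightarrow>\<^sub>M prob_algebra N \<Longrightarrow> \<mu> \<in> borel_probs \<Longrightarrow> sets M = sets borel \<Longrightarrow>
     K \<in> \<mu> \<rightarrow>\<^sub>M subprob_algebra N"
  by (auto simp: borel_probs_def cong: measurable_cong_sets intro: measurable_prob_algebraD)

text \<open>Gluing by enlarging the probability space: a new coordinate is drawn from
  \<open>K (X w)\<close>, while all random variables on \<open>M\<close> keep their joint law.
  Iterating this replaces the gluing of couplings along common marginals.\<close>

lemma extend_by_kernel:
  fixes K :: "'a::topological_space \<Rightarrow> 'a measure"
  assumes "prob_space M" and X[measurable]: "X \<in> measurable M borel"
    and K[measurable]: "K \<in> borel \<rightarrow>\<^sub>M prob_algebra borel"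
  obtains N where "prob_space N" "sets N = sets (M \<Otimes>\<^sub>M borel)" "distr N M fst = M"
    "distr N borel snd = distr M borel X \<bind> K"
    "\<And>g. g \<in> borel_measurable (M \<Otimes>\<^sub>M borel) \<Longrightarrow>
       (\<integral>\<^sup>+p. g p \<partial>N) = (\<integral>\<^sup>+w. \<integral>\<^sup>+y. g (w, y) \<partial>K (X w) \<partial>M)"
proof -
  interpret prob_space M by fact
  define L where "L w = distr (K (X w)) (M \<Otimes>\<^sub>M borel) (Pair w)" for w
  have L: "L \<in> M \<rightarrow>\<^sub>M prob_algebra (M \<Otimes>\<^sub>M borel)"
    unfolding L_def by (rule measurable_distr_prob_space2[where M=borel]) auto
  have M: "M \<in> space (prob_algebra M)" by (simp add: space_prob_algebra assms(1))
  define N where "N = M \<bind> L"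
  have N: "prob_space N" "sets N = sets (M \<Otimes>\<^sub>M borel)"
    unfolding N_def by (rule prob_space_bind'[OF M L], rule sets_bind'[OF M L])
  note N(2)[measurable_cong]
  have KX: "K (X w) \<in> borel_probs" if "w \<in> space M" for w
    using measurable_space[OF K, of "X w"] by (simp add: space_prob_algebra_borel)
  have g: "(\<integral>\<^sup>+p. g p \<partial>N) = (\<integral>\<^sup>+w. \<integral>\<^sup>+y. g (w, y) \<partial>K (X w) \<partial>M)"
    if [measurable]: "g \<in> borel_measurable (M \<Otimes>\<^sub>M borel)" for g
  proof -
    have "(\<integral>\<^sup>+p. g p \<partial>N) = (\<integral>\<^sup>+w. \<integral>\<^sup>+p. g p \<partial>L w \<partial>M)"
      unfolding N_def by (rule nn_integral_bind[OF that measurable_prob_algebraD[OF L]])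
    also have "\<dots> = (\<integral>\<^sup>+w. \<integral>\<^sup>+y. g (w, y) \<partial>K (X w) \<partial>M)"
    proof (rule nn_integral_cong)
      fix w assume w: "w \<in> space M"
      note borel_probsD(2)[OF KX[OF w], measurable_cong]
      show "(\<integral>\<^sup>+p. g p \<partial>L w) = (\<integral>\<^sup>+y. g (w, y) \<partial>K (X w))"
        unfolding L_def using w by (subst nn_integral_distr) auto
    qed
    finally show ?thesis .
  qed
  have "distr N M fst = M"
  proof (rule measure_eqI)
    fix S assume "S \<in> sets (distr N M fst)"
    then have [measurable]: "S \<in> sets M" by simp
    have "emeasure (distr N M fst) S = (\<integral>\<^sup>+x. indicator S x \<partial>distr N M fst)"
      by simp
    also have "\<dots> = (\<integral>\<^sup>+p. indicator S (fst p) \<partial>N)"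
      by (rule nn_integral_distr) auto
    also have "\<dots> = (\<integral>\<^sup>+w. \<integral>\<^sup>+y. indicator S w \<partial>K (X w) \<partial>M)"
      by (subst g) auto
    also have "\<dots> = (\<integral>\<^sup>+w. indicator S w \<partial>M)"
      by (intro nn_integral_cong) (simp add: prob_space.emeasure_space_1[OF borel_probsD(1)[OF KX]])
    finally show "emeasure (distr N M fst) S = emeasure M S" by simp
  qed simp
  moreover have "distr N borel snd = distr M borel X \<bind> K"
  proof (rule measure_eqI)
    have D: "distr M borel X \<in> space (prob_algebra borel)"
      by (simp add: space_prob_algebra prob_space_distr)
    show "sets (distr N borel snd) = sets (distr M borel X \<bind> K)"
      using sets_bind'[OF D K] by simp
    fix S assume "S \<in> sets (distr N borel snd)"
    then have [measurable]: "S \<in> sets borel" by simp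
    have "emeasure (distr N borel snd) S = (\<integral>\<^sup>+x. indicator S x \<partial>distr N borel snd)"
      by simp
    also have "\<dots> = (\<integral>\<^sup>+p. indicator S (snd p) \<partial>N)"
      by (rule nn_integral_distr) auto
    also have "\<dots> = (\<integral>\<^sup>+w. \<integral>\<^sup>+y. indicator S y \<partial>K (X w) \<partial>M)"
      by (subst g) auto
    also have "\<dots> = (\<integral>\<^sup>+w. emeasure (K (X w)) S \<partial>M)"
      by (intro nn_integral_cong nn_integral_indicator) (simp add: borel_probsD(2)[OF KX])
    also have "\<dots> = (\<integral>\<^sup>+x. emeasure (K x) S \<partial>distr M borel X)"
      by (subst nn_integral_distr) (auto intro: measurable_compose[OF measurable_prob_algebraD[OF K] measurable_emeasure_subprob_algebra])
    also have "\<dots> = emeasure (distr M borel X \<bind> K) S"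
      by (rule emeasure_bind_prob_algebra[OF D K, symmetric]) simp
    finally show "emeasure (distr N borel snd) S = emeasure (distr M borel X \<bind> K) S" .
  qed
  ultimately show ?thesis using that N g by blast
qed

lemma nn_integral_of_distr:
  assumes "distr N M f = M" "f \<in> measurable N M" "g \<in> borel_measurable M"
  shows "(\<integral>\<^sup>+p. g (f p) \<partial>N) = (\<integral>\<^sup>+w. g w \<partial>M)"
proof -
  have "(\<integral>\<^sup>+p. g (f p) \<partial>N) = (\<integral>\<^sup>+w. g w \<partial>distr N M f)"
    using assms(2,3) by (intro nn_integral_distr[symmetric]) auto
  then show ?thesis using assms(1) by simp
qed

lemma distr_through_fst:
  assumes "distr Q N fst = N" "sets Q = sets (N \<Otimes>\<^sub>M borel)" "X \<in> measurable N borel"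
  shows "distr Q borel (\<lambda>p. X (fst p)) = distr N borel X"
proof -
  note assms(2)[measurable_cong]
  have "distr Q borel (\<lambda>p. X (fst p)) = distr (distr Q N fst) borel X"
    using assms(3) by (subst distr_distr) (auto simp: comp_def)
  then show ?thesis using assms(1) by simp
qed

text \<open>Only the laws of single coordinates and of consecutive pairs are recorded, because the
  completeness proof estimates the chain through its increments alone.\<close>

lemma markov_chain:
  fixes K :: "nat \<Rightarrow> 'a::topological_space \<Rightarrow> 'a measure"
  assumes "\<And>n. \<mu> n \<in> borel_probs" and K[measurable]: "\<And>n. K n \<in> borel \<rightarrow>\<^sub>M prob_algebra borel"
    and step: "\<And>n. \<mu> n \<bind> K n = \<mu> (Suc n)"
  obtains M :: "(nat \<Rightarrow> 'a) measure" where "prob_space M" "\<And>n. (\<lambda>w. w n) \<in> measurable M borel"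
    "\<And>n. distr M borel (\<lambda>w. w n) = \<mu> n"
    "\<And>n g. g \<in> borel_measurable (borel \<Otimes>\<^sub>M borel) \<Longrightarrow>
       (\<integral>\<^sup>+w. g (w n, w (Suc n)) \<partial>M) = (\<integral>\<^sup>+x. \<integral>\<^sup>+y. g (x, y) \<partial>K n x \<partial>\<mu> n)"
proof -
  have "K n x \<in> borel_probs" for n x
    using measurable_space[OF K[of n], of x] by (simp add: space_prob_algebra_borel)
  from borel_probsD(2)[OF this] have setsK: "sets (K n x) = sets borel" for n x .
  \<comment> \<open>Stage i of the Ionescu-Tulcea construction draws coordinate i from the history
    below i: the empty history gives the initial law, every later stage looks only at the last
    coordinate.\<close>
  define P where "P i w = (case i of 0 \<Rightarrow> \<mu> 0 | Suc j \<Rightarrow> K j (w j))" for i and w :: "nat \<Rightarrow> 'a"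
  have P: "P i \<in> PiM {0..<i} (\<lambda>_. borel) \<rightarrow>\<^sub>M prob_algebra borel" for i
  proof (cases i)
    case 0
    then show ?thesis using assms(1)[of 0] by (simp add: P_def[abs_def] space_prob_algebra_borel)
  next
    case (Suc j)
    then show ?thesis
      unfolding P_def[abs_def] by (auto intro!: measurable_compose[OF _ K] measurable_component_singleton)
  qed
  have Pprob: "P i w \<in> borel_probs" if "w \<in> space (PiM {0..<i} (\<lambda>_. borel))" for i w
    using measurable_space[OF P that] by (simp add: space_prob_algebra_borel)
  interpret IT: Ionescu_Tulcea P "\<lambda>_. borel"
    by (rule Ionescu_Tulcea.intro[OF measurable_prob_algebraD[OF P] borel_probsD(1)[OF Pprob]])
  \<comment> \<open>The law of the coordinates below n, so that coordinate n first appears in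
    \<open>Q (Suc n)\<close>.\<close>
  define Q where "Q n = IT.C 0 n (\<lambda>_. undefined)" for n
  have u: "(\<lambda>_. undefined) \<in> space (PiM {0..<0::nat} (\<lambda>_. borel :: 'a measure))"
    by (simp add: space_PiM)
  have setsQ[measurable_cong]: "sets (Q n) = sets (PiM {0..<n} (\<lambda>_. borel))" for n
    using IT.sets_C[OF u, of n] by (simp add: Q_def)
  have measQ: "(\<lambda>w. w i) \<in> measurable (Q n) borel" if "i < n" for i n
    using measurable_component_singleton[of i "{0..<n}" "\<lambda>_. borel :: 'a measure"] that
    by (simp cong: measurable_cong_sets add: setsQ)
  have spaceQ: "space (Q n) = space (PiM {0..<n} (\<lambda>_. borel))" for n
    by (rule sets_eq_imp_space_eq[OF setsQ])
  have probQ: "prob_space (Q n)" for n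
    using IT.prob_space_C[OF u, of n] by (simp add: Q_def)
  have QSuc: "(\<integral>\<^sup>+w. f w \<partial>Q (Suc n)) = (\<integral>\<^sup>+w. \<integral>\<^sup>+y. f (w(n := y)) \<partial>P n w \<partial>Q n)"
    if f: "f \<in> borel_measurable (PiM {0..<Suc n} (\<lambda>_. borel))" for f n
  proof -
    have "IT.eP n \<in> Q n \<rightarrow>\<^sub>M subprob_algebra (PiM {0..<Suc n} (\<lambda>_. borel))"
      using IT.measurable_eP[of n] by (simp cong: measurable_cong_sets add: setsQ)
    then have "(\<integral>\<^sup>+w. f w \<partial>Q (Suc n)) = (\<integral>\<^sup>+w. \<integral>\<^sup>+v. f v \<partial>IT.eP n w \<partial>Q n)"
      unfolding Q_def IT.C.simps(2) by (simp add: nn_integral_bind[OF f])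
    also have "\<dots> = (\<integral>\<^sup>+w. \<integral>\<^sup>+y. f (w(n := y)) \<partial>P n w \<partial>Q n)"
      by (intro nn_integral_cong IT.nn_integral_eP f) (simp add: spaceQ)
    finally show ?thesis .
  qed
  have law: "distr (Q (Suc n)) borel (\<lambda>w. w n) = \<mu> n" for n
  proof (induction n)
    case 0
    show ?case
    proof (rule measure_eqI)
      show "sets (distr (Q (Suc 0)) borel (\<lambda>w. w 0)) = sets (\<mu> 0)"
        using borel_probsD(2)[OF assms(1)] by simp
      fix S assume "S \<in> sets (distr (Q (Suc 0)) borel (\<lambda>w. w 0))"
      then have [measurable]: "S \<in> sets borel" by simp
      have [measurable]: "(\<lambda>w. w 0) \<in> measurable (Q (Suc 0)) borel" by measurable
      have "emeasure (distr (Q (Suc 0)) borel (\<lambda>w. w 0)) S = (\<integral>\<^sup>+x. indicator S x \<partial>distr (Q (Suc 0)) borel (\<lambda>w. w 0))"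
        by simp
      also have "\<dots> = (\<integral>\<^sup>+w. indicator S (w 0) \<partial>Q (Suc 0))"
        by (rule nn_integral_distr) auto
      also have "\<dots> = (\<integral>\<^sup>+w. \<integral>\<^sup>+y. indicator S y \<partial>\<mu> 0 \<partial>Q 0)"
        by (subst QSuc) (auto simp: P_def)
      also have "\<dots> = emeasure (\<mu> 0) S"
        using borel_probsD(2)[OF assms(1)] prob_space.emeasure_space_1[OF probQ] by simp
      finally show "emeasure (distr (Q (Suc 0)) borel (\<lambda>w. w 0)) S = emeasure (\<mu> 0) S" .
    qed
  next
    case (Suc n)
    show ?case
    proof (rule measure_eqI)
      show "sets (distr (Q (Suc (Suc n))) borel (\<lambda>w. w (Suc n))) = sets (\<mu> (Suc n))"
        using borel_probsD(2)[OF assms(1)] by simp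
      fix S assume "S \<in> sets (distr (Q (Suc (Suc n))) borel (\<lambda>w. w (Suc n)))"
      then have [measurable]: "S \<in> sets borel" by simp
      have "emeasure (distr (Q (Suc (Suc n))) borel (\<lambda>w. w (Suc n))) S
          = (\<integral>\<^sup>+x. indicator S x \<partial>distr (Q (Suc (Suc n))) borel (\<lambda>w. w (Suc n)))"
        by simp
      also have "\<dots> = (\<integral>\<^sup>+w. indicator S (w (Suc n)) \<partial>Q (Suc (Suc n)))"
        by (rule nn_integral_distr) auto
      also have "\<dots> = (\<integral>\<^sup>+w. \<integral>\<^sup>+y. indicator S y \<partial>K n (w n) \<partial>Q (Suc n))"
        by (subst QSuc) (auto simp: P_def)
      also have "\<dots> = (\<integral>\<^sup>+x. \<integral>\<^sup>+y. indicator S y \<partial>K n x \<partial>distr (Q (Suc n)) borel (\<lambda>w. w n))"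
        by (subst nn_integral_distr)
          (auto intro!: nn_integral_measurable_subprob_algebra2[where N=borel] measurable_prob_algebraD)
      also have "\<dots> = (\<integral>\<^sup>+x. emeasure (K n x) S \<partial>\<mu> n)"
        unfolding Suc by (intro nn_integral_cong nn_integral_indicator) (simp add: setsK)
      also have "\<dots> = emeasure (\<mu> (Suc n)) S"
        using emeasure_bind_prob_algebra[OF _ K, of "\<mu> n" S n] step[of n] assms(1)[of n]
        by (simp add: space_prob_algebra_borel)
      finally show "emeasure (distr (Q (Suc (Suc n))) borel (\<lambda>w. w (Suc n))) S = emeasure (\<mu> (Suc n)) S" .
    qed
  qed
  define M where "M = IT.PF.lim"
  have setsM[measurable_cong]: "sets M = sets (PiM UNIV (\<lambda>_. borel))"
    unfolding M_def by (rule IT.PF.sets_lim)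
  have CI: "IT.CI {0..<n} = Q n" for n
  proof -
    have up: "IT.up_to {0..<n} = n"
    proof (rule antisym)
      show "IT.up_to {0..<n} \<le> n" by (simp add: IT.up_to_iff)
      show "n \<le> IT.up_to {0..<n}" using IT.up_to[of "{0..<n}"] by (cases n) auto
    qed
    have "IT.CI {0..<n} = distr (Q n) (PiM {0..<n} (\<lambda>_. borel)) (\<lambda>f. restrict f {0..<n})"
      unfolding IT.CI_def up Q_def ..
    also have "\<dots> = distr (Q n) (Q n) (\<lambda>f. f)"
      by (rule distr_cong) (auto simp: setsQ spaceQ space_PiM)
    finally show ?thesis by simp
  qed
  have MQ: "distr M (PiM {0..<n} (\<lambda>_. borel)) (\<lambda>w. restrict w {0..<n}) = Q n" for n
    unfolding M_def CI[symmetric] by (rule IT.distr_lim) simp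
  have res[measurable]: "(\<lambda>w. restrict w {0..<n}) \<in> measurable M (PiM {0..<n} (\<lambda>_. borel))" for n
    by (intro measurable_restrict) measurable
  have meas[measurable]: "(\<lambda>w. w n) \<in> measurable M borel" for n
    by measurable
  have nnM: "(\<integral>\<^sup>+w. f (restrict w {0..<n}) \<partial>M) = (\<integral>\<^sup>+w. f w \<partial>Q n)"
    if [measurable]: "f \<in> borel_measurable (PiM {0..<n} (\<lambda>_. borel))" for f n
    unfolding MQ[symmetric] by (rule nn_integral_distr[symmetric, OF res]) simp
  have lawM: "distr M borel (\<lambda>w. w n) = \<mu> n" for n
  proof -
    have "distr M borel (\<lambda>w. w n) = distr (Q (Suc n)) borel (\<lambda>w. w n)"
      unfolding MQ[of "Suc n", symmetric] by (subst distr_distr) (auto simp: comp_def)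
    then show ?thesis by (simp add: law)
  qed
  have pairM: "(\<integral>\<^sup>+w. g (w n, w (Suc n)) \<partial>M) = (\<integral>\<^sup>+x. \<integral>\<^sup>+y. g (x, y) \<partial>K n x \<partial>\<mu> n)"
    if [measurable]: "g \<in> borel_measurable (borel \<Otimes>\<^sub>M borel)" for g n
  proof -
    have "(\<integral>\<^sup>+w. g (w n, w (Suc n)) \<partial>M) = (\<integral>\<^sup>+w. g (w n, w (Suc n)) \<partial>Q (Suc (Suc n)))"
      using nnM[of "\<lambda>w. g (w n, w (Suc n))" "Suc (Suc n)"] by simp
    also have "\<dots> = (\<integral>\<^sup>+w. \<integral>\<^sup>+y. g (w n, y) \<partial>K n (w n) \<partial>Q (Suc n))"
      by (subst QSuc) (auto simp: P_def)
    also have "\<dots> = (\<integral>\<^sup>+x. \<integral>\<^sup>+y. g (x, y) \<partial>K n x \<partial>distr (Q (Suc n)) borel (\<lambda>w. w n))"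
      by (subst nn_integral_distr)
        (auto intro!: nn_integral_measurable_subprob_algebra2[where N=borel] measurable_prob_algebraD measQ)
    finally show ?thesis by (simp add: law)
  qed
  have "prob_space M"
    using prob_space_distrD[OF meas[of 0]] borel_probsD(1)[OF assms(1), of 0] lawM[of 0] by simp
  then show ?thesis using that meas lawM pairM by blast
qed

section \<open>Dini derivatives and partitions\<close>

text \<open>Continuous induction on the largest initial interval on which \<open>f \<le> u\<close>.
  \<open>lsc\<close> carries the inequality to its right end r, and \<open>dini\<close> together
  with \<open>strict\<close> carries it beyond r as long as r < T. Since \<open>v\<close> enters as
  a lower slope of \<open>u\<close>, neither function is differentiated, and \<open>f\<close> may
  jump downwards.\<close>

lemma dini_comparison:
  fixes f g u v :: "real \<Rightarrow> real"
  assumes lsc: "\<And>t e. 0 < t \<Longrightarrow> t \<le> T \<Longrightarrow> 0 < e \<Longrightarrow> \<exists>d>0. \<forall>s. 0 \<le> s \<longrightarrow> t - d < s \<longrightarrow> s < t \<longrightarrow> f t \<le> f s + e"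
    and dini: "\<And>t e. 0 \<le> t \<Longrightarrow> t < T \<Longrightarrow> 0 < e \<Longrightarrow> \<exists>d>0. \<forall>h. 0 < h \<longrightarrow> h < d \<longrightarrow> f (t + h) \<le> f t + h * (g t + \<beta> * f t + e)"
    and cont: "continuous_on UNIV u"
    and super: "\<And>t h. 0 \<le> t \<Longrightarrow> 0 \<le> h \<Longrightarrow> u t + h * v t \<le> u (t + h)"
    and strict: "\<And>t. 0 \<le> t \<Longrightarrow> t < T \<Longrightarrow> g t + \<beta> * u t < v t"
    and "0 \<le> \<beta>" "f 0 \<le> u 0" "0 \<le> t" "t \<le> T"
  shows "f t \<le> u t"
proof -
  define S where "S = {t. 0 \<le> t \<and> t \<le> T \<and> (\<forall>s. 0 \<le> s \<longrightarrow> s \<le> t \<longrightarrow> f s \<le> u s)}"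
  have "0 \<in> S" using assms by (auto simp: S_def intro: order_antisym)
  have bdd: "bdd_above S" by (auto simp: S_def bdd_above_def)
  define r where "r = Sup S"
  have r: "0 \<le> r" "r \<le> T"
    using \<open>0 \<in> S\<close> bdd unfolding r_def
    by (auto intro: cSup_upper intro!: cSup_least simp: S_def)
  have below: "f s \<le> u s" if "0 \<le> s" "s < r" for s
  proof -
    have "S \<noteq> {}" using \<open>0 \<in> S\<close> by blast
    then obtain q where "q \<in> S" "s < q"
      using \<open>s < r\<close> unfolding r_def by (metis less_cSupD)
    then show ?thesis using \<open>0 \<le> s\<close> by (auto simp: S_def)
  qed
  have at: "f r \<le> u r"
  proof (cases "r = 0")
    case False
    show ?thesis
    proof (rule field_le_epsilon)
      fix e :: real assume "e > 0"
      obtain d where d: "d > 0" "\<forall>s. 0 \<le> s \<longrightarrow> r - d < s \<longrightarrow> s < r \<longrightarrow> f r \<le> f s + e / 2"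
        using lsc[of r "e/2"] r False \<open>e > 0\<close> by auto
      have "isCont u r" using cont by (simp add: continuous_on_eq_continuous_at)
      then obtain d' where d': "d' > 0" "\<forall>s. dist s r < d' \<longrightarrow> dist (u s) (u r) < e / 2"
        using \<open>e > 0\<close> unfolding continuous_at_eps_delta by (metis half_gt_zero)
      define s where "s = max 0 (r - min d d' / 2)"
      have s: "0 \<le> s" "s < r" "r - d < s" "\<bar>s - r\<bar> < d'"
        using r False d d' by (auto simp: s_def)
      then have "f r \<le> f s + e / 2" "\<bar>u s - u r\<bar> < e / 2" "f s \<le> u s"
        using d d' below[of s] by (auto simp: dist_real_def)
      then show "f r \<le> u r + e" by linarith
    qed
  qed (use assms in auto)
  have "r = T"
  proof (rule ccontr)
    assume "r \<noteq> T"
    then have "r < T" using r by simp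
    \<comment> \<open>The entire gap in \<open>strict\<close> at r is spent as slack of the Dini
      bound, whose slope is then at most \<open>v r\<close>.\<close>
    define e where "e = v r - g r - \<beta> * u r"
    have "e > 0" using strict[of r] r \<open>r < T\<close> by (simp add: e_def)
    obtain d where d: "d > 0" "\<And>h. 0 < h \<Longrightarrow> h < d \<Longrightarrow> f (r + h) \<le> f r + h * (g r + \<beta> * f r + e)"
      using dini[OF r(1) \<open>r < T\<close> \<open>e > 0\<close>] by blast
    define h where "h = min (d / 2) (T - r)"
    have h: "0 < h" "h < d" "r + h \<le> T" using d \<open>r < T\<close> by (auto simp: h_def)
    have "f s \<le> u s" if "0 \<le> s" "s \<le> r + h" for s
    proof (cases "s < r \<or> s = r")
      case True
      then show ?thesis using below that at by auto
    next
      case False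
      define k where "k = s - r"
      have k: "0 < k" "k < d" "s = r + k" using False that h by (auto simp: k_def)
      have "f s \<le> f r + k * (g r + \<beta> * f r + e)" using d(2)[OF k(1,2)] k(3) by simp
      also have "\<dots> \<le> u r + k * (g r + \<beta> * u r + e)"
        using at k(1) \<open>0 \<le> \<beta>\<close> by (intro add_mono mult_left_mono) auto
      also have "\<dots> = u r + k * v r" by (simp add: e_def)
      also have "\<dots> \<le> u s" using super[of r k] r k by simp
      finally show ?thesis .
    qed
    then have "r + h \<in> S" using h r by (auto simp: S_def)
    then have "r + h \<le> r" using bdd unfolding r_def by (intro cSup_upper)
    then show False using h by simp
  qed
  then show ?thesis using below[of t] at assms by (cases "t = T") auto
qed

text \<open>By compactness. It is applied to \<open>W (\<rho> t) (\<sigma> t)\<close> along two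
  curves, for which the relaxed triangle inequality yields local bounds but no continuity.\<close>

lemma locally_bounded_imp_bounded:
  fixes f :: "real \<Rightarrow> real"
  assumes "\<And>t. t \<in> {0..T} \<Longrightarrow> \<exists>d>0. \<exists>C. \<forall>s\<in>{0..T}. \<bar>s - t\<bar> < d \<longrightarrow> f s \<le> C"
  shows "\<exists>C. \<forall>s\<in>{0..T}. f s \<le> C"
proof -
  obtain d C where d: "\<And>t. t \<in> {0..T} \<Longrightarrow> d t > 0"
    and C: "\<And>t s. t \<in> {0..T} \<Longrightarrow> s \<in> {0..T} \<Longrightarrow> \<bar>s - t\<bar> < d t \<Longrightarrow> f s \<le> C t"
    using assms by metis
  have cov: "{0..T} \<subseteq> (\<Union>t\<in>{0..T}. ball t (d t))" using d by fastforce
  obtain F where F: "F \<subseteq> {0..T}" "finite F" "{0..T} \<subseteq> (\<Union>t\<in>F. ball t (d t))"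
    by (rule compactE_image[OF compact_Icc _ cov]) auto
  have "f s \<le> Max (insert 0 (C ` F))" if s: "s \<in> {0..T}" for s
  proof -
    obtain t where t: "t \<in> F" "\<bar>s - t\<bar> < d t" using F(3) s by (auto simp: dist_real_def abs_minus_commute)
    then have "f s \<le> C t" using F(1) s by (intro C) auto
    also have "\<dots> \<le> Max (insert 0 (C ` F))" using F(2) t(1) by (intro Max_ge) auto
    finally show ?thesis .
  qed
  then show ?thesis by blast
qed

section \<open>Partitions of a time interval\<close>

definition next_point :: "real list \<Rightarrow> real \<Rightarrow> real" where
  "next_point \<Delta> t = Min {u \<in> set \<Delta>. t < u}"

lemma pc_approx_next_point: "pc_approx \<Delta> A t = A (next_point \<Delta> t)"
  by (simp add: pc_approx_def next_point_def)

lemma next_point: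
  assumes "is_partition T \<Delta>" "0 \<le> t" "t < T"
  shows "t < next_point \<Delta> t" "next_point \<Delta> t \<le> T" "next_point \<Delta> t \<le> t + mesh \<Delta>"
proof -
  have \<Delta>: "\<Delta> \<noteq> []" "sorted_wrt (<) \<Delta>" "hd \<Delta> = 0" "last \<Delta> = T"
    using assms(1) by (auto simp: is_partition_def)
  let ?U = "{u \<in> set \<Delta>. t < u}"
  have T: "T \<in> ?U" using \<Delta> assms(3) last_in_set by auto
  have "next_point \<Delta> t \<in> ?U" unfolding next_point_def using T by (intro Min_in) auto
  then show "t < next_point \<Delta> t" by simp
  show "next_point \<Delta> t \<le> T" unfolding next_point_def using T by (intro Min_le) auto
  define k where "k = Max {k. k < length \<Delta> \<and> \<Delta> ! k \<le> t}"
  have "0 \<in> {k. k < length \<Delta> \<and> \<Delta> ! k \<le> t}"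
    using \<Delta> assms(2) by (auto simp: hd_conv_nth)
  then have "k \<in> {k. k < length \<Delta> \<and> \<Delta> ! k \<le> t}" unfolding k_def by (intro Max_in) auto
  then have k: "k < length \<Delta>" "\<Delta> ! k \<le> t" by auto
  have "Suc k < length \<Delta>"
  proof (rule ccontr)
    assume "\<not> Suc k < length \<Delta>"
    then have "k = length \<Delta> - 1" using k by simp
    then have "\<Delta> ! k = T" using \<Delta> by (simp add: last_conv_nth)
    then show False using k assms(3) by simp
  qed
  moreover have "\<not> \<Delta> ! Suc k \<le> t"
  proof
    assume "\<Delta> ! Suc k \<le> t"
    then have "Suc k \<le> k" using \<open>Suc k < length \<Delta>\<close> unfolding k_def by (intro Max_ge) auto
    then show False by simp
  qed
  ultimately have "next_point \<Delta> t \<le> \<Delta> ! Suc k"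
    unfolding next_point_def by (intro Min_le) auto
  moreover have "\<Delta> ! Suc k - \<Delta> ! k \<le> mesh \<Delta>"
    unfolding mesh_def
  proof (rule Max_ge)
    have "{\<Delta> ! Suc k - \<Delta> ! k |k. Suc k < length \<Delta>} \<subseteq> (\<lambda>k. \<Delta> ! Suc k - \<Delta> ! k) ` {..<length \<Delta>}"
      by auto
    then show "finite {\<Delta> ! Suc k - \<Delta> ! k |k. Suc k < length \<Delta>}"
      by (rule finite_subset) simp
  qed (use \<open>Suc k < length \<Delta>\<close> in auto)
  ultimately show "next_point \<Delta> t \<le> t + mesh \<Delta>" using k by linarith
qed

lemma uniform_partition:
  assumes "T > 0" "N > 0"
  defines "\<Delta> \<equiv> map (\<lambda>i. real i * T / real N) [0..<Suc N]"
  shows "is_partition T \<Delta>" "mesh \<Delta> = T / real N"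
proof -
  show "is_partition T \<Delta>"
    using assms unfolding is_partition_def
    by (auto simp: sorted_wrt_map sorted_wrt_iff_nth_less hd_map hd_upt divide_strict_right_mono simp del: upt_Suc)
      (simp add: last_map)
  have nth: "\<Delta> ! i = real i * T / real N" if "i < Suc N" for i
    unfolding \<Delta>_def using that by (simp del: upt_Suc)
  have "{\<Delta> ! Suc k - \<Delta> ! k |k. Suc k < length \<Delta>} = {T / real N}"
  proof (intro equalityI subsetI)
    fix x assume "x \<in> {\<Delta> ! Suc k - \<Delta> ! k |k. Suc k < length \<Delta>}"
    then obtain k where "Suc k < Suc N" "x = \<Delta> ! Suc k - \<Delta> ! k" by (auto simp: \<Delta>_def)
    then show "x \<in> {T / real N}" by (simp add: nth diff_divide_distrib[symmetric] algebra_simps)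
  next
    fix x assume "x \<in> {T / real N}"
    then have "x = \<Delta> ! Suc 0 - \<Delta> ! 0 \<and> Suc 0 < length \<Delta>"
      using \<open>N > 0\<close> nth[of 0] nth[of "Suc 0"] by (auto simp: \<Delta>_def simp del: upt_Suc)
    then show "x \<in> {\<Delta> ! Suc k - \<Delta> ! k |k. Suc k < length \<Delta>}" by blast
  qed
  then show "mesh \<Delta> = T / real N" by (simp add: mesh_def)
qed

lemma partition_exists:
  assumes "T > 0" "d > 0"
  obtains \<Delta> where "is_partition T \<Delta>" "mesh \<Delta> < d"
proof -
  obtain N where N: "T / d < real N" using reals_Archimedean2 by blast
  then have "N > 0" using assms by (intro gr0I) (auto simp: divide_less_0_iff not_less)
  moreover have "T / real N < d" using N assms \<open>N > 0\<close> by (simp add: field_simps)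
  ultimately show ?thesis using that uniform_partition[OF assms(1)] by metis
qed

section \<open>Semimetric spaces\<close>

locale complete_semimetric_space =
  fixes c :: "'a::topological_space \<Rightarrow> 'a \<Rightarrow> real" and B :: real
  assumes semimetric: "semimetric c"
    and generates_topology: "generates_topology c"
    and sm_complete: "sm_complete c"
    and separable: "separable_space (euclidean :: 'a topology)"
    and locally_compact: "locally_compact_space (euclidean :: 'a topology)"
    and sm_continuous: "sm_continuous c"
    and B_ge_1: "B \<ge> 1"
    and relaxed_triangle: "c x y \<le> B * (c x z + c z y)"

begin

abbreviation sball :: "'a \<Rightarrow> real \<Rightarrow> 'a set" where
  "sball x r \<equiv> {y. c x y < r}"

lemma c_nonneg [simp]: "0 \<le> c x y"
  and c_refl [simp]: "c x x = 0"
  and c_commute: "c x y = c y x"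
  using semimetric unfolding semimetric_def by auto

text \<open>Failure at all the radii 1/(n+1) would produce two convergent sequences that contradict
  \<open>sm_continuous\<close>.\<close>

lemma c_jointly_continuous:
  assumes "e > 0"
  shows "\<exists>r>0. \<forall>u v. c x u < r \<longrightarrow> c y v < r \<longrightarrow> \<bar>c u v - c x y\<bar> < e"
proof (rule ccontr)
  assume "\<not> ?thesis"
  then have "\<exists>u v. c x u < 1 / real (Suc n) \<and> c y v < 1 / real (Suc n) \<and> \<bar>c u v - c x y\<bar> \<ge> e" for n
    by (meson not_less of_nat_0_less_iff zero_less_Suc zero_less_divide_1_iff)
  then obtain u v where uv: "c x (u n) < 1 / real (Suc n)" "c y (v n) < 1 / real (Suc n)"
    "\<bar>c (u n) (v n) - c x y\<bar> \<ge> e" for n by metis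
  have "(\<lambda>n. c (u n) x) \<longlonglongrightarrow> 0"
    by (rule tendsto_sandwich[OF _ _ tendsto_const LIMSEQ_inverse_real_of_nat])
      (use uv(1) in \<open>auto simp: c_commute[of _ x] inverse_eq_divide less_imp_le\<close>)
  moreover have "(\<lambda>n. c (v n) y) \<longlonglongrightarrow> 0"
    by (rule tendsto_sandwich[OF _ _ tendsto_const LIMSEQ_inverse_real_of_nat])
      (use uv(2) in \<open>auto simp: c_commute[of _ y] inverse_eq_divide less_imp_le\<close>)
  ultimately have "(\<lambda>n. c (u n) (v n)) \<longlonglongrightarrow> c x y"
    using sm_continuous unfolding sm_continuous_def sm_converges_def by blast
  then have "eventually (\<lambda>n. \<bar>c (u n) (v n) - c x y\<bar> < e) sequentially"
    using \<open>e > 0\<close> by (auto simp: tendsto_iff dist_real_def)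
  then show False
    using uv(3) by (auto simp: eventually_sequentially not_less[symmetric])
qed

lemma open_sball: "open (sball x r)"
proof (cases "r > 0")
  case True
  then show ?thesis
    using generates_topology unfolding generates_topology_def
    by (auto intro!: generate_topology.Basis)
next
  case False
  then have "sball x r = {}"
    using c_nonneg by (auto simp: not_less intro: order_trans)
  then show ?thesis by (metis open_empty)
qed

text \<open>The balls are given only as a subbase. That each is a neighbourhood of all its points
  rests on the joint continuity of \<open>c\<close>; for B > 1 the relaxed triangle inequality alone
  would not give it.\<close>

lemma open_iff_sball: "open U \<longleftrightarrow> (\<forall>x\<in>U. \<exists>r>0. sball x r \<subseteq> U)"
proof
  assume "open U"
  then have "generate_topology {{y. c x y < r} |x r. 0 < r} U"
    using generates_topology unfolding generates_topology_def by auto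
  then show "\<forall>x\<in>U. \<exists>r>0. sball x r \<subseteq> U"
  proof induction
    case UNIV
    then show ?case by (auto intro: exI[of _ 1])
  next
    case (Int a b)
    show ?case
    proof
      fix x assume "x \<in> a \<inter> b"
      then obtain r s where "r > 0" "s > 0" "sball x r \<subseteq> a" "sball x s \<subseteq> b"
        using Int by blast
      then show "\<exists>r>0. sball x r \<subseteq> a \<inter> b"
        by (intro exI[of _ "min r s"]) auto
    qed
  next
    case (UN K)
    then show ?case by (meson Sup_upper UnionE order_trans)
  next
    case (Basis s)
    then obtain x r where s: "s = sball x r" "0 < r" by auto
    show ?case
    proof
      fix y assume "y \<in> s"
      then have "r - c x y > 0" using s by auto
      then obtain \<rho> where "\<rho> > 0"
        and \<rho>: "\<forall>u v. c x u < \<rho> \<longrightarrow> c y v < \<rho> \<longrightarrow> \<bar>c u v - c x y\<bar> < r - c x y"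
        using c_jointly_continuous by blast
      then have "sball y \<rho> \<subseteq> s"
        unfolding s using \<rho>[rule_format, of x] by (smt (verit, best) c_refl mem_Collect_eq subsetI)
      then show "\<exists>r>0. sball y r \<subseteq> s" using \<open>\<rho> > 0\<close> by blast
    qed
  qed
next
  assume U: "\<forall>x\<in>U. \<exists>r>0. sball x r \<subseteq> U"
  then have "U = \<Union>{sball x r |x r. sball x r \<subseteq> U}"
    by auto (metis c_refl mem_Collect_eq)
  also have "open \<dots>"
    using open_sball by (intro open_Union) auto
  finally show "open U" .
qed

lemma continuous_c: "continuous_on UNIV (c x)"
proof (subst continuous_on_open_vimage[OF open_UNIV], intro allI impI)
  fix V :: "real set" assume V: "open V"
  show "open (c x -` V \<inter> UNIV)"
    unfolding open_iff_sball
  proof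
    fix y assume "y \<in> c x -` V \<inter> UNIV"
    then obtain e where "e > 0" and e: "\<forall>z. \<bar>z - c x y\<bar> < e \<longrightarrow> z \<in> V"
      using V unfolding open_dist dist_real_def by auto
    obtain r where "r > 0" and r: "\<forall>u v. c x u < r \<longrightarrow> c y v < r \<longrightarrow> \<bar>c u v - c x y\<bar> < e"
      using c_jointly_continuous[OF \<open>e > 0\<close>] by blast
    then show "\<exists>r>0. sball y r \<subseteq> c x -` V \<inter> UNIV"
      using e by (intro exI[of _ r]) auto
  qed
qed

lemma measurable_c_left [measurable]: "c x \<in> borel_measurable borel"
  by (rule borel_measurable_continuous_onI[OF continuous_c])

section \<open>A dense sequence and measurability\<close>

definition dense_seq :: "nat \<Rightarrow> 'a" where
  "dense_seq = (SOME d. \<forall>x r. r > 0 \<longrightarrow> (\<exists>n. c (d n) x < r))"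

lemma dense_seq:
  assumes "r > 0"
  obtains n where "c (dense_seq n) x < r"
proof -
  obtain D :: "'a set" where D: "countable D" "closure D = UNIV"
    using separable unfolding separable_space_def by auto
  then have "D \<noteq> {}" by auto
  have "\<forall>x r. r > 0 \<longrightarrow> (\<exists>n. c (from_nat_into D n) x < r)"
  proof (intro allI impI)
    fix x r assume "r > (0::real)"
    have "x \<in> closure D" using D by auto
    then have "sball x r \<inter> D \<noteq> {}"
      using open_sball[of x r] \<open>r > 0\<close> closure_iff_nhds_not_empty[of x D] by (metis c_refl inf_commute mem_Collect_eq order_refl)
    then obtain y where "y \<in> D" "c x y < r" by blast
    then show "\<exists>n. c (from_nat_into D n) x < r"
      using from_nat_into_surj[OF D(1) \<open>y \<in> D\<close>] by (metis c_commute)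
  qed
  then have "\<forall>x r. r > 0 \<longrightarrow> (\<exists>n. c (dense_seq n) x < r)"
    unfolding dense_seq_def by (rule someI[where P="\<lambda>d. \<forall>x r. r > 0 \<longrightarrow> (\<exists>n. c (d n) x < r)"])
  then show ?thesis using assms that by blast
qed

text \<open>Its level sets are the countable partition into small cells. Taking the least index
  makes them disjoint, and values in \<open>nat\<close> reduce measurability to countably many
  sets.\<close>

definition round_index :: "real \<Rightarrow> 'a \<Rightarrow> nat" where
  "round_index r x = (LEAST n. c (dense_seq n) x < r)"

lemma round_index: "r > 0 \<Longrightarrow> c (dense_seq (round_index r x)) x < r"
  unfolding round_index_def by (metis LeastI dense_seq)

lemma measurable_round_index [measurable]: "round_index r \<in> measurable borel (count_space UNIV)"
  unfolding round_index_def by measurable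

lemma c_tendsto_round:
  "(\<lambda>k. c (dense_seq (round_index (inverse (real (Suc k))) x)) y) \<longlonglongrightarrow> c x y"
proof -
  have "(\<lambda>k. c (dense_seq (round_index (inverse (real (Suc k))) x)) x) \<longlonglongrightarrow> 0"
    by (rule tendsto_sandwich[OF _ _ tendsto_const LIMSEQ_inverse_real_of_nat])
      (auto intro!: always_eventually less_imp_le round_index)
  moreover have "(\<lambda>k. c y y) \<longlonglongrightarrow> 0" by simp
  ultimately show ?thesis
    using sm_continuous[unfolded sm_continuous_def sm_converges_def, rule_format,
        of "\<lambda>k. dense_seq (round_index (inverse (real (Suc k))) x)" x "\<lambda>_. y" y] by simp
qed

text \<open>Rounding the first argument makes \<open>c\<close> a pointwise limit of functions that
  depend on it through a countable index. In this way the product sigma-algebra is never compared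
  with the Borel sets of the product space.\<close>

lemma measurable_c [measurable]:
  "(\<lambda>p. c (fst p) (snd p)) \<in> borel_measurable (borel \<Otimes>\<^sub>M borel)"
proof (rule borel_measurable_LIMSEQ_real)
  show "(\<lambda>p. c (dense_seq (round_index (inverse (real (Suc k))) (fst p))) (snd p))
      \<in> borel_measurable (borel \<Otimes>\<^sub>M borel)" for k
    by (rule measurable_compose_countable[where f="\<lambda>i p. c (dense_seq i) (snd p)"]) measurable
qed (rule c_tendsto_round)

lemma measurable_c_compose [measurable (raw)]:
  assumes [measurable]: "f \<in> measurable M borel" "g \<in> measurable M borel"
  shows "(\<lambda>x. c (f x) (g x)) \<in> borel_measurable M"
proof -
  have "(\<lambda>x. (f x, g x)) \<in> measurable M (borel \<Otimes>\<^sub>M borel)" by measurable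
  from measurable_compose[OF this measurable_c] show ?thesis by simp
qed

lemma compact_sball: "\<exists>r>0. \<exists>K. compact K \<and> sball x r \<subseteq> K"
proof -
  obtain U K where "open U" "compact K" "x \<in> U" "U \<subseteq> K"
    using locally_compact unfolding locally_compact_space_def by simp metis
  then show ?thesis unfolding open_iff_sball by (meson order_trans)
qed

definition basic_ball :: "nat \<times> nat \<Rightarrow> 'a set" where
  "basic_ball p = sball (dense_seq (fst p)) (inverse (real (Suc (snd p))))"

text \<open>The compact superset makes finite sums of bumps on these balls vanish at
  infinity.\<close>

definition small_balls :: "'a set \<Rightarrow> (nat \<times> nat) set" where
  "small_balls U = {p. basic_ball p \<subseteq> U \<and> (\<exists>K. compact K \<and> basic_ball p \<subseteq> K)}"

lemma open_eq_small_balls: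
  assumes "open U"
  shows "U = \<Union>(basic_ball ` small_balls U)"
proof safe
  fix x assume "x \<in> U"
  then obtain r where r: "r > 0" "sball x r \<subseteq> U" using assms open_iff_sball by blast
  obtain s K where s: "s > 0" "compact K" "sball x s \<subseteq> K" using compact_sball by blast
  \<comment> \<open>If x lies in the ball of this radius around a dense point, the relaxed triangle
    inequality puts the whole ball within \<open>min r s\<close> of x.\<close>
  obtain k where k: "inverse (real (Suc k)) < min r s / (2 * B)"
    using r s B_ge_1 reals_Archimedean[of "min r s / (2 * B)"] by auto
  obtain i where i: "c (dense_seq i) x < inverse (real (Suc k))"
    using dense_seq by (metis inverse_positive_iff_positive of_nat_0_less_iff zero_less_Suc)
  have "basic_ball (i, k) \<subseteq> sball x (min r s)"
  proof
    fix y assume "y \<in> basic_ball (i, k)"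
    then have "c x (dense_seq i) + c (dense_seq i) y < 2 * inverse (real (Suc k))"
      using i by (auto simp: c_commute[of x] basic_ball_def)
    then have "B * (c x (dense_seq i) + c (dense_seq i) y) < B * (2 * inverse (real (Suc k)))"
      using B_ge_1 by (intro mult_strict_left_mono) auto
    also have "\<dots> < min r s"
      using k B_ge_1 by (simp add: field_simps)
    finally show "y \<in> sball x (min r s)"
      using relaxed_triangle[of x y "dense_seq i"] by simp
  qed
  then have "(i, k) \<in> small_balls U"
    unfolding small_balls_def using r s by fastforce
  then show "x \<in> \<Union>(basic_ball ` small_balls U)"
    using i by (auto simp: basic_ball_def intro!: bexI[of _ "(i, k)"])
qed (auto simp: small_balls_def)

text \<open>Meant for a limit that is chosen pointwise: there the costs to fixed points are limits
  of measurable functions, while the choice itself gives no access to preimages of sets.\<close>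

lemma borel_measurableI_dense_seq:
  assumes "\<And>i. (\<lambda>w. c (dense_seq i) (f w)) \<in> borel_measurable M"
  shows "f \<in> measurable M borel"
proof (rule borel_measurableI)
  fix U :: "'a set" assume "open U"
  have [measurable]: "(\<lambda>w. c (dense_seq i) (f w)) \<in> borel_measurable M" for i by fact
  have "f -` U \<inter> space M = (\<Union>p\<in>small_balls U.
      {w\<in>space M. c (dense_seq (fst p)) (f w) < inverse (real (Suc (snd p)))})"
    by (subst open_eq_small_balls[OF \<open>open U\<close>]) (auto simp: basic_ball_def)
  also have "\<dots> \<in> sets M"
    by (intro sets.countable_UN'[OF countableI_type]) auto
  finally show "f -` U \<inter> space M \<in> sets M" .
qed

section \<open>Functions in C0 that approximate indicators of open sets\<close>

definition bump :: "nat \<times> nat \<Rightarrow> 'a \<Rightarrow> real" where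
  "bump p y = max 0 (1 - real (Suc (snd p)) * c (dense_seq (fst p)) y)"

text \<open>A substitute for Urysohn functions. Each point of \<open>U\<close> has a positive bump
  on some small ball, so n times the partial sum eventually exceeds 1 there, whereas outside
  \<open>U\<close> all terms vanish. The bound on \<open>prod_encode\<close> keeps the sum finite,
  hence zero outside a compact set.\<close>

definition inner_bump :: "'a set \<Rightarrow> nat \<Rightarrow> 'a \<Rightarrow> real" where
  "inner_bump U n y =
     min 1 (real n * (\<Sum>p\<in>{p\<in>small_balls U. prod_encode p < n}. bump p y))"

lemma bump_nonneg: "0 \<le> bump p y" by (simp add: bump_def)

lemma bump_pos_iff: "0 < bump p y \<longleftrightarrow> y \<in> basic_ball p"
  by (auto simp: bump_def basic_ball_def field_simps)

lemma bump_eq_0_iff: "bump p y = 0 \<longleftrightarrow> y \<notin> basic_ball p"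
  using bump_pos_iff[of p y] bump_nonneg[of p y] by linarith

lemma finite_small_balls: "finite {p\<in>small_balls U. prod_encode p < n}"
  by (rule finite_subset[of _ "prod_decode ` {..<n}"]) (auto simp: image_iff intro!: bexI[of _ "prod_encode _"])

lemma inner_bump_bounds: "0 \<le> inner_bump U n y" "inner_bump U n y \<le> 1"
  by (auto simp: inner_bump_def intro!: mult_nonneg_nonneg sum_nonneg bump_nonneg)

lemma inner_bump_C0: "inner_bump U n \<in> C0"
  unfolding C0_def
proof (safe)
  show "continuous_on UNIV (inner_bump U n)"
    unfolding inner_bump_def bump_def by (intro continuous_intros continuous_c)
next
  fix e :: real assume "e > 0"
  let ?F = "{p\<in>small_balls U. prod_encode p < n}"
  define K where "K p = (SOME K. compact K \<and> basic_ball p \<subseteq> K)" for p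
  have K: "compact (K p)" "basic_ball p \<subseteq> K p" if "p \<in> ?F" for p
  proof -
    have "\<exists>K. compact K \<and> basic_ball p \<subseteq> K" using that by (simp add: small_balls_def)
    from someI_ex[OF this] show "compact (K p)" "basic_ball p \<subseteq> K p"
      unfolding K_def by blast+
  qed
  show "\<exists>K. compact K \<and> (\<forall>x. x \<notin> K \<longrightarrow> \<bar>inner_bump U n x\<bar> < e)"
  proof (intro exI[of _ "\<Union>p\<in>?F. K p"] conjI allI impI)
    show "compact (\<Union>p\<in>?F. K p)" by (intro compact_UN finite_small_balls K(1))
  next
    fix x assume x: "x \<notin> (\<Union>p\<in>?F. K p)"
    have "bump p x = 0" if "p \<in> ?F" for p
      using x K(2)[OF that] that unfolding bump_eq_0_iff by blast
    then show "\<bar>inner_bump U n x\<bar> < e" using \<open>e > 0\<close> by (simp add: inner_bump_def)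
  qed
qed

lemma inner_bump_tendsto:
  assumes "open U"
  shows "(\<lambda>n. inner_bump U n y) \<longlonglongrightarrow> indicator U y"
proof (cases "y \<in> U")
  case True
  then obtain q where p: "q \<in> small_balls U" "y \<in> basic_ball q"
    using open_eq_small_balls[OF assms] by blast
  let ?b = "bump q y"
  have "?b > 0" using p bump_pos_iff by blast
  then obtain N where N: "1 < real N * ?b" using reals_Archimedean3 by blast
  have "inner_bump U n y = 1" if n: "n \<ge> max N (Suc (prod_encode q))" for n
  proof -
    have "?b \<le> (\<Sum>p\<in>{p\<in>small_balls U. prod_encode p < n}. bump p y)"
      using member_le_sum[of q "{p\<in>small_balls U. prod_encode p < n}"
          "\<lambda>p. bump p y"] p n finite_small_balls bump_nonneg by auto
    then have "real N * ?b \<le> real n * (\<Sum>p\<in>{p\<in>small_balls U. prod_encode p < n}. bump p y)"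
      using n \<open>?b > 0\<close> by (intro mult_mono) auto
    then show ?thesis using N by (simp add: inner_bump_def)
  qed
  then have "eventually (\<lambda>n. inner_bump U n y = indicator U y) sequentially"
    using True unfolding eventually_sequentially by (metis indicator_simps(1))
  then show ?thesis by (rule tendsto_eventually)
next
  case False
  have "bump p y = 0" if "p \<in> small_balls U" for p
    using False that unfolding bump_eq_0_iff small_balls_def by blast
  then show ?thesis using False by (simp add: inner_bump_def)
qed

lemma integral_inner_bump_tendsto:
  assumes "\<mu> \<in> borel_probs" "open U"
  shows "(\<lambda>n. \<integral>x. inner_bump U n x \<partial>\<mu>) \<longlonglongrightarrow> measure \<mu> U"
proof -
  interpret prob_space \<mu> using assms by (simp add: borel_probs_def)
  have [measurable_cong]: "sets \<mu> = sets borel" using assms by (simp add: borel_probs_def)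
  have [measurable]: "inner_bump U n \<in> borel_measurable \<mu>" for n
    using C0_measurable[OF inner_bump_C0] by simp
  have [measurable]: "U \<in> sets \<mu>" using assms by simp
  have "(\<lambda>n. \<integral>x. inner_bump U n x \<partial>\<mu>) \<longlonglongrightarrow> (\<integral>x. indicator U x \<partial>\<mu>)"
    by (rule integral_dominated_convergence[where w="\<lambda>_. 1"])
      (use inner_bump_tendsto[OF assms(2)] inner_bump_bounds in auto)
  also have "(\<integral>x. indicator U x \<partial>\<mu>) = measure \<mu> U"
    using sets.sets_into_space[OF \<open>U \<in> sets \<mu>\<close>] by (simp add: Int_absorb2)
  finally show ?thesis .
qed

lemma borel_probs_eqI_open:
  fixes \<mu> \<nu> :: "'a measure"
  assumes "\<mu> \<in> borel_probs" "\<nu> \<in> borel_probs" "\<And>U. open U \<Longrightarrow> measure \<mu> U = measure \<nu> U"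
  shows "\<mu> = \<nu>"
proof (rule measure_eqI_generator_eq)
  interpret \<mu>: prob_space \<mu> using assms by (simp add: borel_probs_def)
  interpret \<nu>: prob_space \<nu> using assms by (simp add: borel_probs_def)
  show "Int_stable {U::'a set. open U}" by (auto simp: Int_stable_def)
  show "emeasure \<mu> X = emeasure \<nu> X" if "X \<in> {U. open U}" for X
    using assms(3)[of X] that by (simp add: \<mu>.emeasure_eq_measure \<nu>.emeasure_eq_measure)
  show "sets \<mu> = sigma_sets UNIV {U. open U}" "sets \<nu> = sigma_sets UNIV {U. open U}"
    using assms by (auto simp: borel_probs_def sets_borel)
  show "range (\<lambda>_::nat. UNIV :: 'a set) \<subseteq> {U. open U}" by auto
  show "emeasure \<mu> UNIV \<noteq> \<infinity>" by simp
qed auto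

text \<open>Integrals of \<open>inner_bump\<close> recover the mass of every open set, and the open
  sets are a generating pi-system. This uniqueness is what gives meaning to the definite description
  in \<open>evolve\<close>.\<close>

lemma borel_probs_eqI_C0:
  fixes \<mu> \<nu> :: "'a measure"
  assumes "\<mu> \<in> borel_probs" "\<nu> \<in> borel_probs"
    and "\<And>\<phi>. \<phi> \<in> C0 \<Longrightarrow> (\<integral>x. \<phi> x \<partial>\<mu>) = (\<integral>x. \<phi> x \<partial>\<nu>)"
  shows "\<mu> = \<nu>"
proof (rule borel_probs_eqI_open[OF assms(1,2)])
  fix U :: "'a set" assume "open U"
  have eq: "(\<lambda>n. \<integral>x. inner_bump U n x \<partial>\<mu>) = (\<lambda>n. \<integral>x. inner_bump U n x \<partial>\<nu>)"
    by (intro ext assms(3) inner_bump_C0)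
  show "measure \<mu> U = measure \<nu> U"
    by (rule LIMSEQ_unique[OF integral_inner_bump_tendsto[OF assms(1) \<open>open U\<close>, unfolded eq]
      integral_inner_bump_tendsto[OF assms(2) \<open>open U\<close>]])
qed

section \<open>Couplings\<close>

lemma Pc_borel_probs: "\<mu> \<in> Pc c \<Longrightarrow> \<mu> \<in> borel_probs"
  by (simp add: Pc_def)

lemma transport_cost_le:
  assumes "prob_space M" and [measurable]: "X \<in> measurable M borel" "Y \<in> measurable M borel"
    and "distr M borel X = \<mu>" "distr M borel Y = \<nu>"
  shows "transport_cost c \<mu> \<nu> \<le> (\<integral>\<^sup>+w. ennreal (c (X w) (Y w)) \<partial>M)"
proof -
  let ?\<gamma> = "distr M (borel \<Otimes>\<^sub>M borel) (\<lambda>w. (X w, Y w))"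
  have "?\<gamma> \<in> couplings \<mu> \<nu>"
    using assms(1,4,5)
    by (auto simp: couplings_def distr_distr comp_def intro!: prob_space.prob_space_distr)
  moreover have "(\<integral>\<^sup>+p. ennreal (c (fst p) (snd p)) \<partial>?\<gamma>) = (\<integral>\<^sup>+w. ennreal (c (X w) (Y w)) \<partial>M)"
    by (subst nn_integral_distr) auto
  ultimately show ?thesis
    unfolding transport_cost_def by (intro INF_lower2[of ?\<gamma>]) auto
qed

lemma transport_cost_less_coupling:
  assumes "transport_cost c \<mu> \<nu> < e"
  obtains \<gamma> where "\<gamma> \<in> couplings \<mu> \<nu>" "(\<integral>\<^sup>+p. ennreal (c (fst p) (snd p)) \<partial>\<gamma>) < e"
  using assms unfolding transport_cost_def INF_less_iff by auto

lemma transport_cost_swap: "transport_cost c \<nu> \<mu> \<le> transport_cost c \<mu> \<nu>"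
  unfolding transport_cost_def[of c \<mu>]
proof (rule INF_greatest)
  fix \<gamma> assume "\<gamma> \<in> couplings \<mu> \<nu>"
  note \<gamma> = couplingsD[OF this]
  note \<gamma>(2)[measurable_cong]
  have "transport_cost c \<nu> \<mu> \<le> (\<integral>\<^sup>+p. ennreal (c (snd p) (fst p)) \<partial>\<gamma>)"
    using \<gamma> by (intro transport_cost_le) auto
  then show "transport_cost c \<nu> \<mu> \<le> (\<integral>\<^sup>+p. ennreal (c (fst p) (snd p)) \<partial>\<gamma>)"
    by (simp add: c_commute)
qed

lemma transport_cost_commute: "transport_cost c \<mu> \<nu> = transport_cost c \<nu> \<mu>"
  by (intro antisym transport_cost_swap)

lemma transport_cost_self:
  assumes "\<mu> \<in> borel_probs"
  shows "transport_cost c \<mu> \<mu> = 0"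
proof -
  note \<mu> = borel_probsD[OF assms]
  have "transport_cost c \<mu> \<mu> \<le> (\<integral>\<^sup>+x. ennreal (c x x) \<partial>\<mu>)"
    using \<mu> by (intro transport_cost_le distr_id2) (auto simp: measurable_def)
  then show ?thesis by simp
qed

text \<open>One factor \<open>B\<close> comes from rounding x to its dense point, after which
  \<open>nn_integral_cell_kernel\<close> applies; the other comes from undoing the rounding under
  the coupling.\<close>

lemma coupling_kernel:
  assumes "\<mu> \<in> borel_probs" "\<nu> \<in> borel_probs" "transport_cost c \<mu> \<nu> < \<infinity>" "e > 0"
  obtains K where "K \<in> borel \<rightarrow>\<^sub>M prob_algebra borel" "\<mu> \<bind> K = \<nu>"
    "(\<integral>\<^sup>+x. \<integral>\<^sup>+y. ennreal (c x y) \<partial>K x \<partial>\<mu>) \<le> ennreal (B\<^sup>2) * transport_cost c \<mu> \<nu> + ennreal e"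
proof -
  \<comment> \<open>Three errors share \<open>e\<close>: rounding costs \<open>B * d\<close>,
    undoing it \<open>B^2 * d\<close>, and the coupling being only nearly optimal another
    \<open>B^2 * d\<close>.\<close>
  define d where "d = e / (3 * B\<^sup>2)"
  have B: "B > 0" "B \<le> B\<^sup>2" using B_ge_1 by (auto simp: power2_eq_square)
  then have "d > 0" using \<open>e > 0\<close> by (simp add: d_def)
  have d: "B * d + B\<^sup>2 * d + B\<^sup>2 * d \<le> e"
    using B mult_right_mono[of B "B\<^sup>2" d] \<open>d > 0\<close> by (simp add: d_def field_simps)
  have "transport_cost c \<mu> \<nu> < transport_cost c \<mu> \<nu> + ennreal d"
    using assms(3) \<open>d > 0\<close> by simp
  then obtain \<gamma> where "\<gamma> \<in> couplings \<mu> \<nu>"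
    and cost: "(\<integral>\<^sup>+p. ennreal (c (fst p) (snd p)) \<partial>\<gamma>) < transport_cost c \<mu> \<nu> + ennreal d"
    by (rule transport_cost_less_coupling)
  note \<gamma> = couplingsD[OF this(1)]
  note \<gamma>(2)[measurable_cong]
  interpret prob_space \<gamma> by fact
  let ?J = "round_index d"
  define K where "K x = cell_kernel \<gamma> ?J (?J x)" for x
  have K[measurable]: "K \<in> borel \<rightarrow>\<^sub>M prob_algebra borel"
    unfolding K_def by (rule measurable_cell_kernel[OF \<open>\<gamma> \<in> _\<close>]) measurable
  have setsK: "sets (K x) = sets borel" for x
    using cell_kernel_space[OF \<open>\<gamma> \<in> _\<close>] by (simp add: K_def borel_probs_def)
  have probK: "prob_space (K x)" for x
    using cell_kernel_space[OF \<open>\<gamma> \<in> _\<close>] by (simp add: K_def borel_probs_def)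
  have bindK: "\<mu> \<bind> K = \<nu>"
  proof (rule measure_eqI)
    have \<mu>: "\<mu> \<in> space (prob_algebra borel)" using assms(1) by (simp add: space_prob_algebra_borel)
    show "sets (\<mu> \<bind> K) = sets \<nu>"
      using sets_bind'[OF \<mu> K] assms(2) by (simp add: borel_probs_def)
    fix S assume "S \<in> sets (\<mu> \<bind> K)"
    then have [measurable]: "S \<in> sets borel" using sets_bind'[OF \<mu> K] by simp
    have "emeasure (\<mu> \<bind> K) S = (\<integral>\<^sup>+x. emeasure (K x) S \<partial>\<mu>)"
      by (rule emeasure_bind_prob_algebra[OF \<mu> K]) simp
    also have "\<dots> = (\<integral>\<^sup>+x. \<integral>\<^sup>+y. indicator S y \<partial>cell_kernel \<gamma> ?J (?J x) \<partial>\<mu>)"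
      using setsK by (simp add: K_def[symmetric])
    also have "\<dots> = (\<integral>\<^sup>+p. indicator S (snd p) \<partial>\<gamma>)"
      by (rule nn_integral_cell_kernel[OF \<open>\<gamma> \<in> _\<close>, where g="\<lambda>_ y. indicator S y"]) measurable
    also have "\<dots> = (\<integral>\<^sup>+y. indicator S y \<partial>distr \<gamma> borel snd)"
      by (subst nn_integral_distr) auto
    also have "\<dots> = emeasure \<nu> S"
      unfolding \<gamma>(4) using assms(2) by (simp add: borel_probs_def)
    finally show "emeasure (\<mu> \<bind> K) S = emeasure \<nu> S" .
  qed
  let ?D = "\<lambda>x. dense_seq (?J x)"
  have round: "c x (?D x) \<le> d" "c (?D x) x \<le> d" for x
    using round_index[OF \<open>d > 0\<close>, of x] by (auto simp: c_commute less_imp_le)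
  have step1: "c x y \<le> B * d + B * c (?D x) y" for x y
    using relaxed_triangle[of x y "?D x"] mult_left_mono[OF round(1)[of x], of B] B
    unfolding distrib_left by linarith
  have step2: "B * d + B * c (?D x) y \<le> B * d + B\<^sup>2 * d + B\<^sup>2 * c x y" for x y
  proof -
    have "B * c (?D x) y \<le> B * (B * (c (?D x) x + c x y))"
      using relaxed_triangle[of "?D x" y x] B by (intro mult_left_mono) auto
    moreover have "B * (B * c (?D x) x) \<le> B * (B * d)"
      using round(2)[of x] B by (intro mult_left_mono) auto
    ultimately show ?thesis
      unfolding power2_eq_square distrib_left mult.assoc by linarith
  qed
  have "(\<integral>\<^sup>+x. \<integral>\<^sup>+y. ennreal (c x y) \<partial>K x \<partial>\<mu>)
      \<le> (\<integral>\<^sup>+x. \<integral>\<^sup>+y. ennreal (B * d + B * c (?D x) y) \<partial>cell_kernel \<gamma> ?J (?J x) \<partial>\<mu>)"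
    unfolding K_def by (intro nn_integral_mono ennreal_leI step1)
  also have "\<dots> = (\<integral>\<^sup>+p. ennreal (B * d + B * c (?D (fst p)) (snd p)) \<partial>\<gamma>)"
    by (rule nn_integral_cell_kernel[OF \<open>\<gamma> \<in> _\<close>, where g="\<lambda>i y. ennreal (B * d + B * c (dense_seq i) y)"])
      measurable
  also have "\<dots> \<le> (\<integral>\<^sup>+p. ennreal (B * d + B\<^sup>2 * d + B\<^sup>2 * c (fst p) (snd p)) \<partial>\<gamma>)"
    by (intro nn_integral_mono ennreal_leI step2)
  also have "\<dots> = (\<integral>\<^sup>+p. ennreal (B * d + B\<^sup>2 * d) + ennreal (B\<^sup>2) * ennreal (c (fst p) (snd p)) \<partial>\<gamma>)"
    using B \<open>d > 0\<close> by (intro nn_integral_cong) (simp add: ennreal_mult[symmetric] ennreal_plus[symmetric] del: ennreal_plus)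
  also have "\<dots> = ennreal (B * d + B\<^sup>2 * d) + ennreal (B\<^sup>2) * (\<integral>\<^sup>+p. ennreal (c (fst p) (snd p)) \<partial>\<gamma>)"
    by (simp add: nn_integral_add nn_integral_cmult emeasure_space_1)
  also have "\<dots> \<le> ennreal (B * d + B\<^sup>2 * d) + ennreal (B\<^sup>2) * (transport_cost c \<mu> \<nu> + ennreal d)"
    using cost B by (intro add_left_mono mult_left_mono less_imp_le) auto
  also have "\<dots> = ennreal (B\<^sup>2) * transport_cost c \<mu> \<nu> + ennreal (B * d + B\<^sup>2 * d + B\<^sup>2 * d)"
  proof -
    have "ennreal (B * d + B\<^sup>2 * d + B\<^sup>2 * d) = ennreal (B * d + B\<^sup>2 * d) + ennreal (B\<^sup>2) * ennreal d"
      using B \<open>d > 0\<close> by (subst ennreal_plus) (auto simp: ennreal_mult)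
    then show ?thesis by (simp only: distrib_left add.assoc add.left_commute add.commute)
  qed
  also have "\<dots> \<le> ennreal (B\<^sup>2) * transport_cost c \<mu> \<nu> + ennreal e"
    using d by (intro add_left_mono ennreal_leI)
  finally have "(\<integral>\<^sup>+x. \<integral>\<^sup>+y. ennreal (c x y) \<partial>K x \<partial>\<mu>)
      \<le> ennreal (B\<^sup>2) * transport_cost c \<mu> \<nu> + ennreal e" .
  then show ?thesis using that K bindK by blast
qed

text \<open>\<open>X\<close> may live on any probability space, so that couplings can be attached
  one after the other to different variables of the same space.\<close>

lemma extend_coupling:
  assumes "prob_space M" and X[measurable]: "X \<in> measurable M borel" and "distr M borel X = \<mu>"
    and "\<nu> \<in> borel_probs" "transport_cost c \<mu> \<nu> < \<infinity>" "e > 0"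
  obtains N where "prob_space N" "sets N = sets (M \<Otimes>\<^sub>M borel)" "distr N M fst = M"
    "distr N borel snd = \<nu>"
    "(\<integral>\<^sup>+p. ennreal (c (X (fst p)) (snd p)) \<partial>N) \<le> ennreal (B\<^sup>2) * transport_cost c \<mu> \<nu> + ennreal e"
proof -
  interpret prob_space M by fact
  have \<mu>: "\<mu> \<in> borel_probs" using assms(3) prob_space_distr[OF X] by (auto simp: borel_probs_def)
  obtain K where K[measurable]: "K \<in> borel \<rightarrow>\<^sub>M prob_algebra borel" and "\<mu> \<bind> K = \<nu>"
    and cost: "(\<integral>\<^sup>+x. \<integral>\<^sup>+y. ennreal (c x y) \<partial>K x \<partial>\<mu>) \<le> ennreal (B\<^sup>2) * transport_cost c \<mu> \<nu> + ennreal e"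
    using coupling_kernel[OF \<mu> assms(4-6)] by blast
  obtain N where N: "prob_space N" "sets N = sets (M \<Otimes>\<^sub>M borel)" "distr N M fst = M"
    "distr N borel snd = distr M borel X \<bind> K"
    and g: "\<And>g. g \<in> borel_measurable (M \<Otimes>\<^sub>M borel) \<Longrightarrow>
       (\<integral>\<^sup>+p. g p \<partial>N) = (\<integral>\<^sup>+w. \<integral>\<^sup>+y. g (w, y) \<partial>K (X w) \<partial>M)"
    using extend_by_kernel[OF assms(1) X K] by blast
  have "(\<integral>\<^sup>+p. ennreal (c (X (fst p)) (snd p)) \<partial>N)
      = (\<integral>\<^sup>+w. \<integral>\<^sup>+y. ennreal (c (X w) y) \<partial>K (X w) \<partial>M)"
    by (subst g) auto
  also have "\<dots> = (\<integral>\<^sup>+x. \<integral>\<^sup>+y. ennreal (c x y) \<partial>K x \<partial>distr M borel X)"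
    by (subst nn_integral_distr)
      (auto intro!: nn_integral_measurable_subprob_algebra2[where N=borel] measurable_prob_algebraD)
  finally have "(\<integral>\<^sup>+p. ennreal (c (X (fst p)) (snd p)) \<partial>N)
      \<le> ennreal (B\<^sup>2) * transport_cost c \<mu> \<nu> + ennreal e"
    using cost assms(3) by simp
  then show ?thesis using that N assms(3) \<open>\<mu> \<bind> K = \<nu>\<close> by simp
qed

section \<open>The transport cost as a semimetric\<close>

text \<open>\<open>enn2real\<close> sends an infinite cost to 0, so a statement such as the triangle
  inequality is made for \<open>W\<close> only on \<open>Pc c\<close>, where the cost is
  finite.\<close>

definition W :: "'a measure \<Rightarrow> 'a measure \<Rightarrow> real" where
  "W \<mu> \<nu> = enn2real (transport_cost c \<mu> \<nu>)"

lemma W_nonneg [simp]: "0 \<le> W \<mu> \<nu>"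
  by (simp add: W_def)

lemma W_commute: "W \<mu> \<nu> = W \<nu> \<mu>"
  by (simp add: W_def transport_cost_commute)

lemma W_self: "\<mu> \<in> Pc c \<Longrightarrow> W \<mu> \<mu> = 0"
  by (simp add: W_def transport_cost_self Pc_borel_probs)

lemma Pc_moment:
  assumes "\<mu> \<in> Pc c"
  shows "(\<integral>\<^sup>+x. ennreal (c z x) \<partial>\<mu>) < \<infinity>"
proof -
  note \<mu> = borel_probsD[OF Pc_borel_probs[OF assms]]
  note \<mu>(2)[measurable_cong]
  interpret prob_space \<mu> by fact
  obtain z' where z': "(\<integral>\<^sup>+x. ennreal (c z' x) \<partial>\<mu>) < \<infinity>" using assms by (auto simp: Pc_def)
  have "(\<integral>\<^sup>+x. ennreal (c z x) \<partial>\<mu>) \<le> (\<integral>\<^sup>+x. ennreal (B * c z z') + ennreal B * ennreal (c z' x) \<partial>\<mu>)"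
  proof (rule nn_integral_mono)
    fix x
    have "ennreal (c z x) \<le> ennreal (B * c z z' + B * c z' x)"
      using relaxed_triangle[of z x z'] by (intro ennreal_leI) (simp add: algebra_simps)
    then show "ennreal (c z x) \<le> ennreal (B * c z z') + ennreal B * ennreal (c z' x)"
      using B_ge_1 by (simp add: ennreal_mult)
  qed
  also have "\<dots> = ennreal (B * c z z') + ennreal B * (\<integral>\<^sup>+x. ennreal (c z' x) \<partial>\<mu>)"
    by (simp add: nn_integral_add nn_integral_cmult emeasure_space_1)
  also have "\<dots> < \<infinity>"
    using z' by (simp add: ennreal_mult_less_top)
  finally show ?thesis .
qed

lemma nn_integral_c_triangle:
  assumes [measurable]: "X \<in> measurable M borel" "Y \<in> measurable M borel" "Z \<in> measurable M borel"
  shows "(\<integral>\<^sup>+w. ennreal (c (X w) (Y w)) \<partial>M)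
    \<le> ennreal B * ((\<integral>\<^sup>+w. ennreal (c (X w) (Z w)) \<partial>M) + (\<integral>\<^sup>+w. ennreal (c (Z w) (Y w)) \<partial>M))"
proof -
  have "(\<integral>\<^sup>+w. ennreal (c (X w) (Y w)) \<partial>M)
      \<le> (\<integral>\<^sup>+w. ennreal B * (ennreal (c (X w) (Z w)) + ennreal (c (Z w) (Y w))) \<partial>M)"
  proof (rule nn_integral_mono)
    fix w
    have "ennreal (c (X w) (Y w)) \<le> ennreal (B * (c (X w) (Z w) + c (Z w) (Y w)))"
      by (intro ennreal_leI relaxed_triangle)
    then show "ennreal (c (X w) (Y w)) \<le> ennreal B * (ennreal (c (X w) (Z w)) + ennreal (c (Z w) (Y w)))"
      using B_ge_1 by (simp add: ennreal_mult)
  qed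
  also have "\<dots> = ennreal B * ((\<integral>\<^sup>+w. ennreal (c (X w) (Z w)) \<partial>M) + (\<integral>\<^sup>+w. ennreal (c (Z w) (Y w)) \<partial>M))"
    by (simp add: nn_integral_add nn_integral_cmult)
  finally show ?thesis .
qed

lemma transport_cost_finite:
  assumes "\<mu> \<in> Pc c" "\<nu> \<in> Pc c"
  shows "transport_cost c \<mu> \<nu> < \<infinity>"
proof -
  note \<mu> = borel_probsD[OF Pc_borel_probs[OF assms(1)]]
  note \<nu> = borel_probsD[OF Pc_borel_probs[OF assms(2)]]
  have id[measurable]: "(\<lambda>x. x) \<in> measurable \<mu> borel" using \<mu> by (simp add: measurable_def)
  \<comment> \<open>The constant kernel produces the independent coupling. Its cost is bounded
    through an arbitrary base point, here \<open>undefined\<close>, at which both moments are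
    finite.\<close>
  have "(\<lambda>_. \<nu>) \<in> borel \<rightarrow>\<^sub>M prob_algebra borel"
    using assms(2) by (simp add: space_prob_algebra_borel Pc_borel_probs)
  from extend_by_kernel[OF \<mu>(1) id this] obtain N where N: "prob_space N"
    "sets N = sets (\<mu> \<Otimes>\<^sub>M borel)" "distr N \<mu> fst = \<mu>" "distr N borel snd = distr \<mu> borel (\<lambda>x. x) \<bind> (\<lambda>_. \<nu>)"
    by metis
  note N(2)[measurable_cong] \<mu>(2)[measurable_cong]
  interpret N: prob_space N by fact
  have d1: "distr N borel fst = \<mu>"
    using N(3) distr_cong[OF refl \<mu>(2), of N fst fst] by simp
  have d2: "distr N borel snd = \<nu>"
    unfolding N(4) distr_id2[OF \<mu>(2)[symmetric]] using \<mu> \<nu>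
    by (intro bind_const' prob_space_imp_subprob_space)
  have "transport_cost c \<mu> \<nu> \<le> (\<integral>\<^sup>+p. ennreal (c (fst p) (snd p)) \<partial>N)"
    using d1 d2 N(1) by (intro transport_cost_le) auto
  also have "\<dots> \<le> ennreal B * ((\<integral>\<^sup>+p. ennreal (c (fst p) undefined) \<partial>N) + (\<integral>\<^sup>+p. ennreal (c undefined (snd p)) \<partial>N))"
    by (rule nn_integral_c_triangle) measurable
  also have "(\<integral>\<^sup>+p. ennreal (c (fst p) undefined) \<partial>N) = (\<integral>\<^sup>+x. ennreal (c undefined x) \<partial>\<mu>)"
    by (subst c_commute) (rule nn_integral_of_distr[OF N(3)], auto)
  also have "(\<integral>\<^sup>+p. ennreal (c undefined (snd p)) \<partial>N) = (\<integral>\<^sup>+x. ennreal (c undefined x) \<partial>\<nu>)"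
    by (subst d2[symmetric], subst nn_integral_distr) auto
  also have "ennreal B * ((\<integral>\<^sup>+x. ennreal (c undefined x) \<partial>\<mu>) + (\<integral>\<^sup>+x. ennreal (c undefined x) \<partial>\<nu>)) < \<infinity>"
    using Pc_moment[OF assms(1), of undefined] Pc_moment[OF assms(2), of undefined]
    by (auto simp: ennreal_mult_less_top)
  finally show ?thesis .
qed

lemma transport_cost_eq_W:
  "\<mu> \<in> Pc c \<Longrightarrow> \<nu> \<in> Pc c \<Longrightarrow> transport_cost c \<mu> \<nu> = ennreal (W \<mu> \<nu>)"
  unfolding W_def using transport_cost_finite by (simp add: less_top)

lemma W_le:
  assumes "transport_cost c \<mu> \<nu> \<le> ennreal r" "0 \<le> r"
  shows "W \<mu> \<nu> \<le> r"
  using enn2real_mono[OF assms(1)] assms(2) unfolding W_def by simp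

text \<open>Of the factor \<open>B^3\<close>, the part \<open>B^2\<close> is the price of realising
  the two couplings by kernels, and the remaining \<open>B\<close> is the pointwise inequality under
  the integral.\<close>

lemma W_triangle:
  assumes "\<mu> \<in> Pc c" "\<nu> \<in> Pc c" "\<kappa> \<in> Pc c"
  shows "W \<mu> \<nu> \<le> B ^ 3 * (W \<mu> \<kappa> + W \<kappa> \<nu>)"
proof (rule field_le_epsilon)
  fix e :: real assume "e > 0"
  define d where "d = e / (2 * B)"
  have B: "B > 0" using B_ge_1 by simp
  have "d > 0" using \<open>e > 0\<close> B by (simp add: d_def)
  note \<mu> = borel_probsD[OF Pc_borel_probs[OF assms(1)]]
  have id[measurable]: "(\<lambda>x. x) \<in> measurable \<mu> borel" using \<mu> by (simp add: measurable_def)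
  have "distr \<mu> borel (\<lambda>x. x) = \<mu>" by (rule distr_id2[OF \<mu>(2)[symmetric]])
  from extend_coupling[OF \<mu>(1) id this Pc_borel_probs[OF assms(3)] transport_cost_finite[OF assms(1,3)] \<open>d > 0\<close>]
  obtain N where N: "prob_space N" "sets N = sets (\<mu> \<Otimes>\<^sub>M borel)" "distr N \<mu> fst = \<mu>" "distr N borel snd = \<kappa>"
    "(\<integral>\<^sup>+p. ennreal (c (fst p) (snd p)) \<partial>N) \<le> ennreal (B\<^sup>2) * transport_cost c \<mu> \<kappa> + ennreal d"
    by blast
  note N(2)[measurable_cong] \<mu>(2)[measurable_cong]
  have "snd \<in> measurable N borel" by measurable
  from extend_coupling[OF N(1) this N(4) Pc_borel_probs[OF assms(2)] transport_cost_finite[OF assms(3,2)] \<open>d > 0\<close>]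
  obtain Q where Q: "prob_space Q" "sets Q = sets (N \<Otimes>\<^sub>M borel)" "distr Q N fst = N" "distr Q borel snd = \<nu>"
    "(\<integral>\<^sup>+p. ennreal (c (snd (fst p)) (snd p)) \<partial>Q) \<le> ennreal (B\<^sup>2) * transport_cost c \<kappa> \<nu> + ennreal d"
    by blast
  note Q(2)[measurable_cong]
  have "distr Q borel (\<lambda>p. fst (fst p)) = distr (distr Q N fst) borel fst"
    by (subst distr_distr) (auto simp: comp_def)
  also have "\<dots> = distr N \<mu> fst"
    unfolding Q(3) by (rule distr_cong) (auto simp: \<mu>)
  finally have "distr Q borel (\<lambda>p. fst (fst p)) = \<mu>" using N(3) by simp
  then have "transport_cost c \<mu> \<nu> \<le> (\<integral>\<^sup>+p. ennreal (c (fst (fst p)) (snd p)) \<partial>Q)"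
    using Q(1,4) by (intro transport_cost_le) auto
  also have "\<dots> \<le> ennreal B * ((\<integral>\<^sup>+p. ennreal (c (fst (fst p)) (snd (fst p))) \<partial>Q) + (\<integral>\<^sup>+p. ennreal (c (snd (fst p)) (snd p)) \<partial>Q))"
    by (rule nn_integral_c_triangle) measurable
  also have "(\<integral>\<^sup>+p. ennreal (c (fst (fst p)) (snd (fst p))) \<partial>Q) = (\<integral>\<^sup>+p. ennreal (c (fst p) (snd p)) \<partial>N)"
    by (rule nn_integral_of_distr[OF Q(3), where g="\<lambda>p. ennreal (c (fst p) (snd p))"]) auto
  also have "ennreal B * ((\<integral>\<^sup>+p. ennreal (c (fst p) (snd p)) \<partial>N) + (\<integral>\<^sup>+p. ennreal (c (snd (fst p)) (snd p)) \<partial>Q))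
     \<le> ennreal B * ((ennreal (B\<^sup>2) * transport_cost c \<mu> \<kappa> + ennreal d) + (ennreal (B\<^sup>2) * transport_cost c \<kappa> \<nu> + ennreal d))"
    by (intro mult_left_mono add_mono N(5) Q(5)) auto
  also have "\<dots> = ennreal (B * ((B\<^sup>2 * W \<mu> \<kappa> + d) + (B\<^sup>2 * W \<kappa> \<nu> + d)))"
    using assms B \<open>d > 0\<close> by (simp add: transport_cost_eq_W ennreal_mult[symmetric] ennreal_plus[symmetric] del: ennreal_plus)
  finally have "W \<mu> \<nu> \<le> B * ((B\<^sup>2 * W \<mu> \<kappa> + d) + (B\<^sup>2 * W \<kappa> \<nu> + d))"
    using B \<open>d > 0\<close> by (intro W_le) auto
  also have "\<dots> = B ^ 3 * (W \<mu> \<kappa> + W \<kappa> \<nu>) + e"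
    using B by (simp add: d_def field_simps power2_eq_square power3_eq_cube)
  finally show "W \<mu> \<nu> \<le> B ^ 3 * (W \<mu> \<kappa> + W \<kappa> \<nu>) + e" .
qed

lemma coupling_near_W:
  assumes "\<mu> \<in> Pc c" "\<nu> \<in> Pc c" "e > 0"
  obtains \<gamma> where "\<gamma> \<in> couplings \<mu> \<nu>" "(\<integral>\<^sup>+p. ennreal (c (fst p) (snd p)) \<partial>\<gamma>) < ennreal (W \<mu> \<nu> + e)"
proof -
  have "transport_cost c \<mu> \<nu> < ennreal (W \<mu> \<nu> + e)"
    using assms by (simp add: transport_cost_eq_W ennreal_less_iff)
  then show ?thesis using that by (rule transport_cost_less_coupling)
qed

lemma markov_c:
  assumes "prob_space M" and [measurable]: "X \<in> measurable M borel" "Y \<in> measurable M borel" and "r > 0"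
    and "(\<integral>\<^sup>+w. ennreal (c (X w) (Y w)) \<partial>M) \<le> ennreal C" "0 \<le> C"
  shows "measure M {w\<in>space M. r \<le> c (X w) (Y w)} \<le> C / r"
proof -
  interpret prob_space M by fact
  have "emeasure M {w\<in>space M. 1 \<le> ennreal (1 / r) * ennreal (c (X w) (Y w))}
      \<le> ennreal (1 / r) * (\<integral>\<^sup>+w. ennreal (c (X w) (Y w)) * indicator (space M) w \<partial>M)"
    by (rule nn_integral_Markov_inequality) auto
  also have "(\<integral>\<^sup>+w. ennreal (c (X w) (Y w)) * indicator (space M) w \<partial>M) = (\<integral>\<^sup>+w. ennreal (c (X w) (Y w)) \<partial>M)"
    by (rule nn_integral_cong) simp
  also have "ennreal (1 / r) * \<dots> \<le> ennreal (1 / r) * ennreal C"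
    by (intro mult_left_mono assms(5)) simp
  also have "\<dots> = ennreal (C / r)" using assms by (simp add: ennreal_mult[symmetric])
  also have "{w\<in>space M. 1 \<le> ennreal (1 / r) * ennreal (c (X w) (Y w))} = {w\<in>space M. r \<le> c (X w) (Y w)}"
    using \<open>r > 0\<close> by (auto simp: ennreal_mult[symmetric] field_simps)
  finally show ?thesis
    using assms(4,6) by (simp add: emeasure_eq_measure)
qed

text \<open>Vanishing of the infimum provides couplings of arbitrarily small cost rather than one of
  cost 0. By Markov's inequality such a coupling moves little mass across a margin inside
  \<open>U\<close>, and the margin then shrinks.\<close>

lemma W_eq_0_imp_measure_le:
  assumes "\<mu> \<in> Pc c" "\<nu> \<in> Pc c" "W \<mu> \<nu> = 0" "open U"
  shows "measure \<nu> U \<le> measure \<mu> U"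
proof -
  note \<mu> = borel_probsD[OF Pc_borel_probs[OF assms(1)]]
  note \<nu> = borel_probsD[OF Pc_borel_probs[OF assms(2)]]
  interpret \<nu>: prob_space \<nu> by fact
  \<comment> \<open>The points at cost at least 1/(k+1) from everything outside \<open>U\<close>. If
    the second coordinate lies here, then the first lies in \<open>U\<close> or the two are at least
    1/(k+1) apart.\<close>
  define V where "V k = - (\<Union>y\<in>-U. sball y (inverse (real (Suc k))))" for k
  have V[measurable]: "V k \<in> sets borel" for k
    unfolding V_def by (intro borel_comp borel_open open_UN ballI open_sball)
  have "measure \<nu> (V k) \<le> measure \<mu> U" for k
  proof (rule field_le_epsilon)
    fix e :: real assume "e > 0"
    define d where "d = e * inverse (real (Suc k))"
    have "d > 0" using \<open>e > 0\<close> by (simp add: d_def)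
    obtain \<gamma> where "\<gamma> \<in> couplings \<mu> \<nu>" and cost: "(\<integral>\<^sup>+p. ennreal (c (fst p) (snd p)) \<partial>\<gamma>) < ennreal (W \<mu> \<nu> + d)"
      using coupling_near_W[OF assms(1,2) \<open>d > 0\<close>] by blast
    note \<gamma> = couplingsD[OF this(1)]
    note \<gamma>(2)[measurable_cong]
    interpret \<gamma>: prob_space \<gamma> by fact
    have U[measurable]: "U \<in> sets borel" using assms(4) by simp
    let ?F = "{p\<in>space \<gamma>. inverse (real (Suc k)) \<le> c (fst p) (snd p)}"
    have "measure \<nu> (V k) = measure \<gamma> (snd -` V k \<inter> space \<gamma>)"
      using measure_distr[of snd \<gamma> borel "V k"] by (simp add: \<gamma>(4))
    also have "\<dots> \<le> measure \<gamma> ((fst -` U \<inter> space \<gamma>) \<union> ?F)"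
    proof (rule \<gamma>.finite_measure_mono)
      show "snd -` V k \<inter> space \<gamma> \<subseteq> (fst -` U \<inter> space \<gamma>) \<union> ?F"
        unfolding V_def using c_commute by (fastforce simp: not_less)
    qed measurable
    also have "\<dots> \<le> measure \<gamma> (fst -` U \<inter> space \<gamma>) + measure \<gamma> ?F"
      by (rule measure_Un_le) measurable
    also have "measure \<gamma> (fst -` U \<inter> space \<gamma>) = measure \<mu> U"
      using measure_distr[of fst \<gamma> borel U] by (simp add: \<gamma>(3))
    also have "measure \<gamma> ?F \<le> d / inverse (real (Suc k))"
      using cost assms(3) \<open>d > 0\<close> \<gamma>(1) by (intro markov_c) auto
    also have "d / inverse (real (Suc k)) = e" by (simp add: d_def)
    finally show "measure \<nu> (V k) \<le> measure \<mu> U + e" by simp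
  qed
  moreover have "(\<lambda>k. measure \<nu> (V k)) \<longlonglongrightarrow> measure \<nu> (\<Union>k. V k)"
  proof (rule \<nu>.finite_Lim_measure_incseq)
    show "range V \<subseteq> sets \<nu>" by (auto simp: \<nu>)
    show "incseq V"
    proof (rule incseq_SucI)
      fix k
      have "inverse (real (Suc (Suc k))) \<le> inverse (real (Suc k))" by (simp add: field_simps)
      then have "sball y (inverse (real (Suc (Suc k)))) \<subseteq> sball y (inverse (real (Suc k)))" for y
        by (blast intro: less_le_trans)
      then show "V k \<le> V (Suc k)" unfolding V_def by blast
    qed
  qed
  moreover have "(\<Union>k. V k) = U"
  proof safe
    fix x assume "x \<in> U"
    then obtain r where r: "r > 0" "sball x r \<subseteq> U" using assms(4) open_iff_sball by blast
    obtain k where "inverse (real (Suc k)) < r" using reals_Archimedean[OF r(1)] by blast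
    then have "x \<in> V k" using r(2) unfolding V_def by (auto simp: c_commute dest!: subsetD)
    then show "x \<in> (\<Union>k. V k)" by blast
  next
    fix x k assume "x \<in> V k"
    moreover have "x \<in> sball x (inverse (real (Suc k)))" by simp
    ultimately show "x \<in> U" unfolding V_def by blast
  qed
  ultimately show ?thesis by (intro LIMSEQ_le_const2) auto
qed

lemma W_eq_0_imp_eq:
  assumes "\<mu> \<in> Pc c" "\<nu> \<in> Pc c" "W \<mu> \<nu> = 0"
  shows "\<mu> = \<nu>"
  using W_eq_0_imp_measure_le[OF assms] W_eq_0_imp_measure_le[OF assms(2,1)] assms W_commute[of \<mu> \<nu>]
  by (intro borel_probs_eqI_open Pc_borel_probs) (auto intro: antisym)

section \<open>Compactness and integrability behind lower semicontinuity\<close>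

text \<open>Finitely many small balls lie in a compact set, and all of them together exhaust the
  space. The open \<open>G\<close> is the set that is measured; \<open>K\<close> supplies the
  compactness.\<close>

lemma tight:
  fixes \<mu> :: "'a measure"
  assumes "\<mu> \<in> borel_probs" "e > 0"
  obtains G K where "open G" "compact K" "G \<subseteq> K" "measure \<mu> (- G) < e"
proof -
  note \<mu> = borel_probsD[OF assms(1)]
  interpret prob_space \<mu> by fact
  define G where "G n = \<Union>(basic_ball ` {p\<in>small_balls UNIV. prod_encode p < n})" for n
  have og: "open (G n)" for n unfolding G_def basic_ball_def by (intro open_UN ballI open_sball)
  have "(\<Union>n. G n) = UNIV"
    using open_eq_small_balls[OF open_UNIV] by (fastforce simp: G_def intro: lessI)
  moreover have "(\<lambda>n. measure \<mu> (G n)) \<longlonglongrightarrow> measure \<mu> (\<Union>n. G n)"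
  proof (rule finite_Lim_measure_incseq)
    show "range G \<subseteq> events" using og by (auto simp: \<mu>)
    show "incseq G" by (auto simp: incseq_def G_def)
  qed
  ultimately have "(\<lambda>n. measure \<mu> (G n)) \<longlonglongrightarrow> 1" using prob_space \<mu>(3) by simp
  then have "eventually (\<lambda>n. measure \<mu> (G n) > 1 - e) sequentially"
    using assms(2) by (intro order_tendstoD) auto
  then obtain n where "measure \<mu> (G n) > 1 - e" by (auto simp: eventually_sequentially)
  moreover have "measure \<mu> (- G n) = 1 - measure \<mu> (G n)"
    using prob_compl[of "G n"] og[of n] by (simp add: \<mu> Compl_eq_Diff_UNIV)
  ultimately have "measure \<mu> (- G n) < e" by simp
  moreover obtain K where "compact K" "G n \<subseteq> K"
  proof -
    let ?F = "{p\<in>small_balls UNIV. prod_encode p < n}"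
    define K where "K p = (SOME K. compact K \<and> basic_ball p \<subseteq> K)" for p
    have K: "compact (K p)" "basic_ball p \<subseteq> K p" if "p \<in> ?F" for p
    proof -
      have "\<exists>K. compact K \<and> basic_ball p \<subseteq> K" using that by (simp add: small_balls_def)
      from someI_ex[OF this] show "compact (K p)" "basic_ball p \<subseteq> K p"
        unfolding K_def by blast+
    qed
    show ?thesis
    proof (rule that)
      show "compact (\<Union>p\<in>?F. K p)" by (intro compact_UN finite_small_balls K(1))
      show "G n \<subseteq> (\<Union>p\<in>?F. K p)" unfolding G_def using K(2) by blast
    qed
  qed
  ultimately show ?thesis using that og by blast
qed

text \<open>Only x and y are confined to \<open>K\<close>; u and v are perturbations that may leave
  it. In this Lebesgue number argument the radii are divided by \<open>2 * B\<close>, so that the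
  relaxed triangle inequality keeps u and v inside the original balls.\<close>

lemma c_uniformly_continuous_compact:
  assumes "compact K" "e > 0"
  shows "\<exists>r>0. \<forall>x\<in>K. \<forall>y\<in>K. \<forall>u v. c x u < r \<longrightarrow> c y v < r \<longrightarrow> \<bar>c u v - c x y\<bar> < e"
proof -
  have B: "B > 0" using B_ge_1 by simp
  have "\<forall>p. \<exists>r>0. \<forall>u v. c (fst p) u < r \<longrightarrow> c (snd p) v < r \<longrightarrow> \<bar>c u v - c (fst p) (snd p)\<bar> < e / 2"
    using c_jointly_continuous[of "e/2"] assms(2) by auto
  then obtain \<rho> where \<rho>: "\<And>p. \<rho> p > 0"
    "\<And>p u v. c (fst p) u < \<rho> p \<Longrightarrow> c (snd p) v < \<rho> p \<Longrightarrow> \<bar>c u v - c (fst p) (snd p)\<bar> < e / 2"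
    by metis
  define O' where "O' p = sball (fst p) (\<rho> p / (2 * B)) \<times> sball (snd p) (\<rho> p / (2 * B))" for p
  have "compact (K \<times> K)" by (intro compact_Times assms)
  moreover have "open (O' p)" for p unfolding O'_def by (intro open_Times open_sball)
  moreover have "K \<times> K \<subseteq> (\<Union>p\<in>K\<times>K. O' p)"
    using \<rho>(1) B by (auto simp: O'_def)
  ultimately obtain F where F: "F \<subseteq> K \<times> K" "finite F" "K \<times> K \<subseteq> (\<Union>p\<in>F. O' p)"
    using compactE_image[of "K \<times> K" "K \<times> K" O'] by metis
  define r where "r = Min (insert 1 ((\<lambda>p. \<rho> p / (2 * B)) ` F))"
  have "r > 0" using F(2) \<rho>(1) B by (auto simp: r_def)
  have near: "c a u < \<rho> p" if "c a x < \<rho> p / (2 * B)" "c x u < r" "p \<in> F" for a x u p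
  proof -
    have "r \<le> \<rho> p / (2 * B)" unfolding r_def using F(2) that(3) by (intro Min_le) auto
    then have "c a x + c x u < \<rho> p / B" using that by auto
    then have "B * (c a x + c x u) < \<rho> p" using B by (simp add: field_simps)
    then show ?thesis using relaxed_triangle[of a u x] by simp
  qed
  show ?thesis
  proof (intro exI[of _ r] conjI ballI allI impI \<open>r > 0\<close>)
    fix x y u v assume xy: "x \<in> K" "y \<in> K" "c x u < r" "c y v < r"
    then obtain p where p: "p \<in> F" "(x, y) \<in> O' p" using F(3) by blast
    have "c (fst p) x < \<rho> p / (2 * B)" "c (snd p) y < \<rho> p / (2 * B)"
      using p(2) by (auto simp: O'_def)
    then have *: "c (fst p) u < \<rho> p" "c (snd p) v < \<rho> p" "c (fst p) x < \<rho> p" "c (snd p) y < \<rho> p"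
      using near[OF _ xy(3) p(1)] near[OF _ xy(4) p(1)] near[of "fst p" x p x] near[of "snd p" y p y] p(1) \<open>r > 0\<close>
      by auto
    have "\<bar>c u v - c (fst p) (snd p)\<bar> < e / 2" by (rule \<rho>(2)[OF *(1,2)])
    moreover have "\<bar>c x y - c (fst p) (snd p)\<bar> < e / 2" by (rule \<rho>(2)[OF *(3,4)])
    ultimately show "\<bar>c u v - c x y\<bar> < e" by linarith
  qed
qed

text \<open>The threshold \<open>d\<close> depends on the law \<open>\<mu>\<close> alone and serves
  every probability space that carries a variable with this law. This matters because the space to
  which it is applied is built from a coupling that is picked after \<open>d\<close>.\<close>

lemma uniformly_integrable_c:
  assumes "\<mu> \<in> Pc c" "e > 0"
  obtains d where "d > 0" "\<And>M X E. prob_space M \<Longrightarrow> X \<in> measurable M borel \<Longrightarrow> distr M borel X = \<mu> \<Longrightarrow>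
    E \<in> sets M \<Longrightarrow> measure M E < d \<Longrightarrow> (\<integral>\<^sup>+w. ennreal (c z (X w)) * indicator E w \<partial>(M :: 'b measure)) \<le> ennreal e"
proof -
  note \<mu> = borel_probsD[OF Pc_borel_probs[OF assms(1)]]
  note \<mu>(2)[measurable_cong]
  define T where "T n x = ennreal (c z x) * indicator {x. real n < c z x} x" for n x
  have [measurable]: "T n \<in> borel_measurable borel" for n unfolding T_def by measurable
  have "(\<lambda>n. \<integral>\<^sup>+x. T n x \<partial>\<mu>) \<longlonglongrightarrow> (\<integral>\<^sup>+x. 0 \<partial>\<mu>)"
  proof (rule nn_integral_dominated_convergence[where w="\<lambda>x. ennreal (c z x)"])
    show "(\<integral>\<^sup>+x. ennreal (c z x) \<partial>\<mu>) < \<infinity>" by (rule Pc_moment[OF assms(1)])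
    show "AE x in \<mu>. (\<lambda>n. T n x) \<longlonglongrightarrow> 0"
    proof (rule AE_I2)
      fix x
      obtain N where "c z x < real N" using reals_Archimedean2 by blast
      then have "eventually (\<lambda>n. T n x = 0) sequentially"
        by (auto simp: eventually_sequentially T_def intro!: exI[of _ N])
      then show "(\<lambda>n. T n x) \<longlonglongrightarrow> 0" by (rule tendsto_eventually)
    qed
  qed (auto simp: T_def indicator_def)
  then have "eventually (\<lambda>n. (\<integral>\<^sup>+x. T n x \<partial>\<mu>) < ennreal (e / 2)) sequentially"
    using assms(2) by (intro order_tendstoD) auto
  then obtain n where n: "(\<integral>\<^sup>+x. T n x \<partial>\<mu>) < ennreal (e / 2)" by (auto simp: eventually_sequentially)
  \<comment> \<open>Below the truncation level n the integral over \<open>E\<close> is at most n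
    times its probability, hence at most e/2 for this threshold; the added 1 covers n = 0.\<close>
  show ?thesis
  proof (rule that[of "e / (2 * (real n + 1))"])
    show "0 < e / (2 * (real n + 1))" using assms(2) by simp
    fix M :: "'b measure" and X E assume M: "prob_space M" and X[measurable]: "X \<in> measurable M borel" and d: "distr M borel X = \<mu>"
      and E[measurable]: "E \<in> sets M" and small: "measure M E < e / (2 * (real n + 1))"
    interpret prob_space M by fact
    have "(\<integral>\<^sup>+w. ennreal (c z (X w)) * indicator E w \<partial>M) \<le> (\<integral>\<^sup>+w. ennreal (real n) * indicator E w + T n (X w) \<partial>M)"
      by (intro nn_integral_mono) (auto simp: T_def indicator_def ennreal_leI not_less)
    also have "\<dots> = ennreal (real n) * emeasure M E + (\<integral>\<^sup>+w. T n (X w) \<partial>M)"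
      by (simp add: nn_integral_add nn_integral_cmult_indicator)
    also have "(\<integral>\<^sup>+w. T n (X w) \<partial>M) = (\<integral>\<^sup>+x. T n x \<partial>\<mu>)"
      by (subst d[symmetric], subst nn_integral_distr) auto
    also have "ennreal (real n) * emeasure M E + (\<integral>\<^sup>+x. T n x \<partial>\<mu>) \<le> ennreal (e / 2) + ennreal (e / 2)"
    proof (intro add_mono less_imp_le[OF n])
      have "real n * measure M E \<le> real n * (e / (2 * (real n + 1)))"
        using small by (intro mult_left_mono) auto
      also have "\<dots> \<le> e / 2" using assms(2) by (simp add: field_simps)
      finally show "ennreal (real n) * emeasure M E \<le> ennreal (e / 2)"
        by (simp add: emeasure_eq_measure ennreal_mult[symmetric] ennreal_leI)
    qed
    also have "\<dots> = ennreal e" using assms(2) by (simp add: ennreal_plus[symmetric] del: ennreal_plus)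
    finally show "(\<integral>\<^sup>+w. ennreal (c z (X w)) * indicator E w \<partial>M) \<le> ennreal e" .
  qed
qed

section \<open>Lower semicontinuity and completeness\<close>

text \<open>Variables X and Y with the fixed laws \<open>\<mu>\<close> and \<open>\<nu>\<close> are
  attached to a nearly optimal coupling (X', Y') of \<open>\<mu>'\<close> and \<open>\<nu>'\<close>.
  The factor \<open>B^2\<close> of this operation multiplies only the small costs from X' to X and
  from Y' to Y. Outside a bad event, uniform continuity of \<open>c\<close> replaces (X, Y) by (X',
  Y') with factor 1; on the bad event the relaxed triangle inequality suffices, because the fixed
  laws have uniformly integrable costs.\<close>

lemma W_lower_semicontinuous:
  assumes "\<mu> \<in> Pc c" "\<nu> \<in> Pc c" "e > 0"
  shows "\<exists>d>0. \<forall>\<mu>'\<in>Pc c. \<forall>\<nu>'\<in>Pc c. W \<mu> \<mu>' < d \<longrightarrow> W \<nu> \<nu>' < d \<longrightarrow> W \<mu> \<nu> \<le> W \<mu>' \<nu>' + e"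
proof -
  have B: "B > 0" using B_ge_1 by simp
  \<comment> \<open>The bad event will contribute \<open>B * (a + a) = e / 4\<close>.\<close>
  define a where "a = e / (8 * B)"
  have "a > 0" using assms(3) B by (simp add: a_def)
  obtain d1 where d1: "d1 > 0" "\<And>M X E. prob_space M \<Longrightarrow> X \<in> measurable M borel \<Longrightarrow> distr M borel X = \<mu> \<Longrightarrow>
    E \<in> sets M \<Longrightarrow> measure M E < d1 \<Longrightarrow>
    (\<integral>\<^sup>+w. ennreal (c undefined (X w)) * indicator E w \<partial>(M :: ((('a \<times> 'a) \<times> 'a) \<times> 'a) measure)) \<le> ennreal a"
    using uniformly_integrable_c[OF assms(1) \<open>a > 0\<close>] by blast
  obtain d2 where d2: "d2 > 0" "\<And>M X E. prob_space M \<Longrightarrow> X \<in> measurable M borel \<Longrightarrow> distr M borel X = \<nu> \<Longrightarrow>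
    E \<in> sets M \<Longrightarrow> measure M E < d2 \<Longrightarrow>
    (\<integral>\<^sup>+w. ennreal (c undefined (X w)) * indicator E w \<partial>(M :: ((('a \<times> 'a) \<times> 'a) \<times> 'a) measure)) \<le> ennreal a"
    using uniformly_integrable_c[OF assms(2) \<open>a > 0\<close>] by blast
  \<comment> \<open>The bad event is a union of four events of probability at most \<open>q\<close>:
    X or Y misses \<open>G1\<close> or \<open>G2\<close>, or is at least \<open>r\<close> away from
    its primed partner.\<close>
  define q where "q = min d1 d2 / 5"
  have q: "q > 0" "5 * q \<le> d1" "5 * q \<le> d2" using d1(1) d2(1) by (auto simp: q_def)
  obtain G1 K1 where 1: "open G1" "compact K1" "G1 \<subseteq> K1" "measure \<mu> (- G1) < q"
    using tight[OF Pc_borel_probs[OF assms(1)] q(1)] by blast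
  obtain G2 K2 where 2: "open G2" "compact K2" "G2 \<subseteq> K2" "measure \<nu> (- G2) < q"
    using tight[OF Pc_borel_probs[OF assms(2)] q(1)] by blast
  obtain r where r: "r > 0"
    "\<And>x y u v. x \<in> K1 \<union> K2 \<Longrightarrow> y \<in> K1 \<union> K2 \<Longrightarrow> c x u < r \<Longrightarrow> c y v < r \<Longrightarrow> \<bar>c u v - c x y\<bar> < e / 4"
    using c_uniformly_continuous_compact[OF compact_Un[OF 1(2) 2(2)], of "e / 4"] assms(3) by auto
  \<comment> \<open>Half of \<open>q * r\<close> pays for \<open>B^2\<close> times the distance, the
    other half for the error in \<open>extend_coupling\<close>; Markov's inequality at level
    \<open>r\<close> turns \<open>q * r\<close> into the probability \<open>q\<close>.\<close>
  define d where "d = q * r / (2 * B\<^sup>2)"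
  have "d > 0" using q r(1) B by (simp add: d_def)
  have "W \<mu> \<nu> \<le> W \<mu>' \<nu>' + e"
    if near: "\<mu>' \<in> Pc c" "\<nu>' \<in> Pc c" "W \<mu> \<mu>' < d" "W \<nu> \<nu>' < d" for \<mu>' \<nu>'
  proof -
    have "e / 4 > 0" using assms(3) by simp
    obtain \<gamma> where "\<gamma> \<in> couplings \<mu>' \<nu>'"
      and cost: "(\<integral>\<^sup>+p. ennreal (c (fst p) (snd p)) \<partial>\<gamma>) < ennreal (W \<mu>' \<nu>' + e / 4)"
      using coupling_near_W[OF near(1,2) \<open>e / 4 > 0\<close>] by blast
    note \<gamma> = couplingsD[OF this(1)]
    note \<gamma>(2)[measurable_cong]
    have s: "q * r / 2 > 0" using q r by simp
    have "fst \<in> measurable \<gamma> borel" by measurable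
    from extend_coupling[OF \<gamma>(1) this \<gamma>(3) Pc_borel_probs[OF assms(1)] transport_cost_finite[OF near(1) assms(1)] s]
    obtain N where N: "prob_space N" "sets N = sets (\<gamma> \<Otimes>\<^sub>M borel)" "distr N \<gamma> fst = \<gamma>" "distr N borel snd = \<mu>"
      "(\<integral>\<^sup>+p. ennreal (c (fst (fst p)) (snd p)) \<partial>N) \<le> ennreal (B\<^sup>2) * transport_cost c \<mu>' \<mu> + ennreal (q * r / 2)"
      by blast
    note N(2)[measurable_cong]
    have m: "(\<lambda>p. snd (fst p)) \<in> measurable N borel" by measurable
    have "distr N borel (\<lambda>p. snd (fst p)) = \<nu>'"
      using distr_through_fst[OF N(3,2), of snd] \<gamma>(4) by simp
    from extend_coupling[OF N(1) m this Pc_borel_probs[OF assms(2)] transport_cost_finite[OF near(2) assms(2)] s]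
    obtain Q where Q: "prob_space Q" "sets Q = sets (N \<Otimes>\<^sub>M borel)" "distr Q N fst = N" "distr Q borel snd = \<nu>"
      "(\<integral>\<^sup>+p. ennreal (c (snd (fst (fst p))) (snd p)) \<partial>Q) \<le> ennreal (B\<^sup>2) * transport_cost c \<nu>' \<nu> + ennreal (q * r / 2)"
      by blast
    note Q(2)[measurable_cong]
    interpret Q: prob_space Q by fact
    define X' where "X' p = fst (fst (fst p))" for p :: "(('a \<times> 'a) \<times> 'a) \<times> 'a"
    define Y' where "Y' p = snd (fst (fst p))" for p :: "(('a \<times> 'a) \<times> 'a) \<times> 'a"
    define X where "X p = snd (fst p)" for p :: "(('a \<times> 'a) \<times> 'a) \<times> 'a"
    define Y where "Y p = snd p" for p :: "(('a \<times> 'a) \<times> 'a) \<times> 'a"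
    have meas[measurable]: "X' \<in> measurable Q borel" "Y' \<in> measurable Q borel"
      "X \<in> measurable Q borel" "Y \<in> measurable Q borel"
      unfolding X'_def Y'_def X_def Y_def by measurable
    have lawX: "distr Q borel X = \<mu>"
      using distr_through_fst[OF Q(3,2), of snd] N(4) unfolding X_def by simp
    have lawY: "distr Q borel Y = \<nu>" using Q(4) unfolding Y_def by simp
    have costXY': "(\<integral>\<^sup>+p. ennreal (c (X' p) (Y' p)) \<partial>Q) < ennreal (W \<mu>' \<nu>' + e / 4)"
    proof -
      have "(\<integral>\<^sup>+p. ennreal (c (X' p) (Y' p)) \<partial>Q) = (\<integral>\<^sup>+p. ennreal (c (fst (fst p)) (snd (fst p))) \<partial>N)"
        unfolding X'_def Y'_def
        by (rule nn_integral_of_distr[OF Q(3), where g="\<lambda>p. ennreal (c (fst (fst p)) (snd (fst p)))"]) auto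
      also have "\<dots> = (\<integral>\<^sup>+p. ennreal (c (fst p) (snd p)) \<partial>\<gamma>)"
        by (rule nn_integral_of_distr[OF N(3), where g="\<lambda>p. ennreal (c (fst p) (snd p))"]) auto
      finally show ?thesis using cost by simp
    qed
    have small: "B\<^sup>2 * W \<mu>1 \<mu>2 + q * r / 2 \<le> q * r" if "W \<mu>2 \<mu>1 < d" for \<mu>1 \<mu>2
      using that B mult_strict_left_mono[of "W \<mu>2 \<mu>1" d "B\<^sup>2"]
      by (simp add: d_def W_commute[of \<mu>1])
    have costX: "(\<integral>\<^sup>+p. ennreal (c (X' p) (X p)) \<partial>Q) \<le> ennreal (q * r)"
    proof -
      have "(\<integral>\<^sup>+p. ennreal (c (X' p) (X p)) \<partial>Q) = (\<integral>\<^sup>+p. ennreal (c (fst (fst p)) (snd p)) \<partial>N)"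
        unfolding X'_def X_def
        by (rule nn_integral_of_distr[OF Q(3), where g="\<lambda>p. ennreal (c (fst (fst p)) (snd p))"]) auto
      also have "\<dots> \<le> ennreal (B\<^sup>2) * ennreal (W \<mu>' \<mu>) + ennreal (q * r / 2)"
        using N(5) by (simp add: transport_cost_eq_W near assms)
      also have "\<dots> = ennreal (B\<^sup>2 * W \<mu>' \<mu> + q * r / 2)"
        using q r(1) by (simp add: ennreal_mult)
      also have "\<dots> \<le> ennreal (q * r)" by (rule ennreal_leI[OF small[OF near(3)]])
      finally show ?thesis .
    qed
    have costY: "(\<integral>\<^sup>+p. ennreal (c (Y' p) (Y p)) \<partial>Q) \<le> ennreal (q * r)"
    proof -
      have "(\<integral>\<^sup>+p. ennreal (c (Y' p) (Y p)) \<partial>Q) \<le> ennreal (B\<^sup>2) * ennreal (W \<nu>' \<nu>) + ennreal (q * r / 2)"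
        using Q(5) unfolding Y'_def Y_def by (simp add: transport_cost_eq_W near assms)
      also have "\<dots> = ennreal (B\<^sup>2 * W \<nu>' \<nu> + q * r / 2)"
        using q r(1) by (simp add: ennreal_mult)
      also have "\<dots> \<le> ennreal (q * r)" by (rule ennreal_leI[OF small[OF near(4)]])
      finally show ?thesis .
    qed
    define E where "E = (X -` (- G1) \<inter> space Q) \<union> (Y -` (- G2) \<inter> space Q)
      \<union> {w\<in>space Q. r \<le> c (X' w) (X w)} \<union> {w\<in>space Q. r \<le> c (Y' w) (Y w)}"
    have G[measurable]: "G1 \<in> sets borel" "G2 \<in> sets borel" using 1 2 by auto
    have [measurable]: "E \<in> sets Q" unfolding E_def by measurable
    have "measure Q E \<le> measure Q (X -` (- G1) \<inter> space Q) + measure Q (Y -` (- G2) \<inter> space Q)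
      + measure Q {w\<in>space Q. r \<le> c (X' w) (X w)} + measure Q {w\<in>space Q. r \<le> c (Y' w) (Y w)}"
      unfolding E_def
      by (intro order_trans[OF measure_Un_le] add_mono order_refl) measurable
    also have "measure Q (X -` (- G1) \<inter> space Q) = measure \<mu> (- G1)"
      unfolding lawX[symmetric] by (rule measure_distr[symmetric]) auto
    also have "measure Q (Y -` (- G2) \<inter> space Q) = measure \<nu> (- G2)"
      unfolding lawY[symmetric] by (rule measure_distr[symmetric]) auto
    also have "measure Q {w\<in>space Q. r \<le> c (X' w) (X w)} \<le> q * r / r"
      using q r(1) costX by (intro markov_c[OF Q(1)]) auto
    also have "measure Q {w\<in>space Q. r \<le> c (Y' w) (Y w)} \<le> q * r / r"
      using q r(1) costY by (intro markov_c[OF Q(1)]) auto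
    finally have "measure Q E < 5 * q" using 1(4) 2(4) r(1) q(1) by simp
    then have small1: "measure Q E < d1" and small2: "measure Q E < d2" using q by auto
    have pt: "ennreal (c (X w) (Y w)) \<le> (ennreal (c (X' w) (Y' w)) + ennreal (e / 4)) +
       ennreal B * (ennreal (c undefined (X w)) * indicator E w + ennreal (c undefined (Y w)) * indicator E w)"
      if "w \<in> space Q" for w
    proof (cases "w \<in> E")
      case True
      have "ennreal (c (X w) (Y w)) \<le> ennreal (B * (c undefined (X w) + c undefined (Y w)))"
        using relaxed_triangle[of "X w" "Y w" undefined] by (intro ennreal_leI) (simp add: c_commute[of "X w"])
      then have "ennreal (c (X w) (Y w)) \<le> ennreal B * (ennreal (c undefined (X w)) * indicator E w + ennreal (c undefined (Y w)) * indicator E w)"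
        using True B by (simp add: ennreal_mult)
      then show ?thesis by (rule order_trans) simp
    next
      case False
      then have "X w \<in> K1 \<union> K2" "Y w \<in> K1 \<union> K2" "c (X w) (X' w) < r" "c (Y w) (Y' w) < r"
        using that 1(3) 2(3) by (auto simp: E_def c_commute[of "X w"] c_commute[of "Y w"])
      then have "\<bar>c (X' w) (Y' w) - c (X w) (Y w)\<bar> < e / 4" by (rule r(2))
      then have "ennreal (c (X w) (Y w)) \<le> ennreal (c (X' w) (Y' w) + e / 4)"
        by (intro ennreal_leI) linarith
      then show ?thesis using False assms(3) by simp
    qed
    have "transport_cost c \<mu> \<nu> \<le> (\<integral>\<^sup>+p. ennreal (c (X p) (Y p)) \<partial>Q)"
      by (rule transport_cost_le[OF Q(1) meas(3,4) lawX lawY])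
    also have "\<dots> \<le> (\<integral>\<^sup>+w. (ennreal (c (X' w) (Y' w)) + ennreal (e / 4)) +
       ennreal B * (ennreal (c undefined (X w)) * indicator E w + ennreal (c undefined (Y w)) * indicator E w) \<partial>Q)"
      by (rule nn_integral_mono[OF pt])
    also have "\<dots> = ((\<integral>\<^sup>+w. ennreal (c (X' w) (Y' w)) \<partial>Q) + ennreal (e / 4)) +
       ennreal B * ((\<integral>\<^sup>+w. ennreal (c undefined (X w)) * indicator E w \<partial>Q) + (\<integral>\<^sup>+w. ennreal (c undefined (Y w)) * indicator E w \<partial>Q))"
      by (simp add: nn_integral_add nn_integral_cmult Q.emeasure_space_1)
    also have "\<dots> \<le> (ennreal (W \<mu>' \<nu>' + e / 4) + ennreal (e / 4)) + ennreal B * (ennreal a + ennreal a)"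
      using d1(2)[OF Q(1) meas(3) lawX _ small1] d2(2)[OF Q(1) meas(4) lawY _ small2] costXY'
      by (intro add_mono mult_left_mono order_refl) (auto simp: less_imp_le)
    also have "\<dots> = ennreal ((W \<mu>' \<nu>' + e / 4) + e / 4 + B * (a + a))"
      using B \<open>a > 0\<close> assms(3) by (simp add: ennreal_mult[symmetric] ennreal_plus[symmetric] del: ennreal_plus)
    also have "(W \<mu>' \<nu>' + e / 4) + e / 4 + B * (a + a) \<le> W \<mu>' \<nu>' + e"
      using assms(3) B by (simp add: a_def field_simps)
    finally have "transport_cost c \<mu> \<nu> \<le> ennreal (W \<mu>' \<nu>' + e)" by (simp add: ennreal_leI)
    then show ?thesis using assms(3) by (intro W_le) auto
  qed
  then show ?thesis using \<open>d > 0\<close> by blast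
qed

text \<open>Peeling off the first link each time puts the weight \<open>B^(i+1)\<close> on link i.
  These growing weights are the reason for the condition \<open>B * \<theta> \<le> 1 / 2\<close> in
  \<open>W_complete\<close>.\<close>

lemma c_chain:
  "c (x n) (x (n + k)) \<le> (\<Sum>i<k. B ^ Suc i * c (x (n + i)) (x (n + Suc i)))"
proof (induction k arbitrary: n)
  case (Suc k)
  have "c (x n) (x (n + Suc k)) \<le> B * (c (x n) (x (Suc n)) + c (x (Suc n)) (x (Suc n + k)))"
    using relaxed_triangle[of "x n" "x (n + Suc k)" "x (Suc n)"] by simp
  also have "\<dots> \<le> B * (c (x n) (x (Suc n)) + (\<Sum>i<k. B ^ Suc i * c (x (Suc n + i)) (x (Suc n + Suc i))))"
    using B_ge_1 Suc[of "Suc n"] by (intro mult_left_mono add_left_mono) auto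
  also have "\<dots> = (\<Sum>i<Suc k. B ^ Suc i * c (x (n + i)) (x (n + Suc i)))"
    by (subst sum.lessThan_Suc_shift) (simp add: sum_distrib_left distrib_left mult.assoc)
  finally show ?case .
qed simp

text \<open>The limit is described through its cost to every point z, the form that
  \<open>borel_measurableI_dense_seq\<close> requires.\<close>

lemma c_chain_limit:
  assumes "(\<Sum>i. ennreal (B ^ Suc i * c (x i) (x (Suc i)))) < \<infinity>"
  obtains y where "\<And>n. ennreal (c (x n) y) \<le> (\<Sum>i. ennreal (B ^ Suc i * c (x (n + i)) (x (n + Suc i))))"
    "\<And>z. (\<lambda>n. c z (x n)) \<longlonglongrightarrow> c z y"
proof -
  define S where "S n = (\<Sum>i. ennreal (B ^ Suc i * c (x (n + i)) (x (n + Suc i))))" for n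
  define b where "b i = B ^ Suc i * c (x i) (x (Suc i))" for i
  have b: "b i \<ge> 0" for i using B_ge_1 by (simp add: b_def)
  have "summable b"
    using assms b by (intro summable_suminf_not_top) (auto simp: b_def)
  have cS: "ennreal (c (x n) (x m)) \<le> S n" if nm: "n \<le> m" for n m
  proof -
    obtain k where m: "m = n + k" using le_Suc_ex[OF nm] by blast
    have "ennreal (c (x n) (x m)) \<le> ennreal (\<Sum>i<k. B ^ Suc i * c (x (n + i)) (x (n + Suc i)))"
      unfolding m by (intro ennreal_leI c_chain)
    also have "\<dots> = (\<Sum>i<k. ennreal (B ^ Suc i * c (x (n + i)) (x (n + Suc i))))"
      using B_ge_1 by (intro sum_ennreal[symmetric]) auto
    also have "\<dots> \<le> S n" unfolding S_def by (intro sum_le_suminf) auto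
    finally show ?thesis .
  qed
  \<comment> \<open>The weights in \<open>S n\<close> restart at \<open>B\<close>, so
    \<open>S n\<close> is dominated by the tail of the series of \<open>b\<close>, whose weights
    keep growing.\<close>
  have Sb: "S n \<le> ennreal (\<Sum>i. b (i + n))" for n
  proof -
    have "S n \<le> (\<Sum>i. ennreal (b (i + n)))"
      unfolding S_def b_def
    proof (intro suminf_le ennreal_leI)
      fix i
      show "B ^ Suc i * c (x (n + i)) (x (n + Suc i)) \<le> B ^ Suc (i + n) * c (x (i + n)) (x (Suc (i + n)))"
        using power_increasing[of "Suc i" "Suc (i + n)" B] B_ge_1
        by (simp add: add.commute[of n i] mult_right_mono del: power_Suc)
    qed auto
    also have "\<dots> = ennreal (\<Sum>i. b (i + n))"
      using b \<open>summable b\<close> by (intro suminf_ennreal2) (auto simp: summable_iff_shift)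
    finally show ?thesis .
  qed
  have tail: "(\<lambda>n. ennreal (\<Sum>i. b (i + n))) \<longlonglongrightarrow> 0"
    using suminf_exist_split2[OF \<open>summable b\<close>] tendsto_ennrealI by fastforce
  have S0: "S \<longlonglongrightarrow> 0"
    by (rule tendsto_sandwich[OF _ _ tendsto_const tail]) (use Sb in auto)
  have "(\<lambda>n. SUP m\<in>{n..}. ennreal (c (x n) (x m))) \<longlonglongrightarrow> 0"
    by (rule tendsto_sandwich[OF _ _ tendsto_const S0]) (use cS in \<open>auto intro!: always_eventually SUP_least\<close>)
  then obtain y where y: "sm_converges c x y"
    using sm_complete unfolding sm_complete_def by blast
  have lim: "(\<lambda>n. c z (x n)) \<longlonglongrightarrow> c z y" for z
    using sm_continuous[unfolded sm_continuous_def, rule_format, of "\<lambda>_. z" z x y] y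
    by (simp add: sm_converges_def)
  have "ennreal (c (x n) y) \<le> S n" for n
  proof (rule LIMSEQ_le_const2)
    show "(\<lambda>m. ennreal (c (x n) (x m))) \<longlonglongrightarrow> ennreal (c (x n) y)"
      by (intro tendsto_ennrealI lim)
    show "\<exists>N. \<forall>m\<ge>N. ennreal (c (x n) (x m)) \<le> S n" using cS by blast
  qed
  then show ?thesis using that lim unfolding S_def by blast
qed

text \<open>\<open>B * \<theta> \<le> 1 / 2\<close> makes the expectations of the weighted
  increments from \<open>c_chain\<close> geometric with ratio at most 1/2. Their sum is thus
  integrable, hence finite almost surely, and the expected sum from n on bounds the distance to the
  limit; the 2 in the rate is the geometric series.\<close>

lemma W_complete:
  assumes "\<And>n. \<mu> n \<in> Pc c" "\<And>n. W (\<mu> n) (\<mu> (Suc n)) \<le> C * \<theta> ^ n"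
    and "0 < \<theta>" "B * \<theta> \<le> 1 / 2" "0 \<le> C"
  obtains \<nu> where "\<nu> \<in> Pc c" "\<And>n. W (\<mu> n) \<nu> \<le> 2 * B * (B\<^sup>2 * C + 1) * \<theta> ^ n"
proof -
  have B: "B > 0" using B_ge_1 by simp
  \<comment> \<open>In units of \<open>\<theta>^n\<close>, a step of the chain costs at most
    \<open>B^2 * C\<close>, plus 1 for the error term of \<open>coupling_kernel\<close>.\<close>
  define D where "D = B\<^sup>2 * C + 1"
  have "D > 0" using assms(5) unfolding D_def by (intro add_nonneg_pos) auto
  have "\<exists>K. K \<in> borel \<rightarrow>\<^sub>M prob_algebra borel \<and> \<mu> n \<bind> K = \<mu> (Suc n) \<and>
    (\<integral>\<^sup>+x. \<integral>\<^sup>+y. ennreal (c x y) \<partial>K x \<partial>\<mu> n) \<le> ennreal (D * \<theta> ^ n)" for n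
  proof -
    have "\<theta> ^ n > 0" using assms(3) by simp
    from coupling_kernel[OF Pc_borel_probs[OF assms(1)] Pc_borel_probs[OF assms(1)] transport_cost_finite[OF assms(1,1)] this]
    obtain K where K: "K \<in> borel \<rightarrow>\<^sub>M prob_algebra borel" "\<mu> n \<bind> K = \<mu> (Suc n)"
      "(\<integral>\<^sup>+x. \<integral>\<^sup>+y. ennreal (c x y) \<partial>K x \<partial>\<mu> n) \<le> ennreal (B\<^sup>2) * transport_cost c (\<mu> n) (\<mu> (Suc n)) + ennreal (\<theta> ^ n)"
      by blast
    note K(3)
    also have "ennreal (B\<^sup>2) * transport_cost c (\<mu> n) (\<mu> (Suc n)) + ennreal (\<theta> ^ n) = ennreal (B\<^sup>2 * W (\<mu> n) (\<mu> (Suc n)) + \<theta> ^ n)"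
      using assms(3) by (simp add: transport_cost_eq_W assms(1) ennreal_mult)
    also have "\<dots> \<le> ennreal (D * \<theta> ^ n)"
      using mult_left_mono[OF assms(2)[of n], of "B\<^sup>2"] by (intro ennreal_leI) (simp add: D_def algebra_simps)
    finally show ?thesis using K by blast
  qed
  then obtain K where K: "\<And>n. K n \<in> borel \<rightarrow>\<^sub>M prob_algebra borel" "\<And>n. \<mu> n \<bind> K n = \<mu> (Suc n)"
    "\<And>n. (\<integral>\<^sup>+x. \<integral>\<^sup>+y. ennreal (c x y) \<partial>K n x \<partial>\<mu> n) \<le> ennreal (D * \<theta> ^ n)"
    by metis
  from markov_chain[of \<mu> K, OF Pc_borel_probs[OF assms(1)] K(1,2)]
  obtain M :: "(nat \<Rightarrow> 'a) measure" where M: "prob_space M" "\<And>n. (\<lambda>w. w n) \<in> measurable M borel"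
    "\<And>n. distr M borel (\<lambda>w. w n) = \<mu> n"
    "\<And>n g. g \<in> borel_measurable (borel \<Otimes>\<^sub>M borel) \<Longrightarrow>
       (\<integral>\<^sup>+w. g (w n, w (Suc n)) \<partial>M) = (\<integral>\<^sup>+x. \<integral>\<^sup>+y. g (x, y) \<partial>K n x \<partial>\<mu> n)"
    by blast
  note M(2)[measurable]
  interpret prob_space M by fact
  define S where "S n w = (\<Sum>i. ennreal (B ^ Suc i * c (w (n + i)) (w (n + Suc i))))" for n and w :: "nat \<Rightarrow> 'a"
  have [measurable]: "S n \<in> borel_measurable M" for n unfolding S_def by measurable
  have cost: "(\<integral>\<^sup>+w. ennreal (c (w n) (w (Suc n))) \<partial>M) \<le> ennreal (D * \<theta> ^ n)" for n
    using M(4)[of "\<lambda>p. ennreal (c (fst p) (snd p))" n] K(3)[of n] by simp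
  have ES: "(\<integral>\<^sup>+w. S n w \<partial>M) \<le> ennreal (2 * B * D * \<theta> ^ n)" for n
  proof -
    have "(\<integral>\<^sup>+w. S n w \<partial>M) = (\<Sum>i. \<integral>\<^sup>+w. ennreal (B ^ Suc i * c (w (n + i)) (w (n + Suc i))) \<partial>M)"
      unfolding S_def by (rule nn_integral_suminf) measurable
    also have "\<dots> \<le> (\<Sum>i. ennreal (B * D * \<theta> ^ n * (1 / 2) ^ i))"
    proof (intro suminf_le)
      fix i
      have "(\<integral>\<^sup>+w. ennreal (B ^ Suc i * c (w (n + i)) (w (n + Suc i))) \<partial>M)
          = ennreal (B ^ Suc i) * (\<integral>\<^sup>+w. ennreal (c (w (n + i)) (w (Suc (n + i)))) \<partial>M)"
        using B by (simp add: ennreal_mult nn_integral_cmult del: power_Suc)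
      also have "\<dots> \<le> ennreal (B ^ Suc i) * ennreal (D * \<theta> ^ (n + i))"
        by (intro mult_left_mono cost) simp
      also have "\<dots> = ennreal (B * D * \<theta> ^ n * (B * \<theta>) ^ i)"
        using B \<open>D > 0\<close> assms(3) by (simp add: ennreal_mult[symmetric] power_add power_mult_distrib ac_simps)
      also have "\<dots> \<le> ennreal (B * D * \<theta> ^ n * (1 / 2) ^ i)"
        using B \<open>D > 0\<close> assms(3,4) by (intro ennreal_leI mult_left_mono power_mono) auto
      finally show "(\<integral>\<^sup>+w. ennreal (B ^ Suc i * c (w (n + i)) (w (n + Suc i))) \<partial>M)
        \<le> ennreal (B * D * \<theta> ^ n * (1 / 2) ^ i)" .
    qed auto
    also have "\<dots> = ennreal (\<Sum>i. B * D * \<theta> ^ n * (1 / 2) ^ i)"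
      using B \<open>D > 0\<close> assms(3) by (intro suminf_ennreal2) (auto intro!: summable_mult summable_geometric)
    also have "(\<Sum>i. B * D * \<theta> ^ n * (1 / 2) ^ i) = 2 * B * D * \<theta> ^ n"
      by (subst suminf_mult) (auto simp: suminf_geometric intro!: summable_geometric)
    finally show ?thesis .
  qed
  have S0: "S 0 w = (\<Sum>i. ennreal (B ^ Suc i * c (w i) (w (Suc i))))" for w
    unfolding S_def by simp
  have "(\<integral>\<^sup>+w. S 0 w \<partial>M) \<noteq> \<infinity>" using ES[of 0] by (auto simp: top_unique)
  then have AE: "AE w in M. S 0 w < \<infinity>"
    using nn_integral_PInf_AE[of "S 0" M] by (auto simp: less_top)
  \<comment> \<open>On the null event where the series diverges, the default \<open>w 0\<close>
    keeps \<open>y\<close> a limit of measurable functions in the measurability proof.\<close>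
  define y where "y w = (if S 0 w < \<infinity> then
    (SOME y. (\<forall>n. ennreal (c (w n) y) \<le> S n w) \<and> (\<forall>z. (\<lambda>n. c z (w n)) \<longlonglongrightarrow> c z y)) else w 0)" for w
  have y: "(\<forall>n. ennreal (c (w n) (y w)) \<le> S n w) \<and> (\<forall>z. (\<lambda>n. c z (w n)) \<longlonglongrightarrow> c z (y w))"
    if "S 0 w < \<infinity>" for w
  proof -
    have "\<exists>y. (\<forall>n. ennreal (c (w n) y) \<le> S n w) \<and> (\<forall>z. (\<lambda>n. c z (w n)) \<longlonglongrightarrow> c z y)"
    proof (rule c_chain_limit[of w])
      show "(\<Sum>i. ennreal (B ^ Suc i * c (w i) (w (Suc i)))) < \<infinity>"
        using that unfolding S0 .
    next
      fix y assume "\<And>n. ennreal (c (w n) y) \<le> (\<Sum>i. ennreal (B ^ Suc i * c (w (n + i)) (w (n + Suc i))))"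
        "\<And>z. (\<lambda>n. c z (w n)) \<longlonglongrightarrow> c z y"
      then show ?thesis unfolding S_def by (intro exI[of _ y] conjI allI)
    qed
    from someI_ex[OF this] show ?thesis using that by (simp add: y_def)
  qed
  have ymeas[measurable]: "y \<in> measurable M borel"
  proof (rule borel_measurableI_dense_seq)
    fix i
    have "(\<lambda>w. c (dense_seq i) (if S 0 w < \<infinity> then w k else w 0)) \<in> borel_measurable M" for k
      by measurable
    then show "(\<lambda>w. c (dense_seq i) (y w)) \<in> borel_measurable M"
    proof (rule borel_measurable_LIMSEQ_real[rotated])
      fix w
      show "(\<lambda>k. c (dense_seq i) (if S 0 w < \<infinity> then w k else w 0)) \<longlonglongrightarrow> c (dense_seq i) (y w)"
        using y[of w] by (cases "S 0 w < \<infinity>") (auto simp: y_def)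
    qed
  qed
  define \<nu> where "\<nu> = distr M borel y"
  have \<nu>: "\<nu> \<in> borel_probs" unfolding \<nu>_def borel_probs_def by (auto intro: prob_space_distr)
  have cy: "(\<integral>\<^sup>+w. ennreal (c (w n) (y w)) \<partial>M) \<le> ennreal (2 * B * D * \<theta> ^ n)" for n
  proof -
    have "(\<integral>\<^sup>+w. ennreal (c (w n) (y w)) \<partial>M) \<le> (\<integral>\<^sup>+w. S n w \<partial>M)"
      by (rule nn_integral_mono_AE, rule eventually_mono[OF AE]) (use y in blast)
    then show ?thesis using ES[of n] by simp
  qed
  have "\<nu> \<in> Pc c"
  proof -
    have "(\<integral>\<^sup>+x. ennreal (c undefined x) \<partial>\<nu>) = (\<integral>\<^sup>+w. ennreal (c undefined (y w)) \<partial>M)"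
      unfolding \<nu>_def by (rule nn_integral_distr) auto
    also have "\<dots> \<le> ennreal B * ((\<integral>\<^sup>+w. ennreal (c undefined (w 0)) \<partial>M) + (\<integral>\<^sup>+w. ennreal (c (w 0) (y w)) \<partial>M))"
      by (rule nn_integral_c_triangle) measurable
    also have "(\<integral>\<^sup>+w. ennreal (c undefined (w 0)) \<partial>M) = (\<integral>\<^sup>+x. ennreal (c undefined x) \<partial>\<mu> 0)"
      unfolding M(3)[symmetric] by (rule nn_integral_distr[symmetric]) auto
    also have "ennreal B * ((\<integral>\<^sup>+x. ennreal (c undefined x) \<partial>\<mu> 0) + (\<integral>\<^sup>+w. ennreal (c (w 0) (y w)) \<partial>M)) < \<infinity>"
      using Pc_moment[OF assms(1)[of 0], of undefined] order_le_less_trans[OF cy[of 0] ennreal_less_top]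
      by (auto simp: ennreal_mult_less_top)
    finally show ?thesis using \<nu> unfolding Pc_def by blast
  qed
  moreover have "W (\<mu> n) \<nu> \<le> 2 * B * (B\<^sup>2 * C + 1) * \<theta> ^ n" for n
  proof (rule W_le)
    have "transport_cost c (\<mu> n) \<nu> \<le> (\<integral>\<^sup>+w. ennreal (c (w n) (y w)) \<partial>M)"
      using M(1,3) \<nu>_def by (intro transport_cost_le) auto
    then show "transport_cost c (\<mu> n) \<nu> \<le> ennreal (2 * B * (B\<^sup>2 * C + 1) * \<theta> ^ n)"
      using cy[of n] unfolding D_def by (rule order_trans)
    show "0 \<le> 2 * B * (B\<^sup>2 * C + 1) * \<theta> ^ n"
      using B \<open>D > 0\<close> assms(3) unfolding D_def by simp
  qed
  ultimately show ?thesis using that by blast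
qed

section \<open>Evolution of measures along semigroups\<close>

definition semigroup_of :: "'a operator \<Rightarrow> real \<Rightarrow> 'a \<Rightarrow> 'a measure" where
  "semigroup_of A = (SOME \<kappa>. prob_semigroup \<kappa> \<and> generator_of \<kappa> = A)"

lemma semigroup_of:
  assumes "A \<in> Gc0 c"
  shows "prob_semigroup (semigroup_of A)"
proof -
  have "\<exists>\<kappa>. prob_semigroup \<kappa> \<and> generator_of \<kappa> = A" using assms by (auto simp: Gc0_def)
  from someI_ex[OF this] show ?thesis by (simp add: semigroup_of_def)
qed

lemma exp_op_eq: "exp_op A t = kernel_op (semigroup_of A) t"
  by (simp add: exp_op_def semigroup_of_def)

text \<open>The semigroup maps each \<open>inner_bump\<close> into \<open>C0\<close>, hence to a
  measurable function, and these functions converge to the mass that the kernel gives to an open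
  set.\<close>

lemma prob_semigroup_measurable:
  fixes \<kappa> :: "real \<Rightarrow> 'a \<Rightarrow> 'a measure"
  assumes "prob_semigroup \<kappa>" "0 \<le> t"
  shows "\<kappa> t \<in> borel \<rightarrow>\<^sub>M prob_algebra borel"
proof (rule measurable_prob_algebra_generated[OF sets_borel])
  have \<kappa>: "\<kappa> t x \<in> borel_probs" for x using assms by (auto simp: prob_semigroup_def)
  show "Int_stable {U::'a set. open U}" by (auto simp: Int_stable_def)
  show "prob_space (\<kappa> t x)" "sets (\<kappa> t x) = sets borel" for x
    using borel_probsD[OF \<kappa>] by auto
  fix U :: "'a set" assume "U \<in> {U. open U}"
  then have "open U" by simp
  have "(\<lambda>x. measure (\<kappa> t x) U) \<in> borel_measurable borel"
  proof (rule borel_measurable_LIMSEQ_real)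
    show "(\<lambda>n. kernel_op \<kappa> t (inner_bump U n) x) \<longlonglongrightarrow> measure (\<kappa> t x) U" for x
      unfolding kernel_op_def by (rule integral_inner_bump_tendsto[OF \<kappa> \<open>open U\<close>])
    have "kernel_op \<kappa> t (inner_bump U n) \<in> C0" for n
      using assms inner_bump_C0 by (auto simp: prob_semigroup_def)
    then show "kernel_op \<kappa> t (inner_bump U n) \<in> borel_measurable borel" for n
      by (rule C0_measurable)
  qed
  then show "(\<lambda>x. emeasure (\<kappa> t x) U) \<in> borel_measurable borel"
    using finite_measure.emeasure_eq_measure[OF prob_space.finite_measure[OF borel_probsD(1)[OF \<kappa>]]]
    by simp
qed auto

lemma evolve_exists:
  fixes \<kappa> :: "real \<Rightarrow> 'a \<Rightarrow> 'a measure"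
  assumes "prob_semigroup \<kappa>" "0 \<le> t" "\<mu> \<in> borel_probs"
  shows "\<exists>\<nu>\<in>borel_probs. \<forall>\<phi>\<in>C0. (\<integral>x. \<phi> x \<partial>\<nu>) = (\<integral>x. kernel_op \<kappa> t \<phi> x \<partial>\<mu>)"
proof (intro bexI[of _ "\<mu> \<bind> \<kappa> t"] ballI)
  have \<kappa>: "\<kappa> t \<in> borel \<rightarrow>\<^sub>M prob_algebra borel" by (rule prob_semigroup_measurable[OF assms(1,2)])
  have \<mu>: "\<mu> \<in> space (prob_algebra borel)" using assms(3) by (simp add: space_prob_algebra_borel)
  show "\<mu> \<bind> \<kappa> t \<in> borel_probs"
    using prob_space_bind'[OF \<mu> \<kappa>] sets_bind'[OF \<mu> \<kappa>] by (simp add: borel_probs_def)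
  fix \<phi> :: "'a \<Rightarrow> real" assume \<phi>: "\<phi> \<in> C0"
  obtain b where b: "\<And>x. \<bar>\<phi> x\<bar> \<le> b" using C0_bounded[OF \<phi>] by blast
  have p: "prob_space (\<kappa> t x)" for x
    using assms by (auto simp: prob_semigroup_def borel_probs_def)
  show "(\<integral>x. \<phi> x \<partial>(\<mu> \<bind> \<kappa> t)) = (\<integral>x. kernel_op \<kappa> t \<phi> x \<partial>\<mu>)"
    unfolding kernel_op_def
    by (rule integral_bind[where K=borel and B=b and B'=1])
      (use b C0_measurable[OF \<phi>] kernel_subprob[OF \<kappa> assms(3)] borel_probsD(1)[OF assms(3)] p
        in \<open>auto simp: prob_space.finite_measure prob_space.emeasure_space_1\<close>)
qed

text \<open>Existence is the composition of \<open>\<mu>\<close> with the kernel, uniqueness the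
  fact that \<open>C0\<close> separates Borel probabilities.\<close>

lemma evolve:
  assumes "A \<in> Gc0 c" "0 \<le> t" "\<mu> \<in> borel_probs"
  shows "evolve A t \<mu> \<in> borel_probs"
    "\<And>\<phi>. \<phi> \<in> C0 \<Longrightarrow> (\<integral>x. \<phi> x \<partial>evolve A t \<mu>) = (\<integral>x. exp_op A t \<phi> x \<partial>\<mu>)"
proof -
  have "\<exists>!\<nu>. \<nu> \<in> borel_probs \<and> (\<forall>\<phi>\<in>C0. (\<integral>x. \<phi> x \<partial>\<nu>) = (\<integral>x. exp_op A t \<phi> x \<partial>\<mu>))"
    using evolve_exists[OF semigroup_of[OF assms(1)] assms(2,3)] unfolding exp_op_eq
    by (auto intro: borel_probs_eqI_C0)
  from theI'[OF this] show "evolve A t \<mu> \<in> borel_probs"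
    "\<And>\<phi>. \<phi> \<in> C0 \<Longrightarrow> (\<integral>x. \<phi> x \<partial>evolve A t \<mu>) = (\<integral>x. exp_op A t \<phi> x \<partial>\<mu>)"
    by (auto simp: evolve_def)
qed

lemma evolve_0:
  assumes "A \<in> Gc0 c" "\<mu> \<in> borel_probs"
  shows "evolve A 0 \<mu> = \<mu>"
proof (rule borel_probs_eqI_C0)
  fix \<phi> :: "'a \<Rightarrow> real" assume "\<phi> \<in> C0"
  moreover have "exp_op A 0 \<phi> = \<phi>"
    using semigroup_of[OF assms(1)] \<open>\<phi> \<in> C0\<close> by (auto simp: exp_op_eq prob_semigroup_def)
  ultimately show "(\<integral>x. \<phi> x \<partial>evolve A 0 \<mu>) = (\<integral>x. \<phi> x \<partial>\<mu>)"
    using evolve(2)[OF assms(1) order_refl assms(2)] by simp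
qed (use assms evolve in auto)

text \<open>The semigroup law is assumed on \<open>C0\<close>, which is also where equality of
  measures is tested. By duality the operator applied last to a function acts first on the
  measure.\<close>

lemma evolve_add:
  assumes "A \<in> Gc0 c" "\<mu> \<in> borel_probs" "0 \<le> t" "0 \<le> s"
  shows "evolve A (t + s) \<mu> = evolve A s (evolve A t \<mu>)"
proof (rule borel_probs_eqI_C0)
  have t: "evolve A t \<mu> \<in> borel_probs" by (rule evolve(1)[OF assms(1,3,2)])
  show "evolve A s (evolve A t \<mu>) \<in> borel_probs" by (rule evolve(1)[OF assms(1,4) t])
  show "evolve A (t + s) \<mu> \<in> borel_probs" using assms by (intro evolve(1)) auto
  fix \<phi> :: "'a \<Rightarrow> real" assume \<phi>: "\<phi> \<in> C0"
  have sem: "exp_op A s \<phi> \<in> C0" "exp_op A (t + s) \<phi> = exp_op A t (exp_op A s \<phi>)"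
    using semigroup_of[OF assms(1)] \<phi> assms(3,4) by (auto simp: exp_op_eq prob_semigroup_def)
  have "(\<integral>x. \<phi> x \<partial>evolve A s (evolve A t \<mu>)) = (\<integral>x. exp_op A t (exp_op A s \<phi>) x \<partial>\<mu>)"
    using evolve(2)[OF assms(1,4) t \<phi>] evolve(2)[OF assms(1,3,2) sem(1)] by simp
  then show "(\<integral>x. \<phi> x \<partial>evolve A (t + s) \<mu>) = (\<integral>x. \<phi> x \<partial>evolve A s (evolve A t \<mu>))"
    using evolve(2)[OF assms(1) _ assms(2) \<phi>, of "t + s"] assms(3,4) sem(2) by simp
qed

section \<open>Continuous curves of measures\<close>

definition W_continuous_on :: "real set \<Rightarrow> (real \<Rightarrow> 'a measure) \<Rightarrow> bool" where
  "W_continuous_on I \<rho> \<longleftrightarrow>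
     (\<forall>t\<in>I. \<rho> t \<in> Pc c) \<and> (\<forall>t\<in>I. \<forall>e>0. \<exists>d>0. \<forall>s\<in>I. \<bar>s - t\<bar> < d \<longrightarrow> W (\<rho> t) (\<rho> s) < e)"

lemma Pc_curves_iff: "\<rho> \<in> Pc_curves c I \<longleftrightarrow> W_continuous_on I \<rho>"
proof (cases "\<forall>t\<in>I. \<rho> t \<in> Pc c")
  case True
  have "((\<lambda>s. transport_cost c (\<rho> t) (\<rho> s)) \<longlongrightarrow> 0) (at t within I) \<longleftrightarrow>
    (\<forall>e>0. \<exists>d>0. \<forall>s\<in>I. \<bar>s - t\<bar> < d \<longrightarrow> W (\<rho> t) (\<rho> s) < e)" if t: "t \<in> I" for t
  proof -
    have "((\<lambda>s. transport_cost c (\<rho> t) (\<rho> s)) \<longlongrightarrow> 0) (at t within I) \<longleftrightarrow>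
      ((\<lambda>s. ennreal (W (\<rho> t) (\<rho> s))) \<longlongrightarrow> ennreal 0) (at t within I)"
      using True t by (intro filterlim_cong refl) (auto simp: eventually_at_filter transport_cost_eq_W)
    also have "\<dots> \<longleftrightarrow> ((\<lambda>s. W (\<rho> t) (\<rho> s)) \<longlongrightarrow> 0) (at t within I)"
      by (rule tendsto_ennreal_iff) auto
    also have "\<dots> \<longleftrightarrow> (\<forall>e>0. \<exists>d>0. \<forall>s\<in>I. s \<noteq> t \<longrightarrow> \<bar>s - t\<bar> < d \<longrightarrow> W (\<rho> t) (\<rho> s) < e)"
      unfolding tendsto_iff eventually_at by (simp add: dist_real_def imp_conjL)
    also have "\<dots> \<longleftrightarrow> (\<forall>e>0. \<exists>d>0. \<forall>s\<in>I. \<bar>s - t\<bar> < d \<longrightarrow> W (\<rho> t) (\<rho> s) < e)"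
      using W_self True t by metis
    finally show ?thesis .
  qed
  then show ?thesis using True by (auto simp: Pc_curves_def W_continuous_on_def)
qed (auto simp: Pc_curves_def W_continuous_on_def)

lemma W_continuous_on_subset: "W_continuous_on I \<rho> \<Longrightarrow> J \<subseteq> I \<Longrightarrow> W_continuous_on J \<rho>"
  unfolding W_continuous_on_def by (meson subsetD)

lemma W_continuous_onD:
  assumes "W_continuous_on I \<rho>" "t \<in> I"
  shows "\<rho> t \<in> Pc c" "\<And>e. 0 < e \<Longrightarrow> \<exists>d>0. \<forall>s\<in>I. \<bar>s - t\<bar> < d \<longrightarrow> W (\<rho> t) (\<rho> s) < e"
  using assms unfolding W_continuous_on_def by blast+

lemma evolve_Pc:
  assumes "A \<in> Gc0 c" "\<mu> \<in> Pc c"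
  shows "W_continuous_on {0..} (\<lambda>t. evolve A t \<mu>)"
  using assms unfolding Gc0_def Pc_curves_iff by auto

text \<open>The constant of the relaxed triangle inequality for \<open>W\<close>.\<close>

definition b :: real where "b = B ^ 3"

lemma b_ge_1: "b \<ge> 1" using B_ge_1 by (simp add: b_def)

lemma W_triangle3:
  assumes "\<mu> \<in> Pc c" "\<nu> \<in> Pc c" "\<mu>' \<in> Pc c" "\<nu>' \<in> Pc c"
  shows "W \<mu> \<nu> \<le> b\<^sup>2 * (W \<mu> \<mu>' + W \<mu>' \<nu>' + W \<nu>' \<nu>)"
proof -
  have "W \<mu> \<nu> \<le> b * (W \<mu> \<mu>' + W \<mu>' \<nu>)" by (rule W_triangle[folded b_def, OF assms(1-3)])
  also have "\<dots> \<le> b * (W \<mu> \<mu>' + b * (W \<mu>' \<nu>' + W \<nu>' \<nu>))"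
    using W_triangle[folded b_def, OF assms(3,2,4)] b_ge_1 by (intro mult_left_mono add_left_mono) auto
  also have "\<dots> \<le> b * (b * W \<mu> \<mu>' + b * (W \<mu>' \<nu>' + W \<nu>' \<nu>))"
    using b_ge_1 mult_right_mono[of 1 b "W \<mu> \<mu>'"] by (intro mult_left_mono add_right_mono) auto
  also have "\<dots> = b\<^sup>2 * (W \<mu> \<mu>' + W \<mu>' \<nu>' + W \<nu>' \<nu>)"
    by (simp only: power2_eq_square distrib_left mult.assoc add.assoc)
  finally show ?thesis .
qed

lemma W_uniformly_continuous:
  assumes "W_continuous_on {0..T} \<rho>" "e > 0"
  obtains d where "d > 0" "\<And>s t. s \<in> {0..T} \<Longrightarrow> t \<in> {0..T} \<Longrightarrow> \<bar>s - t\<bar> < d \<Longrightarrow> W (\<rho> s) (\<rho> t) < e"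
proof -
  have "e / (2 * b) > 0" using assms(2) b_ge_1 by (intro divide_pos_pos) auto
  then have "\<forall>t\<in>{0..T}. \<exists>d>0. \<forall>s\<in>{0..T}. \<bar>s - t\<bar> < d \<longrightarrow> W (\<rho> t) (\<rho> s) < e / (2 * b)"
    using W_continuous_onD(2)[OF assms(1)] by blast
  then obtain d where d: "\<And>t. t \<in> {0..T} \<Longrightarrow> d t > 0"
    "\<And>t s. t \<in> {0..T} \<Longrightarrow> s \<in> {0..T} \<Longrightarrow> \<bar>s - t\<bar> < d t \<Longrightarrow> W (\<rho> t) (\<rho> s) < e / (2 * b)"
    by metis
  have cov: "{0..T} \<subseteq> \<Union>((\<lambda>t. ball t (d t)) ` {0..T})" using d(1) by fastforce
  obtain r where r: "r > 0" "\<And>x. x \<in> {0..T} \<Longrightarrow> \<exists>G\<in>(\<lambda>t. ball t (d t)) ` {0..T}. ball x r \<subseteq> G"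
    by (rule Heine_Borel_lemma[OF compact_Icc cov]) auto
  show ?thesis
  proof (rule that[OF r(1)])
    fix s t assume st: "s \<in> {0..T}" "t \<in> {0..T}" "\<bar>s - t\<bar> < r"
    obtain q where q: "q \<in> {0..T}" "ball s r \<subseteq> ball q (d q)" using r(2)[OF st(1)] by auto
    have "s \<in> ball q (d q)" "t \<in> ball q (d q)" using q(2) st r(1) by (auto simp: dist_real_def subset_iff)
    then have "W (\<rho> q) (\<rho> s) < e / (2 * b)" "W (\<rho> q) (\<rho> t) < e / (2 * b)"
      using d(2)[OF q(1)] st by (auto simp: dist_real_def abs_minus_commute)
    then have "W (\<rho> s) (\<rho> q) + W (\<rho> q) (\<rho> t) < 2 * (e / (2 * b))"
      by (simp add: W_commute[of "\<rho> s"])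
    then have "b * (W (\<rho> s) (\<rho> q) + W (\<rho> q) (\<rho> t)) < b * (2 * (e / (2 * b)))"
      using b_ge_1 by (intro mult_strict_left_mono) auto
    also have "\<dots> = e" using b_ge_1 by simp
    finally show "W (\<rho> s) (\<rho> t) < e"
      using W_triangle[folded b_def, of "\<rho> s" "\<rho> t" "\<rho> q"] W_continuous_onD(1)[OF assms(1)] st q by force
  qed
qed

lemma W_bounded_curves:
  assumes "W_continuous_on {0..T} \<rho>" "W_continuous_on {0..T} \<sigma>"
  shows "\<exists>C. \<forall>s\<in>{0..T}. W (\<rho> s) (\<sigma> s) \<le> C"
proof (rule locally_bounded_imp_bounded)
  fix t assume t: "t \<in> {0..T}"
  obtain d1 where d1: "d1 > 0" "\<forall>s\<in>{0..T}. \<bar>s - t\<bar> < d1 \<longrightarrow> W (\<rho> t) (\<rho> s) < 1"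
    using W_continuous_onD(2)[OF assms(1) t zero_less_one] by blast
  obtain d2 where d2: "d2 > 0" "\<forall>s\<in>{0..T}. \<bar>s - t\<bar> < d2 \<longrightarrow> W (\<sigma> t) (\<sigma> s) < 1"
    using W_continuous_onD(2)[OF assms(2) t zero_less_one] by blast
  have "W (\<rho> s) (\<sigma> s) \<le> b\<^sup>2 * (1 + W (\<rho> t) (\<sigma> t) + 1)" if s: "s \<in> {0..T}" "\<bar>s - t\<bar> < min d1 d2" for s
  proof -
    have "W (\<rho> s) (\<sigma> s) \<le> b\<^sup>2 * (W (\<rho> s) (\<rho> t) + W (\<rho> t) (\<sigma> t) + W (\<sigma> t) (\<sigma> s))"
      using W_continuous_onD(1)[OF assms(1)] W_continuous_onD(1)[OF assms(2)] s t by (intro W_triangle3) auto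
    also have "\<dots> \<le> b\<^sup>2 * (1 + W (\<rho> t) (\<sigma> t) + 1)"
      using d1 d2 s by (intro mult_left_mono add_mono) (auto simp: W_commute[of "\<rho> s"] less_imp_le)
    finally show ?thesis .
  qed
  then show "\<exists>d>0. \<exists>C. \<forall>s\<in>{0..T}. \<bar>s - t\<bar> < d \<longrightarrow> W (\<rho> s) (\<sigma> s) \<le> C"
    using d1 d2 by (intro exI[of _ "min d1 d2"] conjI exI[of _ "b\<^sup>2 * (1 + W (\<rho> t) (\<sigma> t) + 1)"]) auto
qed

lemma W_continuous_on_concat:
  assumes \<rho>: "W_continuous_on {a..} \<rho>" and \<sigma>: "W_continuous_on {b'..} \<sigma>" and "a \<le> b'" "\<rho> b' = \<sigma> b'"
  shows "W_continuous_on {a..} (\<lambda>t. if t \<le> b' then \<rho> t else \<sigma> t)" (is "W_continuous_on _ ?f")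
  unfolding W_continuous_on_def
proof (intro conjI ballI allI impI)
  fix t assume t: "t \<in> {a..}"
  then show "?f t \<in> Pc c" using W_continuous_onD(1)[OF \<rho>, of t] W_continuous_onD(1)[OF \<sigma>, of t] by auto
  fix e :: real assume "e > 0"
  consider "t < b'" | "t = b'" | "t > b'" by linarith
  then show "\<exists>d>0. \<forall>s\<in>{a..}. \<bar>s - t\<bar> < d \<longrightarrow> W (?f t) (?f s) < e"
  proof cases
    case 1
    obtain d where "d > 0" "\<forall>s\<in>{a..}. \<bar>s - t\<bar> < d \<longrightarrow> W (\<rho> t) (\<rho> s) < e"
      using W_continuous_onD(2)[OF \<rho> t \<open>e > 0\<close>] by blast
    then show ?thesis using 1 by (intro exI[of _ "min d (b' - t)"]) (auto simp: abs_if split: if_splits)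
  next
    case 2
    obtain d where d: "d > 0" "\<forall>s\<in>{a..}. \<bar>s - t\<bar> < d \<longrightarrow> W (\<rho> t) (\<rho> s) < e"
      using W_continuous_onD(2)[OF \<rho> t \<open>e > 0\<close>] by blast
    have "t \<in> {b'..}" using 2 by simp
    obtain d' where d': "d' > 0" "\<forall>s\<in>{b'..}. \<bar>s - t\<bar> < d' \<longrightarrow> W (\<sigma> t) (\<sigma> s) < e"
      using W_continuous_onD(2)[OF \<sigma> \<open>t \<in> {b'..}\<close> \<open>e > 0\<close>] by blast
    show ?thesis using 2 d d' assms(4) by (intro exI[of _ "min d d'"]) auto
  next
    case 3
    then have "t \<in> {b'..}" by simp
    obtain d where "d > 0" "\<forall>s\<in>{b'..}. \<bar>s - t\<bar> < d \<longrightarrow> W (\<sigma> t) (\<sigma> s) < e"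
      using W_continuous_onD(2)[OF \<sigma> \<open>t \<in> {b'..}\<close> \<open>e > 0\<close>] by blast
    then show ?thesis using 3 by (intro exI[of _ "min d (t - b')"]) (auto simp: abs_if split: if_splits)
  qed
qed

lemma W_continuous_on_shift:
  assumes "W_continuous_on {0..} \<rho>"
  shows "W_continuous_on {a..} (\<lambda>t. \<rho> (t - a))"
  unfolding W_continuous_on_def
proof (intro conjI ballI allI impI)
  fix t assume t: "t \<in> {a..}"
  then have t': "t - a \<in> {0..}" by simp
  then show "\<rho> (t - a) \<in> Pc c" by (rule W_continuous_onD(1)[OF assms])
  fix e :: real assume "e > 0"
  obtain d where d: "d > 0" "\<forall>s\<in>{0..}. \<bar>s - (t - a)\<bar> < d \<longrightarrow> W (\<rho> (t - a)) (\<rho> s) < e"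
    using W_continuous_onD(2)[OF assms t' \<open>e > 0\<close>] by blast
  then show "\<exists>d>0. \<forall>s\<in>{a..}. \<bar>s - t\<bar> < d \<longrightarrow> W (\<rho> (t - a)) (\<rho> (s - a)) < e"
    by (intro exI[of _ d]) (auto simp: algebra_simps)
qed

section \<open>Piecewise constant evolutions\<close>

text \<open>\<open>butlast\<close> appears because \<open>S0\<close> never reads the generator at
  the last partition point. For \<open>pc_approx\<close> that generator would be taken at the
  minimum of an empty set.\<close>

lemma S0_start:
  assumes "sorted_wrt (<) (a # \<Delta>)" "\<rho>\<^sub>0 \<in> Pc c" "\<And>x. x \<in> set (butlast (a # \<Delta>)) \<Longrightarrow> A x \<in> Gc0 c"
  shows "S0 (a # \<Delta>) \<rho>\<^sub>0 A a = \<rho>\<^sub>0"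
  using assms evolve_0[OF _ Pc_borel_probs[OF assms(2)], of "A a"] by (cases \<Delta>) auto

lemma S0_continuous:
  assumes "sorted_wrt (<) (a # \<Delta>)" "\<rho>\<^sub>0 \<in> Pc c" "\<And>x. x \<in> set (butlast (a # \<Delta>)) \<Longrightarrow> A x \<in> Gc0 c"
  shows "W_continuous_on {a..} (S0 (a # \<Delta>) \<rho>\<^sub>0 A)"
  using assms
proof (induction \<Delta> arbitrary: a \<rho>\<^sub>0)
  case Nil
  then show ?case by (auto simp: W_continuous_on_def W_self intro: exI[of _ 1])
next
  case (Cons b' \<Delta>)
  have A: "A a \<in> Gc0 c" using Cons.prems by auto
  have cont: "W_continuous_on {a..} (\<lambda>t. evolve (A a) (t - a) \<rho>\<^sub>0)"
    by (rule W_continuous_on_shift[OF evolve_Pc[OF A Cons.prems(2)]])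
  have ab: "a < b'" using Cons.prems by simp
  let ?\<rho> = "evolve (A a) (b' - a) \<rho>\<^sub>0"
  have \<rho>: "?\<rho> \<in> Pc c" using W_continuous_onD(1)[OF cont, of b'] ab by simp
  have prems: "sorted_wrt (<) (b' # \<Delta>)" "\<And>x. x \<in> set (butlast (b' # \<Delta>)) \<Longrightarrow> A x \<in> Gc0 c"
    using Cons.prems by auto
  have "W_continuous_on {a..} (\<lambda>t. if t \<le> b' then evolve (A a) (t - a) \<rho>\<^sub>0 else S0 (b' # \<Delta>) ?\<rho> A t)"
    using ab S0_start[OF prems(1) \<rho> prems(2)]
    by (intro W_continuous_on_concat cont Cons.IH[OF prems(1) \<rho> prems(2)]) auto
  then show ?case by simp
qed

text \<open>At a partition point the generator is that of the interval to its right. The condition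
  on q says that p and t have the same next partition point, which later removes the partition index
  from all estimates.\<close>

lemma S0_local_evolution:
  assumes "sorted_wrt (<) (a # \<Delta>)" "\<rho>\<^sub>0 \<in> Pc c" "\<And>x. x \<in> set (butlast (a # \<Delta>)) \<Longrightarrow> A x \<in> Gc0 c"
    and "a \<le> t" "t < last (a # \<Delta>)"
  shows "\<exists>p\<in>set (butlast (a # \<Delta>)). p \<le> t \<and> (\<forall>q\<in>set (a # \<Delta>). p < q \<longrightarrow> t < q) \<and>
    (\<exists>d>0. \<forall>h. 0 \<le> h \<longrightarrow> h < d \<longrightarrow> S0 (a # \<Delta>) \<rho>\<^sub>0 A (t + h) = evolve (A p) h (S0 (a # \<Delta>) \<rho>\<^sub>0 A t))"
  using assms
proof (induction \<Delta> arbitrary: a \<rho>\<^sub>0)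
  case (Cons b' \<Delta>)
  have A: "A a \<in> Gc0 c" using Cons.prems by auto
  have ab: "a < b'" using Cons.prems by simp
  let ?\<rho> = "evolve (A a) (b' - a) \<rho>\<^sub>0"
  have \<rho>: "?\<rho> \<in> Pc c" using W_continuous_onD(1)[OF evolve_Pc[OF A Cons.prems(2)], of "b' - a"] ab by simp
  have prems: "sorted_wrt (<) (b' # \<Delta>)" "\<And>x. x \<in> set (butlast (b' # \<Delta>)) \<Longrightarrow> A x \<in> Gc0 c"
    using Cons.prems by auto
  show ?case
  proof (cases "t < b'")
    case True
    have "S0 (a # b' # \<Delta>) \<rho>\<^sub>0 A (t + h) = evolve (A a) h (S0 (a # b' # \<Delta>) \<rho>\<^sub>0 A t)"
      if "0 \<le> h" "h < b' - t" for h
      using that True evolve_add[OF A Pc_borel_probs[OF Cons.prems(2)], of "t - a" h] Cons.prems(4)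
      by (simp add: algebra_simps)
    moreover have "\<forall>q\<in>set (a # b' # \<Delta>). a < q \<longrightarrow> t < q"
      using True Cons.prems(1) by auto
    ultimately show ?thesis
      using True Cons.prems(4) by (intro bexI[of _ a] conjI exI[of _ "b' - t"]) auto
  next
    case False
    have rest: "S0 (a # b' # \<Delta>) \<rho>\<^sub>0 A s = S0 (b' # \<Delta>) ?\<rho> A s" if "b' \<le> s" for s
      using that S0_start[OF prems(1) \<rho> prems(2)] by (cases "s = b'") auto
    have "t < last (b' # \<Delta>)" using Cons.prems(5) by simp
    then obtain p d where p: "p \<in> set (butlast (b' # \<Delta>))" "p \<le> t" "\<forall>q\<in>set (b' # \<Delta>). p < q \<longrightarrow> t < q"
      and d: "d > 0" "\<forall>h. 0 \<le> h \<longrightarrow> h < d \<longrightarrow> S0 (b' # \<Delta>) ?\<rho> A (t + h) = evolve (A p) h (S0 (b' # \<Delta>) ?\<rho> A t)"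
      using Cons.IH[OF prems(1) \<rho> prems(2)] False by (meson not_less)
    have "p \<in> set (b' # \<Delta>)" using p(1) by (rule in_set_butlastD)
    then have "\<not> p < a" using Cons.prems(1) by auto
    then have "\<forall>q\<in>set (a # b' # \<Delta>). p < q \<longrightarrow> t < q" using p(3) by auto
    moreover have "p \<in> set (butlast (a # b' # \<Delta>))" using p(1) by simp
    moreover have "\<forall>h. 0 \<le> h \<longrightarrow> h < d \<longrightarrow> S0 (a # b' # \<Delta>) \<rho>\<^sub>0 A (t + h) = evolve (A p) h (S0 (a # b' # \<Delta>) \<rho>\<^sub>0 A t)"
      using d(2) False rest by (simp del: S0.simps)
    ultimately show ?thesis using p(2) d(1) by blast
  qed
qed simp

lemma S0_pc_approx:
  assumes "is_partition T \<Delta>" "\<rho>\<^sub>0 \<in> Pc c" "\<And>t. t \<in> {0..T} \<Longrightarrow> A t \<in> Gc0 c"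
  defines "R \<equiv> S0 \<Delta> \<rho>\<^sub>0 (pc_approx \<Delta> A)"
  shows "R 0 = \<rho>\<^sub>0" "W_continuous_on {0..} R"
    "\<And>t. 0 \<le> t \<Longrightarrow> t < T \<Longrightarrow> \<exists>d>0. \<forall>h. 0 \<le> h \<longrightarrow> h < d \<longrightarrow> R (t + h) = evolve (A (next_point \<Delta> t)) h (R t)"
proof -
  obtain \<Delta>' where \<Delta>': "\<Delta> = 0 # \<Delta>'" using assms(1) by (cases \<Delta>) (auto simp: is_partition_def)
  have sorted: "sorted_wrt (<) (0 # \<Delta>')" and last: "last (0 # \<Delta>') = T"
    using assms(1) unfolding is_partition_def \<Delta>' by auto
  have G: "pc_approx \<Delta> A x \<in> Gc0 c" if x: "x \<in> set (butlast (0 # \<Delta>'))" for x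
  proof -
    have "x \<in> set \<Delta>" unfolding \<Delta>' using x by (rule in_set_butlastD)
    then have "0 \<le> x" using sorted unfolding \<Delta>' by auto
    have "\<Delta> = butlast \<Delta> @ [T]" using last unfolding \<Delta>' by (metis append_butlast_last_id list.distinct(1))
    moreover have "sorted_wrt (<) \<Delta>" using sorted \<Delta>' by simp
    ultimately have "x < T" using x unfolding \<Delta>'[symmetric]
      by (metis list.set_intros(1) sorted_wrt_append)
    then show ?thesis
      using next_point[OF assms(1) \<open>0 \<le> x\<close>] \<open>0 \<le> x\<close> unfolding pc_approx_next_point by (intro assms(3)) auto
  qed
  show "R 0 = \<rho>\<^sub>0" unfolding R_def using S0_start[where A="pc_approx \<Delta> A", OF sorted assms(2) G] by (simp add: \<Delta>')
  show "W_continuous_on {0..} R" unfolding R_def using S0_continuous[where A="pc_approx \<Delta> A", OF sorted assms(2) G] by (simp add: \<Delta>')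
  fix t assume t: "0 \<le> t" "t < T"
  obtain p d where p: "p \<in> set (butlast \<Delta>)" "p \<le> t" "\<forall>q\<in>set \<Delta>. p < q \<longrightarrow> t < q"
    and d: "d > 0" "\<forall>h. 0 \<le> h \<longrightarrow> h < d \<longrightarrow> R (t + h) = evolve (pc_approx \<Delta> A p) h (R t)"
    using S0_local_evolution[where A="pc_approx \<Delta> A", OF sorted assms(2) G t(1)] t(2)
    unfolding last R_def \<Delta>' by blast
  have "{u \<in> set \<Delta>. p < u} = {u \<in> set \<Delta>. t < u}" using p by auto
  then have "next_point \<Delta> p = next_point \<Delta> t" by (simp add: next_point_def)
  then show "\<exists>d>0. \<forall>h. 0 \<le> h \<longrightarrow> h < d \<longrightarrow> R (t + h) = evolve (A (next_point \<Delta> t)) h (R t)"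
    using d unfolding pc_approx_next_point by auto
qed

section \<open>The mean-field problem\<close>

lemma SUP_transport_cost_tendsto_0_iff:
  assumes "\<And>t. t \<in> I \<Longrightarrow> f t \<in> Pc c" "\<And>n t. t \<in> I \<Longrightarrow> g n t \<in> Pc c"
  shows "(\<lambda>n. SUP t\<in>I. transport_cost c (f t) (g n t)) \<longlonglongrightarrow> 0 \<longleftrightarrow>
    (\<forall>e>0. \<exists>N::nat. \<forall>n\<ge>N. \<forall>t\<in>I. W (f t) (g n t) \<le> e)"
proof (intro iffI allI impI)
  fix e :: real assume "e > 0"
  assume "(\<lambda>n. SUP t\<in>I. transport_cost c (f t) (g n t)) \<longlonglongrightarrow> 0"
  then have "eventually (\<lambda>n. (SUP t\<in>I. transport_cost c (f t) (g n t)) < ennreal e) sequentially"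
    using \<open>e > 0\<close> by (intro order_tendstoD) auto
  then obtain N where N: "\<And>n. n \<ge> N \<Longrightarrow> (SUP t\<in>I. transport_cost c (f t) (g n t)) < ennreal e"
    by (auto simp: eventually_sequentially)
  have "W (f t) (g n t) \<le> e" if "n \<ge> N" "t \<in> I" for n t
  proof (rule W_le)
    have "transport_cost c (f t) (g n t) \<le> (SUP t\<in>I. transport_cost c (f t) (g n t))"
      using that by (intro SUP_upper)
    then show "transport_cost c (f t) (g n t) \<le> ennreal e" using N[OF that(1)] by simp
  qed (use \<open>e > 0\<close> in simp)
  then show "\<exists>N. \<forall>n\<ge>N. \<forall>t\<in>I. W (f t) (g n t) \<le> e" by blast
next
  assume R: "\<forall>e>0. \<exists>N. \<forall>n\<ge>N. \<forall>t\<in>I. W (f t) (g n t) \<le> e"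
  show "(\<lambda>n. SUP t\<in>I. transport_cost c (f t) (g n t)) \<longlonglongrightarrow> 0"
  proof (rule order_tendstoI)
    fix a :: ennreal assume "0 < a"
    then obtain x where x: "0 < x" "x < a" using dense by blast
    then obtain e where e: "x = ennreal e" "e > 0" by (cases x) auto
    obtain N where N: "\<forall>n\<ge>N. \<forall>t\<in>I. W (f t) (g n t) \<le> e" using R e(2) by blast
    have "(SUP t\<in>I. transport_cost c (f t) (g n t)) < a" if "n \<ge> N" for n
    proof -
      have "(SUP t\<in>I. transport_cost c (f t) (g n t)) \<le> ennreal e"
        using N that assms by (intro SUP_least) (auto simp: transport_cost_eq_W ennreal_leI)
      then show ?thesis using x e by simp
    qed
    then show "eventually (\<lambda>n. (SUP t\<in>I. transport_cost c (f t) (g n t)) < a) sequentially"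
      by (auto simp: eventually_sequentially)
  qed simp
qed

text \<open>Fineness is measured by the change of \<open>m\<close> up to the next sample rather than
  by the mesh, so the tolerance does not mention the modulus of continuity of \<open>m\<close>. The
  choice makes it a function that the recursion for \<open>picard\<close> can call.\<close>

definition fine_partition :: "real \<Rightarrow> (real \<Rightarrow> 'a measure) \<Rightarrow> real \<Rightarrow> real list" where
  "fine_partition T m e = (SOME \<Delta>. is_partition T \<Delta> \<and>
     (\<forall>s. 0 \<le> s \<longrightarrow> s < T \<longrightarrow> W (m s) (m (next_point \<Delta> s)) \<le> e))"

lemma W_next_point:
  assumes "W_continuous_on {0..T} m" "e > 0"
  obtains d where "d > 0" "\<And>\<Delta> s. is_partition T \<Delta> \<Longrightarrow> mesh \<Delta> < d \<Longrightarrow> 0 \<le> s \<Longrightarrow> s < T \<Longrightarrow>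
    W (m s) (m (next_point \<Delta> s)) < e"
proof -
  obtain d where d: "d > 0" "\<And>s t. s \<in> {0..T} \<Longrightarrow> t \<in> {0..T} \<Longrightarrow> \<bar>s - t\<bar> < d \<Longrightarrow> W (m s) (m t) < e"
    using W_uniformly_continuous[OF assms] by blast
  show ?thesis
  proof (rule that[OF d(1)])
    fix \<Delta> s assume *: "is_partition T \<Delta>" "mesh \<Delta> < d" "0 \<le> s" "s < T"
    show "W (m s) (m (next_point \<Delta> s)) < e"
      using next_point[OF *(1,3,4)] * by (intro d(2)) auto
  qed
qed

lemma fine_partition:
  assumes "W_continuous_on {0..} m" "T > 0" "e > 0"
  shows "is_partition T (fine_partition T m e)"
    "\<And>s. 0 \<le> s \<Longrightarrow> s < T \<Longrightarrow> W (m s) (m (next_point (fine_partition T m e) s)) \<le> e"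
proof -
  have "W_continuous_on {0..T} m" using assms(1) by (rule W_continuous_on_subset) auto
  from W_next_point[OF this assms(3)] obtain d where d: "d > 0"
    "\<And>\<Delta> s. is_partition T \<Delta> \<Longrightarrow> mesh \<Delta> < d \<Longrightarrow> 0 \<le> s \<Longrightarrow> s < T \<Longrightarrow> W (m s) (m (next_point \<Delta> s)) < e"
    by blast
  obtain \<Delta> where "is_partition T \<Delta>" "mesh \<Delta> < d" using partition_exists[OF assms(2) d(1)] .
  then have "\<exists>\<Delta>. is_partition T \<Delta> \<and> (\<forall>s. 0 \<le> s \<longrightarrow> s < T \<longrightarrow> W (m s) (m (next_point \<Delta> s)) \<le> e)"
    using d(2) by (intro exI[of _ \<Delta>]) (auto intro: less_imp_le)
  from someI_ex[OF this] show "is_partition T (fine_partition T m e)"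
    "\<And>s. 0 \<le> s \<Longrightarrow> s < T \<Longrightarrow> W (m s) (m (next_point (fine_partition T m e) s)) \<le> e"
    unfolding fine_partition_def by auto
qed

end

locale mean_field_generator = complete_semimetric_space c B
  for c :: "'a::topological_space \<Rightarrow> 'a \<Rightarrow> real" and B +
  fixes \<A> :: "'a measure \<Rightarrow> 'a operator" and \<alpha> \<beta> :: real
  assumes Gc0: "\<And>\<mu>. \<mu> \<in> Pc c \<Longrightarrow> \<A> \<mu> \<in> Gc0 c"
    and \<alpha>: "\<alpha> \<ge> 0" and \<beta>: "\<beta> \<ge> 0"
    and omega: "\<And>\<mu> \<nu> \<mu>' \<nu>'. \<mu> \<in> Pc c \<Longrightarrow> \<nu> \<in> Pc c \<Longrightarrow> \<mu>' \<in> Pc c \<Longrightarrow> \<nu>' \<in> Pc c \<Longrightarrow>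
      omega c \<mu> \<nu> (\<A> \<mu>') (\<A> \<nu>')
        \<le> ereal (\<alpha> * enn2real (transport_cost c \<mu>' \<nu>') + \<beta> * enn2real (transport_cost c \<mu> \<nu>))"

begin

text \<open>Unfolding the limsup in \<open>omega\<close> produces the hypothesis \<open>dini\<close>
  of \<open>dini_comparison\<close> at a single time.\<close>

lemma omega_dini:
  assumes "\<mu> \<in> Pc c" "\<nu> \<in> Pc c" "\<mu>' \<in> Pc c" "\<nu>' \<in> Pc c" "e > 0"
  shows "\<exists>d>0. \<forall>h. 0 < h \<longrightarrow> h < d \<longrightarrow>
    W (evolve (\<A> \<mu>') h \<mu>) (evolve (\<A> \<nu>') h \<nu>) \<le> W \<mu> \<nu> + h * (\<alpha> * W \<mu>' \<nu>' + \<beta> * W \<mu> \<nu> + e)"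
proof -
  let ?L = "\<alpha> * W \<mu>' \<nu>' + \<beta> * W \<mu> \<nu>"
  have "omega c \<mu> \<nu> (\<A> \<mu>') (\<A> \<nu>') \<le> ereal ?L"
    using omega[OF assms(1-4)] by (simp add: W_def)
  also have "\<dots> < ereal (?L + e)" using assms(5) by simp
  finally have "eventually (\<lambda>t. ereal (1 / t * (W (evolve (\<A> \<mu>') t \<mu>) (evolve (\<A> \<nu>') t \<nu>) - W \<mu> \<nu>)) < ereal (?L + e)) (at_right 0)"
    unfolding omega_def W_def by (rule Limsup_lessD)
  then obtain d where d: "d > 0"
    "\<And>h. 0 < h \<Longrightarrow> h < d \<Longrightarrow> 1 / h * (W (evolve (\<A> \<mu>') h \<mu>) (evolve (\<A> \<nu>') h \<nu>) - W \<mu> \<nu>) < ?L + e"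
    unfolding eventually_at_right_field by auto
  have "W (evolve (\<A> \<mu>') h \<mu>) (evolve (\<A> \<nu>') h \<nu>) \<le> W \<mu> \<nu> + h * (?L + e)" if "0 < h" "h < d" for h
    using d(2)[OF that] that(1) by (simp add: field_simps)
  then show ?thesis using d(1) by blast
qed

section \<open>Comparison of two schemes\<close>

abbreviation scheme :: "real list \<Rightarrow> 'a measure \<Rightarrow> (real \<Rightarrow> 'a measure) \<Rightarrow> real \<Rightarrow> 'a measure" where
  "scheme \<Delta> \<rho>\<^sub>0 m \<equiv> S0 \<Delta> \<rho>\<^sub>0 (pc_approx \<Delta> (\<lambda>s. \<A> (m s)))"

lemma scheme:
  assumes "is_partition T \<Delta>" "\<rho>\<^sub>0 \<in> Pc c" "m \<in> {0..T} \<rightarrow> Pc c"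
  shows "scheme \<Delta> \<rho>\<^sub>0 m 0 = \<rho>\<^sub>0" "W_continuous_on {0..} (scheme \<Delta> \<rho>\<^sub>0 m)"
    "\<And>t. 0 \<le> t \<Longrightarrow> t < T \<Longrightarrow> \<exists>d>0. \<forall>h. 0 \<le> h \<longrightarrow> h < d \<longrightarrow>
       scheme \<Delta> \<rho>\<^sub>0 m (t + h) = evolve (\<A> (m (next_point \<Delta> t))) h (scheme \<Delta> \<rho>\<^sub>0 m t)"
  using S0_pc_approx[OF assms(1,2), of "\<lambda>s. \<A> (m s)"] assms(3) Gc0 by (blast dest: funcset_mem)+

text \<open>The constant K = \<open>\<alpha> / (l - \<beta>) * M\<close> is the one for which u = K
  exp (l t) solves u' = \<alpha> M exp (l t) + \<beta> u. The growth of the distance at time s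
  involves only the two generators active at s, so the schemes may have different partitions and
  horizons.\<close>

lemma scheme_comparison:
  assumes "is_partition T1 \<Delta>" "is_partition T2 \<Delta>'" "T \<le> T1" "T \<le> T2" "\<rho>\<^sub>0 \<in> Pc c"
    and m: "m \<in> {0..T1} \<rightarrow> Pc c" and m': "m' \<in> {0..T2} \<rightarrow> Pc c"
    and "\<beta> < l" "0 \<le> M"
    and bound: "\<And>s. 0 \<le> s \<Longrightarrow> s < T \<Longrightarrow> W (m (next_point \<Delta> s)) (m' (next_point \<Delta>' s)) \<le> M * exp (l * s)"
    and "0 \<le> t" "t \<le> T"
  shows "W (scheme \<Delta> \<rho>\<^sub>0 m t) (scheme \<Delta>' \<rho>\<^sub>0 m' t) \<le> \<alpha> / (l - \<beta>) * M * exp (l * t)"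
proof -
  let ?R = "scheme \<Delta> \<rho>\<^sub>0 m" and ?R' = "scheme \<Delta>' \<rho>\<^sub>0 m'"
  note R = scheme[OF assms(1) assms(5) m] and R' = scheme[OF assms(2) assms(5) m']
  let ?K = "\<alpha> / (l - \<beta>) * M"
  have PR: "?R s \<in> Pc c" "?R' s \<in> Pc c" if "0 \<le> s" for s
    using W_continuous_onD(1)[OF R(2), of s] W_continuous_onD(1)[OF R'(2), of s] that by auto
  have "?K \<ge> 0" using \<alpha> assms(8,9) by simp
  \<comment> \<open>The surplus \<open>e\<close> makes the majorant satisfy the differential
    inequality strictly and is removed at the end.\<close>
  have est: "W (?R t) (?R' t) \<le> (?K + e) * exp (l * t)" if e: "e > 0" for e
  proof (rule dini_comparison[where T=T and \<beta>=\<beta> and f="\<lambda>t. W (?R t) (?R' t)" and u="\<lambda>t. (?K + e) * exp (l * t)"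
        and v="\<lambda>t. l * ((?K + e) * exp (l * t))"
        and g="\<lambda>t. \<alpha> * W (m (next_point \<Delta> t)) (m' (next_point \<Delta>' t))"])
    fix s e' :: real assume s: "0 < s" "s \<le> T" and "0 < e'"
    obtain d where d: "d > 0" "\<forall>\<mu>'\<in>Pc c. \<forall>\<nu>'\<in>Pc c. W (?R s) \<mu>' < d \<longrightarrow> W (?R' s) \<nu>' < d \<longrightarrow> W (?R s) (?R' s) \<le> W \<mu>' \<nu>' + e'"
      using W_lower_semicontinuous[OF PR(1)[of s] PR(2)[of s] \<open>0 < e'\<close>] s by auto
    have s0: "s \<in> {0..}" using s by simp
    obtain d1 where d1: "d1 > 0" "\<forall>q\<in>{0..}. \<bar>q - s\<bar> < d1 \<longrightarrow> W (?R s) (?R q) < d"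
      using W_continuous_onD(2)[OF R(2) s0 d(1)] by blast
    obtain d2 where d2: "d2 > 0" "\<forall>q\<in>{0..}. \<bar>q - s\<bar> < d2 \<longrightarrow> W (?R' s) (?R' q) < d"
      using W_continuous_onD(2)[OF R'(2) s0 d(1)] by blast
    have "W (?R s) (?R' s) \<le> W (?R q) (?R' q) + e'" if "0 \<le> q" "s - min d1 d2 < q" "q < s" for q
      using d(2) d1(2) d2(2) PR that by auto
    then show "\<exists>d>0. \<forall>q. 0 \<le> q \<longrightarrow> s - d < q \<longrightarrow> q < s \<longrightarrow> W (?R s) (?R' s) \<le> W (?R q) (?R' q) + e'"
      using d1(1) d2(1) by (intro exI[of _ "min d1 d2"]) simp
  next
    fix s e' :: real assume s: "0 \<le> s" "s < T" and "0 < e'"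
    have sT: "s < T1" "s < T2" using s assms by auto
    let ?p = "next_point \<Delta> s" and ?p' = "next_point \<Delta>' s"
    have p: "m ?p \<in> Pc c" "m' ?p' \<in> Pc c"
      using next_point[OF assms(1) s(1) sT(1)] next_point[OF assms(2) s(1) sT(2)] s
      by (auto intro!: funcset_mem[OF m] funcset_mem[OF m'])
    obtain d where d: "d > 0" "\<forall>h. 0 < h \<longrightarrow> h < d \<longrightarrow>
        W (evolve (\<A> (m ?p)) h (?R s)) (evolve (\<A> (m' ?p')) h (?R' s))
          \<le> W (?R s) (?R' s) + h * (\<alpha> * W (m ?p) (m' ?p') + \<beta> * W (?R s) (?R' s) + e')"
      using omega_dini[OF PR(1)[OF s(1)] PR(2)[OF s(1)] p \<open>0 < e'\<close>] by blast
    obtain d1 where d1: "d1 > 0" "\<forall>h. 0 \<le> h \<longrightarrow> h < d1 \<longrightarrow> ?R (s + h) = evolve (\<A> (m ?p)) h (?R s)"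
      using R(3)[OF s(1) sT(1)] by auto
    obtain d2 where d2: "d2 > 0" "\<forall>h. 0 \<le> h \<longrightarrow> h < d2 \<longrightarrow> ?R' (s + h) = evolve (\<A> (m' ?p')) h (?R' s)"
      using R'(3)[OF s(1) sT(2)] by auto
    show "\<exists>d>0. \<forall>h. 0 < h \<longrightarrow> h < d \<longrightarrow> W (?R (s + h)) (?R' (s + h))
        \<le> W (?R s) (?R' s) + h * (\<alpha> * W (m ?p) (m' ?p') + \<beta> * W (?R s) (?R' s) + e')"
      using d d1 d2 by (intro exI[of _ "min d (min d1 d2)"]) auto
  next
    show "continuous_on UNIV (\<lambda>t. (?K + e) * exp (l * t))" by (intro continuous_intros)
  next
    fix s h :: real assume "0 \<le> s" "0 \<le> h"
    have "1 + l * h \<le> exp (l * h)" by (rule exp_ge_add_one_self)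
    then have le: "(?K + e) * exp (l * s) * (1 + l * h) \<le> (?K + e) * exp (l * s) * exp (l * h)"
      using \<open>?K \<ge> 0\<close> e by (intro mult_left_mono) auto
    have eq1: "x + h * (l * x) = x * (1 + l * h)" for x by (simp add: algebra_simps)
    have eq2: "(?K + e) * exp (l * (s + h)) = (?K + e) * exp (l * s) * exp (l * h)"
      by (simp only: distrib_left exp_add mult.assoc)
    show "(?K + e) * exp (l * s) + h * (l * ((?K + e) * exp (l * s))) \<le> (?K + e) * exp (l * (s + h))"
      unfolding eq1 eq2 by (rule le)
  next
    fix s :: real assume s: "0 \<le> s" "s < T"
    have "\<alpha> * W (m (next_point \<Delta> s)) (m' (next_point \<Delta>' s)) \<le> \<alpha> * (M * exp (l * s))"
      using bound[OF s] \<alpha> by (intro mult_left_mono) auto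
    also have "\<dots> = (l - \<beta>) * (?K * exp (l * s))" using assms(8) by simp
    also have "\<dots> < (l - \<beta>) * ((?K + e) * exp (l * s))"
      using assms(8) e by (intro mult_strict_left_mono mult_strict_right_mono) auto
    finally show "\<alpha> * W (m (next_point \<Delta> s)) (m' (next_point \<Delta>' s)) + \<beta> * ((?K + e) * exp (l * s)) < l * ((?K + e) * exp (l * s))"
      by (simp add: left_diff_distrib)
  next
    show "W (?R 0) (?R' 0) \<le> (?K + e) * exp (l * 0)"
      using R(1) R'(1) W_self[OF assms(5)] \<open>?K \<ge> 0\<close> e by simp
  qed (use \<beta> assms in auto)
  show ?thesis
  proof (rule field_le_epsilon)
    fix e :: real assume "e > 0"
    \<comment> \<open>Rescaled so that the surplus at time t is exactly the given
      \<open>e\<close>.\<close>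
    then have "e * exp (- (l * t)) > 0" by simp
    from est[OF this] show "W (?R t) (?R' t) \<le> ?K * exp (l * t) + e"
      by (simp add: distrib_right mult.assoc exp_add[symmetric])
  qed
qed

text \<open>Since \<open>B \<le> b\<close>, this meets the condition
  \<open>B * \<theta> \<le> 1 / 2\<close> of \<open>W_complete\<close>.\<close>

definition \<theta> :: real where "\<theta> = 1 / (2 * b)"

text \<open>The term with \<open>b^2\<close> absorbs the factor of \<open>W_triangle3\<close>; the
  summand 1 keeps \<open>\<omega>\<close> above \<open>\<beta>\<close> also for
  \<open>\<alpha> = 0\<close>.\<close>

definition \<omega> :: real where "\<omega> = \<beta> + 2 * \<alpha> * b\<^sup>2 / \<theta> + 1"

text \<open>
  Weighting curves by \<open>exp (\<omega> t)\<close> makes one Picard step contract by the factor \<open>\<theta> / 2\<close>, which is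
  small enough to beat the constant in the relaxed triangle inequality.
\<close>

lemma \<theta>: "0 < \<theta>" "\<theta> \<le> 1 / 2" "B * \<theta> \<le> 1 / 2"
proof -
  have B: "B \<ge> 1" by (rule B_ge_1)
  then have "B \<le> B ^ 3" using power_increasing[of 1 3 B] by simp
  then show "0 < \<theta>" "\<theta> \<le> 1 / 2" "B * \<theta> \<le> 1 / 2"
    using B b_ge_1 by (auto simp: \<theta>_def b_def field_simps)
qed

lemma \<omega>: "\<beta> < \<omega>" "0 \<le> \<omega>" "\<alpha> / (\<omega> - \<beta>) * b\<^sup>2 \<le> \<theta> / 2"
proof -
  have "2 * \<alpha> * b\<^sup>2 / \<theta> \<ge> 0" using \<alpha> \<theta> by simp
  then show "\<beta> < \<omega>" "0 \<le> \<omega>" using \<beta> by (auto simp: \<omega>_def)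
  have "\<alpha> * b\<^sup>2 * 2 \<le> \<theta> * (\<omega> - \<beta>)"
    using \<theta>(1) by (simp add: \<omega>_def distrib_left)
  then show "\<alpha> / (\<omega> - \<beta>) * b\<^sup>2 \<le> \<theta> / 2" using \<open>\<beta> < \<omega>\<close> by (simp add: field_simps)
qed

text \<open>The factor \<open>b^2\<close> in the hypothesis anticipates that the samples at the next
  points are compared through \<open>W_triangle3\<close>. The half in the rate
  \<open>\<theta> / 2\<close> leaves room for sampling errors.\<close>

lemma contraction:
  assumes "is_partition T1 \<Delta>" "is_partition T2 \<Delta>'" "T \<le> T1" "T \<le> T2" "\<rho>\<^sub>0 \<in> Pc c"
    and "m \<in> {0..T1} \<rightarrow> Pc c" "m' \<in> {0..T2} \<rightarrow> Pc c" "0 \<le> M"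
    and "\<And>s. 0 \<le> s \<Longrightarrow> s < T \<Longrightarrow> W (m (next_point \<Delta> s)) (m' (next_point \<Delta>' s)) \<le> b\<^sup>2 * M * exp (\<omega> * s)"
    and "0 \<le> t" "t \<le> T"
  shows "W (scheme \<Delta> \<rho>\<^sub>0 m t) (scheme \<Delta>' \<rho>\<^sub>0 m' t) \<le> \<theta> / 2 * M * exp (\<omega> * t)"
proof -
  have "W (scheme \<Delta> \<rho>\<^sub>0 m t) (scheme \<Delta>' \<rho>\<^sub>0 m' t) \<le> \<alpha> / (\<omega> - \<beta>) * (b\<^sup>2 * M) * exp (\<omega> * t)"
    by (rule scheme_comparison[OF assms(1-7) \<omega>(1) _ assms(9-11)]) (use assms(8) b_ge_1 in auto)
  also have "\<dots> = (\<alpha> / (\<omega> - \<beta>) * b\<^sup>2) * M * exp (\<omega> * t)" by simp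
  also have "\<dots> \<le> \<theta> / 2 * M * exp (\<omega> * t)"
    using \<omega>(3) assms(8) by (intro mult_right_mono) auto
  finally show ?thesis .
qed

section \<open>Picard iteration\<close>

text \<open>Iterate j + 1 evolves up to time j + 1 and stays constant afterwards, so it is a curve
  on all of \<open>[0, \<infinity>)\<close>. Its sampling tolerance \<open>\<theta>^j\<close> decays
  at the rate at which consecutive iterates approach each other.\<close>

primrec picard :: "'a measure \<Rightarrow> nat \<Rightarrow> real \<Rightarrow> 'a measure" where
  "picard \<rho>\<^sub>0 0 = (\<lambda>_. \<rho>\<^sub>0)"
| "picard \<rho>\<^sub>0 (Suc j) = scheme (fine_partition (real (Suc j)) (picard \<rho>\<^sub>0 j) (\<theta> ^ j)) \<rho>\<^sub>0 (picard \<rho>\<^sub>0 j)"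

context
  fixes \<rho>\<^sub>0 :: "'a measure"
  assumes \<rho>\<^sub>0: "\<rho>\<^sub>0 \<in> Pc c"

begin

abbreviation m :: "nat \<Rightarrow> real \<Rightarrow> 'a measure" where "m \<equiv> picard \<rho>\<^sub>0"

abbreviation \<Delta> :: "nat \<Rightarrow> real list" where "\<Delta> j \<equiv> fine_partition (real (Suc j)) (m j) (\<theta> ^ j)"

lemma picard_curve: "m j 0 = \<rho>\<^sub>0 \<and> W_continuous_on {0..} (m j)"
proof (induction j)
  case 0
  then show ?case using \<rho>\<^sub>0 by (auto simp: W_continuous_on_def W_self intro: exI[of _ 1])
next
  case (Suc j)
  have "is_partition (real (Suc j)) (\<Delta> j)" using Suc \<theta>(1) by (intro fine_partition) auto
  then show ?case
    using scheme(1,2)[of "real (Suc j)" "\<Delta> j" \<rho>\<^sub>0 "m j"] \<rho>\<^sub>0 W_continuous_onD(1)[of "{0..}" "m j"] Suc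
    by auto
qed

lemma picard_Pc: "0 \<le> t \<Longrightarrow> m j t \<in> Pc c"
  using W_continuous_onD(1)[of "{0..}" "m j"] picard_curve[of j] by simp

lemma picard_partition:
  "is_partition (real (Suc j)) (\<Delta> j)"
  "0 \<le> s \<Longrightarrow> s < real (Suc j) \<Longrightarrow> W (m j s) (m j (next_point (\<Delta> j) s)) \<le> \<theta> ^ j"
  using fine_partition[of "m j" "real (Suc j)" "\<theta> ^ j"] picard_curve[of j] \<theta>(1) by auto

text \<open>Each of the two samples differs from the value at s by at most
  \<open>\<theta>^j\<close>. Because of \<open>2 \<le> C\<close> both errors together cost no more
  than the assumed bound itself; the sum is bounded through \<open>2 * C * \<theta>^j\<close>, and
  the contraction by \<open>\<theta> / 2\<close> restores the form of the estimate.\<close>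

lemma picard_step:
  assumes "T \<le> real (Suc j)" "2 \<le> C"
    and "\<And>s. 0 \<le> s \<Longrightarrow> s \<le> T \<Longrightarrow> W (m (Suc j) s) (m j s) \<le> C * \<theta> ^ j * exp (\<omega> * s)"
    and "0 \<le> t" "t \<le> T"
  shows "W (m (Suc (Suc j)) t) (m (Suc j) t) \<le> C * \<theta> ^ Suc j * exp (\<omega> * t)"
proof -
  have "W (scheme (\<Delta> (Suc j)) \<rho>\<^sub>0 (m (Suc j)) t) (scheme (\<Delta> j) \<rho>\<^sub>0 (m j) t) \<le> \<theta> / 2 * (2 * C * \<theta> ^ j) * exp (\<omega> * t)"
  proof (rule contraction[OF picard_partition(1) picard_partition(1) _ assms(1) \<rho>\<^sub>0])
    fix s assume s: "0 \<le> s" "s < T"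
    let ?p = "next_point (\<Delta> (Suc j)) s" and ?q = "next_point (\<Delta> j) s"
    have s': "s < real (Suc j)" "s < real (Suc (Suc j))" using s assms(1) by auto
    have pq: "0 \<le> ?p" "0 \<le> ?q"
      using next_point(1)[OF picard_partition(1) s(1) s'(1)] next_point(1)[OF picard_partition(1) s(1) s'(2)] s by auto
    have "W (m (Suc j) ?p) (m j ?q) \<le> b\<^sup>2 * (W (m (Suc j) ?p) (m (Suc j) s) + W (m (Suc j) s) (m j s) + W (m j s) (m j ?q))"
      using s pq by (intro W_triangle3 picard_Pc) auto
    also have "\<dots> \<le> b\<^sup>2 * (\<theta> ^ j + C * \<theta> ^ j * exp (\<omega> * s) + \<theta> ^ j)"
    proof (intro mult_left_mono add_mono)
      have "W (m (Suc j) ?p) (m (Suc j) s) \<le> \<theta> ^ Suc j"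
        using picard_partition(2)[OF s(1) s'(2)] by (simp add: W_commute del: picard.simps)
      also have "\<dots> \<le> \<theta> ^ j" using \<theta> by (intro power_decreasing) auto
      finally show "W (m (Suc j) ?p) (m (Suc j) s) \<le> \<theta> ^ j" .
      show "W (m (Suc j) s) (m j s) \<le> C * \<theta> ^ j * exp (\<omega> * s)" using s by (intro assms(3)) auto
      show "W (m j s) (m j ?q) \<le> \<theta> ^ j" by (rule picard_partition(2)[OF s(1) s'(1)])
    qed simp
    also have "\<dots> \<le> b\<^sup>2 * (2 * C * \<theta> ^ j * exp (\<omega> * s))"
    proof (rule mult_left_mono)
      have "1 \<le> exp (\<omega> * s)" using \<omega>(2) s by simp
      then have "2 * \<theta> ^ j \<le> C * \<theta> ^ j * exp (\<omega> * s)"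
        using assms(2) \<theta>(1) mult_mono[of "2 * \<theta> ^ j" "C * \<theta> ^ j" 1 "exp (\<omega> * s)"] by simp
      then show "\<theta> ^ j + C * \<theta> ^ j * exp (\<omega> * s) + \<theta> ^ j \<le> 2 * C * \<theta> ^ j * exp (\<omega> * s)" by simp
    qed simp
    finally show "W (m (Suc j) ?p) (m j ?q) \<le> b\<^sup>2 * (2 * C * \<theta> ^ j) * exp (\<omega> * s)"
      by (simp only: mult.assoc)
  qed (use assms \<theta>(1) picard_Pc in \<open>auto simp del: picard.simps\<close>)
  moreover have "\<theta> / 2 * (2 * C * \<theta> ^ j) = C * \<theta> ^ Suc j" by simp
  ultimately show ?thesis by (simp only: picard.simps)
qed

text \<open>The step estimate is used on \<open>[0, T]\<close> only from a stage J on whose horizon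
  has reached T. About the difference at stage J nothing more than boundedness is known.\<close>

lemma picard_geometric:
  assumes "0 < T"
  obtains C J where "0 \<le> C" "\<And>n t. 0 \<le> t \<Longrightarrow> t \<le> T \<Longrightarrow> W (m (J + n) t) (m (Suc (J + n)) t) \<le> C * \<theta> ^ n"
proof -
  obtain J :: nat where J: "T \<le> real J" using real_arch_simple by blast
  have "W_continuous_on {0..T} (m j)" for j
    using picard_curve[of j] by (auto elim: W_continuous_on_subset)
  from W_bounded_curves[OF this this, of "Suc J" J]
  obtain C0 where C0: "\<And>s. s \<in> {0..T} \<Longrightarrow> W (m (Suc J) s) (m J s) \<le> C0"
    by blast
  \<comment> \<open>Both demands on \<open>C\<close> are met: \<open>picard_step\<close> needs at
    least 2, and the start of the induction needs \<open>C0 \<le> C * \<theta>^J\<close>.\<close>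
  define C where "C = max 2 (C0 / \<theta> ^ J)"
  have C: "2 \<le> C" "C0 \<le> C * \<theta> ^ J" using \<theta>(1) by (auto simp: C_def field_simps max_def)
  have step: "W (m (Suc (J + n)) t) (m (J + n) t) \<le> C * \<theta> ^ (J + n) * exp (\<omega> * t)" if "0 \<le> t" "t \<le> T" for n t
    using that
  proof (induction n arbitrary: t)
    case 0
    have "W (m (Suc J) t) (m J t) \<le> C * \<theta> ^ J * 1" using C0[of t] C 0 by auto
    also have "\<dots> \<le> C * \<theta> ^ J * exp (\<omega> * t)"
      using C(1) \<theta>(1) \<omega>(2) 0 by (intro mult_left_mono) auto
    finally show ?case by (simp del: picard.simps)
  next
    case (Suc n)
    show ?case
      using picard_step[of T "J + n" C t] J C(1) Suc by (simp del: picard.simps)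
  qed
  show ?thesis
  proof (rule that[of "C * \<theta> ^ J * exp (\<omega> * T)" J])
    show "0 \<le> C * \<theta> ^ J * exp (\<omega> * T)" using C(1) \<theta>(1) by simp
    fix n t assume t: "0 \<le> t" "t \<le> T"
    have "W (m (J + n) t) (m (Suc (J + n)) t) \<le> C * \<theta> ^ (J + n) * exp (\<omega> * t)"
      using step[OF t] by (simp add: W_commute del: picard.simps)
    also have "\<dots> \<le> C * \<theta> ^ (J + n) * exp (\<omega> * T)"
      using C(1) \<theta>(1) \<omega>(2) t by (intro mult_left_mono) (auto intro: mult_left_mono)
    finally show "W (m (J + n) t) (m (Suc (J + n)) t) \<le> C * \<theta> ^ J * exp (\<omega> * T) * \<theta> ^ n"
      by (simp add: power_add ac_simps del: picard.simps)
  qed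
qed

section \<open>Limit of the iterates\<close>

text \<open>Chosen at each time without reference to a horizon; only the rates of convergence will
  depend on T.\<close>

definition picard_limit :: "real \<Rightarrow> 'a measure" where
  "picard_limit t = (SOME \<nu>. \<nu> \<in> Pc c \<and> (\<lambda>j. W (m j t) \<nu>) \<longlonglongrightarrow> 0)"

lemma W_limit_unique:
  assumes "\<mu> \<in> Pc c" "\<nu> \<in> Pc c" "\<And>n. x n \<in> Pc c" "(\<lambda>n. W (x n) \<mu>) \<longlonglongrightarrow> 0" "(\<lambda>n. W (x n) \<nu>) \<longlonglongrightarrow> 0"
  shows "\<mu> = \<nu>"
proof -
  have "(\<lambda>n. b * (W (x n) \<mu> + W (x n) \<nu>)) \<longlonglongrightarrow> b * (0 + 0)"
    by (intro tendsto_intros assms)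
  moreover have "W \<mu> \<nu> \<le> b * (W (x n) \<mu> + W (x n) \<nu>)" for n
    using W_triangle[folded b_def, OF assms(1,2,3)] by (simp add: W_commute[of \<mu> "x _"])
  ultimately have "W \<mu> \<nu> \<le> b * (0 + 0)" by (intro LIMSEQ_le_const) auto
  then have "W \<mu> \<nu> = 0" by (intro antisym) auto
  then show ?thesis by (rule W_eq_0_imp_eq[OF assms(1,2)])
qed

text \<open>\<open>W_complete\<close> is applied at each fixed t. Its rate depends on
  \<open>C\<close> and \<open>\<theta>\<close> only, so the pointwise limits are uniform on
  \<open>[0, T]\<close>.\<close>

lemma picard_limit_uniform:
  assumes "0 < T"
  obtains D J where "0 \<le> D" "\<And>n t. 0 \<le> t \<Longrightarrow> t \<le> T \<Longrightarrow> picard_limit t \<in> Pc c \<and> W (m (J + n) t) (picard_limit t) \<le> D * \<theta> ^ n"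
proof -
  obtain C J where C: "0 \<le> C" "\<And>n t. 0 \<le> t \<Longrightarrow> t \<le> T \<Longrightarrow> W (m (J + n) t) (m (Suc (J + n)) t) \<le> C * \<theta> ^ n"
    using picard_geometric[OF assms] by blast
  define D where "D = 2 * B * (B\<^sup>2 * C + 1)"
  have "0 \<le> D" using C(1) B_ge_1 by (simp add: D_def)
  have "picard_limit t \<in> Pc c \<and> W (m (J + n) t) (picard_limit t) \<le> D * \<theta> ^ n" if t: "0 \<le> t" "t \<le> T" for n t
  proof -
    have geo: "W (m (J + n) t) (m (J + Suc n) t) \<le> C * \<theta> ^ n" for n
      using C(2)[OF t] by (simp del: picard.simps)
    obtain \<nu> where \<nu>: "\<nu> \<in> Pc c" "\<And>n. W (m (J + n) t) \<nu> \<le> D * \<theta> ^ n"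
      using W_complete[of "\<lambda>n. m (J + n) t", OF picard_Pc[OF t(1)] geo \<theta>(1,3) C(1)] unfolding D_def by blast
    have "(\<lambda>n. D * \<theta> ^ n) \<longlonglongrightarrow> D * 0"
      using \<theta> by (intro tendsto_intros LIMSEQ_realpow_zero) auto
    then have "(\<lambda>n. D * \<theta> ^ n) \<longlonglongrightarrow> 0" by simp
    from tendsto_sandwich[OF _ _ tendsto_const this] have "(\<lambda>n. W (m (n + J) t) \<nu>) \<longlonglongrightarrow> 0"
      using \<nu>(2) by (simp add: add.commute[of _ J] del: picard.simps)
    then have lim: "(\<lambda>n. W (m n t) \<nu>) \<longlonglongrightarrow> 0" by (rule LIMSEQ_offset)
    then have "picard_limit t \<in> Pc c \<and> (\<lambda>j. W (m j t) (picard_limit t)) \<longlonglongrightarrow> 0"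
      unfolding picard_limit_def using \<nu>(1)
      by (intro someI[where P="\<lambda>\<nu>. \<nu> \<in> Pc c \<and> (\<lambda>j. W (m j t) \<nu>) \<longlonglongrightarrow> 0" and x=\<nu>] conjI)
    then have "picard_limit t = \<nu>"
      by (intro W_limit_unique[where x="\<lambda>n. m n t"] lim \<nu>(1) picard_Pc[OF t(1)]) blast+
    then show ?thesis using \<nu> by simp
  qed
  then show ?thesis using that \<open>0 \<le> D\<close> by blast
qed

lemma picard_limit_approx:
  assumes "0 < T" "0 < e"
  obtains J where "\<And>j t. J \<le> j \<Longrightarrow> 0 \<le> t \<Longrightarrow> t \<le> T \<Longrightarrow> W (m j t) (picard_limit t) < e"
proof -
  obtain D J where D: "0 \<le> D" "\<And>n t. 0 \<le> t \<Longrightarrow> t \<le> T \<Longrightarrow> W (m (J + n) t) (picard_limit t) \<le> D * \<theta> ^ n"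
    by (rule picard_limit_uniform[OF assms(1)]) blast
  have "(\<lambda>n. D * \<theta> ^ n) \<longlonglongrightarrow> D * 0"
    using \<theta> by (intro tendsto_intros LIMSEQ_realpow_zero) auto
  then have "eventually (\<lambda>n. D * \<theta> ^ n < e) sequentially"
    using assms(2) by (intro order_tendstoD) auto
  then obtain N where N: "\<And>n. N \<le> n \<Longrightarrow> D * \<theta> ^ n < e" by (auto simp: eventually_sequentially)
  show ?thesis
  proof (rule that[of "J + N"])
    fix j t assume j: "J + N \<le> j" and t: "0 \<le> t" "t \<le> T"
    have "W (m (J + (j - J)) t) (picard_limit t) \<le> D * \<theta> ^ (j - J)" by (rule D(2)[OF t])
    also have "\<dots> < e" using j by (intro N) auto
    finally show "W (m j t) (picard_limit t) < e" using j by simp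
  qed
qed

lemma picard_limit_Pc: "0 \<le> t \<Longrightarrow> picard_limit t \<in> Pc c"
proof -
  assume t: "0 \<le> t"
  then have "0 < t + 1" by simp
  then show ?thesis
  proof (rule picard_limit_uniform)
    fix D J
    assume "\<And>n s. 0 \<le> s \<Longrightarrow> s \<le> t + 1 \<Longrightarrow> picard_limit s \<in> Pc c \<and> W (m (J + n) s) (picard_limit s) \<le> D * \<theta> ^ n"
    from this[of t 0] t show ?thesis by simp
  qed
qed

lemma picard_limit_0: "picard_limit 0 = \<rho>\<^sub>0"
proof -
  have "W \<rho>\<^sub>0 (picard_limit 0) \<le> 0 + e" if e: "e > 0" for e
  proof -
    obtain J where "\<And>j t. J \<le> j \<Longrightarrow> 0 \<le> t \<Longrightarrow> t \<le> 1 \<Longrightarrow> W (m j t) (picard_limit t) < e"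
      using picard_limit_approx[OF zero_less_one e] by blast
    from this[of J 0] show ?thesis using picard_curve[of J] by simp
  qed
  then have "W \<rho>\<^sub>0 (picard_limit 0) \<le> 0" by (rule field_le_epsilon)
  then have "W \<rho>\<^sub>0 (picard_limit 0) = 0" by (intro antisym) auto
  then show ?thesis using W_eq_0_imp_eq[OF \<rho>\<^sub>0 picard_limit_Pc[OF order_refl]] by simp
qed

lemma picard_limit_continuous: "W_continuous_on {0..} picard_limit"
  unfolding W_continuous_on_def
proof (intro conjI ballI allI impI)
  fix t :: real assume t: "t \<in> {0..}"
  then show "picard_limit t \<in> Pc c" by (simp add: picard_limit_Pc)
  fix e :: real assume "e > 0"
  define a where "a = e / (4 * b\<^sup>2)"
  have "a > 0" using \<open>e > 0\<close> b_ge_1 by (simp add: a_def)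
  have T: "0 < t + 1" using t by auto
  obtain j where j: "\<And>s. 0 \<le> s \<Longrightarrow> s \<le> t + 1 \<Longrightarrow> W (m j s) (picard_limit s) < a"
  proof -
    obtain J where "\<And>j s. J \<le> j \<Longrightarrow> 0 \<le> s \<Longrightarrow> s \<le> t + 1 \<Longrightarrow> W (m j s) (picard_limit s) < a"
      using picard_limit_approx[OF T \<open>a > 0\<close>] by blast
    then show ?thesis by (intro that[of J]) auto
  qed
  obtain d where d: "d > 0" "\<forall>s\<in>{0..}. \<bar>s - t\<bar> < d \<longrightarrow> W (m j t) (m j s) < a"
    using W_continuous_onD(2)[of "{0..}" "m j", OF _ t \<open>a > 0\<close>] picard_curve by blast
  have "W (picard_limit t) (picard_limit s) < e" if s: "s \<in> {0..}" "\<bar>s - t\<bar> < min d 1" for s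
  proof -
    have "W (picard_limit t) (picard_limit s) \<le> b\<^sup>2 * (W (picard_limit t) (m j t) + W (m j t) (m j s) + W (m j s) (picard_limit s))"
      using s t by (intro W_triangle3 picard_limit_Pc picard_Pc) auto
    also have "\<dots> \<le> b\<^sup>2 * (a + a + a)"
    proof (intro mult_left_mono add_mono)
      show "W (picard_limit t) (m j t) \<le> a" using j[of t] t by (simp add: W_commute)
      show "W (m j t) (m j s) \<le> a" using d(2) s by (simp add: less_imp_le)
      show "W (m j s) (picard_limit s) \<le> a" using j[of s] s by (simp add: less_imp_le)
    qed simp
    also have "\<dots> < e" using \<open>e > 0\<close> b_ge_1 by (simp add: a_def)
    finally show ?thesis .
  qed
  then show "\<exists>d>0. \<forall>s\<in>{0..}. \<bar>s - t\<bar> < d \<longrightarrow> W (picard_limit t) (picard_limit s) < e"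
    using d(1) by (intro exI[of _ "min d 1"]) auto
qed

text \<open>The iterate \<open>m (Suc j)\<close> is itself a scheme, driven by \<open>m j\<close>.
  Hence \<open>contraction\<close> compares it with the scheme on \<open>\<Delta>'\<close> driven by
  the limit, while \<open>m j\<close> and \<open>m (Suc j)\<close> are both close to the
  limit.\<close>

lemma picard_limit_stable:
  assumes "T > 0" "e > 0"
  obtains d where "d > 0" "\<And>\<Delta>' t. is_partition T \<Delta>' \<Longrightarrow> mesh \<Delta>' < d \<Longrightarrow> t \<in> {0..T} \<Longrightarrow>
    W (picard_limit t) (scheme \<Delta>' \<rho>\<^sub>0 picard_limit t) \<le> e"
proof -
  define E where "E = exp (\<omega> * T)"
  \<comment> \<open>Solves \<open>b * (a + 3 * a * E) = e\<close>. The 3 counts the sampling error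
    of \<open>m j\<close>, that of the limit, and the distance between the two.\<close>
  define a where "a = e / (b * (1 + 3 * E))"
  have "E > 0" by (simp add: E_def)
  then have "b * (1 + 3 * E) > 0" using b_ge_1 by (intro mult_pos_pos) auto
  then have "a > 0" using assms by (simp add: a_def)
  have cont: "W_continuous_on {0..T} picard_limit"
    using picard_limit_continuous by (rule W_continuous_on_subset) auto
  obtain d where d: "d > 0" "\<And>\<Delta>' s. is_partition T \<Delta>' \<Longrightarrow> mesh \<Delta>' < d \<Longrightarrow> 0 \<le> s \<Longrightarrow> s < T \<Longrightarrow>
    W (picard_limit s) (picard_limit (next_point \<Delta>' s)) < a"
    using W_next_point[OF cont \<open>a > 0\<close>] by blast
  obtain J where J: "\<And>j t. J \<le> j \<Longrightarrow> 0 \<le> t \<Longrightarrow> t \<le> T \<Longrightarrow> W (m j t) (picard_limit t) < a"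
    using picard_limit_approx[OF assms(1) \<open>a > 0\<close>] by blast
  obtain J1 where J1: "\<theta> ^ J1 < a" using real_arch_pow_inv[OF \<open>a > 0\<close>, of \<theta>] \<theta> by auto
  obtain J2 :: nat where J2: "T \<le> real J2" using real_arch_simple by blast
  define j where "j = max J (max J1 J2)"
  have "\<theta> ^ j \<le> \<theta> ^ J1" using \<theta> by (intro power_decreasing) (auto simp: j_def)
  then have \<theta>j: "\<theta> ^ j \<le> a" using J1 by simp
  have Tj: "T \<le> real (Suc j)" using J2 by (simp add: j_def)
  have Jj: "J \<le> j" "J \<le> Suc j" by (auto simp: j_def)
  show ?thesis
  proof (rule that[OF d(1)])
    fix \<Delta>' t assume \<Delta>': "is_partition T \<Delta>'" "mesh \<Delta>' < d" and t: "t \<in> {0..T}"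
    have lim: "picard_limit \<in> {0..T} \<rightarrow> Pc c" by (auto intro: picard_limit_Pc)
    have "W (scheme (\<Delta> j) \<rho>\<^sub>0 (m j) t) (scheme \<Delta>' \<rho>\<^sub>0 picard_limit t) \<le> \<theta> / 2 * (3 * a) * exp (\<omega> * t)"
    proof (rule contraction[OF picard_partition(1) \<Delta>'(1) Tj order_refl \<rho>\<^sub>0 _ lim])
      fix s assume s: "0 \<le> s" "s < T"
      let ?p = "next_point (\<Delta> j) s" and ?q = "next_point \<Delta>' s"
      have s': "s < real (Suc j)" using s Tj by simp
      have pq: "0 \<le> ?p" "0 \<le> ?q"
        using next_point(1)[OF picard_partition(1) s(1) s'] next_point(1)[OF \<Delta>'(1) s] s by auto
      have "W (m j ?p) (picard_limit ?q) \<le> b\<^sup>2 * (W (m j ?p) (m j s) + W (m j s) (picard_limit s) + W (picard_limit s) (picard_limit ?q))"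
        using s pq by (intro W_triangle3 picard_Pc picard_limit_Pc) auto
      also have "\<dots> \<le> b\<^sup>2 * (a + a + a)"
      proof (intro mult_left_mono add_mono)
        show "W (m j ?p) (m j s) \<le> a"
          using picard_partition(2)[OF s(1) s'] \<theta>j by (simp add: W_commute)
        show "W (m j s) (picard_limit s) \<le> a" using J[OF Jj(1)] s by (simp add: less_imp_le)
        show "W (picard_limit s) (picard_limit ?q) \<le> a" using d(2)[OF \<Delta>' s] by simp
      qed simp
      also have "\<dots> = b\<^sup>2 * (3 * a) * 1" by simp
      also have "\<dots> \<le> b\<^sup>2 * (3 * a) * exp (\<omega> * s)"
        using \<open>a > 0\<close> \<omega>(2) s by (intro mult_left_mono) auto
      finally show "W (m j ?p) (picard_limit ?q) \<le> b\<^sup>2 * (3 * a) * exp (\<omega> * s)" .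
    qed (use \<open>a > 0\<close> t picard_Pc in auto)
    also have "\<dots> \<le> 1 * (3 * a) * E"
      unfolding E_def using \<theta> \<open>a > 0\<close> t \<omega>(2) by (intro mult_mono) (auto intro: mult_left_mono)
    finally have 1: "W (m (Suc j) t) (scheme \<Delta>' \<rho>\<^sub>0 picard_limit t) \<le> 3 * a * E" by simp
    have "scheme \<Delta>' \<rho>\<^sub>0 picard_limit t \<in> Pc c"
      using W_continuous_onD(1)[OF scheme(2)[OF \<Delta>'(1) \<rho>\<^sub>0 lim]] t by auto
    then have "W (picard_limit t) (scheme \<Delta>' \<rho>\<^sub>0 picard_limit t)
      \<le> b * (W (picard_limit t) (m (Suc j) t) + W (m (Suc j) t) (scheme \<Delta>' \<rho>\<^sub>0 picard_limit t))"
      using t by (intro W_triangle[folded b_def] picard_limit_Pc picard_Pc) auto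
    also have "\<dots> \<le> b * (a + 3 * a * E)"
    proof (intro mult_left_mono add_mono 1)
      show "W (picard_limit t) (m (Suc j) t) \<le> a"
        using J[OF Jj(2), of t] t by (simp add: W_commute less_imp_le del: picard.simps)
    qed (use b_ge_1 in simp)
    also have "\<dots> = a * (b * (1 + 3 * E))" by (simp add: algebra_simps)
    also have "\<dots> = e" using less_imp_neq[OF \<open>b * (1 + 3 * E) > 0\<close>] unfolding a_def by simp
    finally show "W (picard_limit t) (scheme \<Delta>' \<rho>\<^sub>0 picard_limit t) \<le> e" .
  qed
qed

section \<open>Existence and uniqueness\<close>

lemma stable_solution_iff:
  assumes "W_continuous_on {0..} \<rho>" "\<rho> 0 = \<rho>\<^sub>0"
  shows "stable_solution c T (\<lambda>t. \<A> (\<rho> t)) (\<rho> 0) \<rho> \<longleftrightarrow>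
    (\<forall>D::nat \<Rightarrow> real list. (\<forall>n. is_partition T (D n)) \<and> (\<lambda>n. mesh (D n)) \<longlonglongrightarrow> 0 \<longrightarrow>
      (\<forall>e>0. \<exists>N. \<forall>n\<ge>N. \<forall>t\<in>{0..T}. W (\<rho> t) (scheme (D n) \<rho>\<^sub>0 \<rho> t) \<le> e))"
proof -
  have T: "W_continuous_on {0..T} \<rho>" using assms(1) by (rule W_continuous_on_subset) auto
  then have Pc: "\<rho> \<in> {0..T} \<rightarrow> Pc c" by (auto dest: W_continuous_onD(1))
  have "(\<lambda>n. SUP t\<in>{0..T}. transport_cost c (\<rho> t) (scheme (D n) \<rho>\<^sub>0 \<rho> t)) \<longlonglongrightarrow> 0 \<longleftrightarrow>
      (\<forall>e>0. \<exists>N. \<forall>n\<ge>N. \<forall>t\<in>{0..T}. W (\<rho> t) (scheme (D n) \<rho>\<^sub>0 \<rho> t) \<le> e)"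
    if D: "\<forall>n. is_partition T (D n)" for D :: "nat \<Rightarrow> real list"
  proof (rule SUP_transport_cost_tendsto_0_iff)
    show "\<rho> t \<in> Pc c" if "t \<in> {0..T}" for t by (rule W_continuous_onD(1)[OF T that])
    show "scheme (D n) \<rho>\<^sub>0 \<rho> t \<in> Pc c" if "t \<in> {0..T}" for n t
      using W_continuous_onD(1)[OF scheme(2)[OF _ \<rho>\<^sub>0 Pc]] D that by auto
  qed
  then show ?thesis
    using T unfolding stable_solution_def Pc_curves_iff assms(2) by blast
qed

lemma picard_limit_solution: "mean_field_solution c \<A> picard_limit"
  unfolding mean_field_solution_def Pc_curves_iff
proof (intro conjI allI impI picard_limit_continuous)
  fix T :: real assume "T > 0"
  show "stable_solution c T (\<lambda>t. \<A> (picard_limit t)) (picard_limit 0) picard_limit"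
    unfolding stable_solution_iff[OF picard_limit_continuous picard_limit_0]
  proof (intro allI impI)
    fix D :: "nat \<Rightarrow> real list" and e :: real
    assume D: "(\<forall>n. is_partition T (D n)) \<and> (\<lambda>n. mesh (D n)) \<longlonglongrightarrow> 0" and "e > 0"
    obtain d where d: "d > 0" "\<And>\<Delta>' t. is_partition T \<Delta>' \<Longrightarrow> mesh \<Delta>' < d \<Longrightarrow> t \<in> {0..T} \<Longrightarrow>
      W (picard_limit t) (scheme \<Delta>' \<rho>\<^sub>0 picard_limit t) \<le> e"
      using picard_limit_stable[OF \<open>T > 0\<close> \<open>e > 0\<close>] by blast
    have "eventually (\<lambda>n. mesh (D n) < d) sequentially"
      using D d(1) by (intro order_tendstoD) auto
    then obtain N where "\<And>n. n \<ge> N \<Longrightarrow> mesh (D n) < d" by (auto simp: eventually_sequentially)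
    then show "\<exists>N. \<forall>n\<ge>N. \<forall>t\<in>{0..T}. W (picard_limit t) (scheme (D n) \<rho>\<^sub>0 picard_limit t) \<le> e"
      using d(2) D by blast
  qed
qed

text \<open>Stability is specialised to uniform partitions so that two solutions can be compared
  through schemes on a common partition.\<close>

lemma mean_field_solution_approx:
  assumes "mean_field_solution c \<A> \<rho>" "\<rho> 0 = \<rho>\<^sub>0" "T > 0" "e > 0"
  shows "W_continuous_on {0..} \<rho>"
    "\<exists>N. \<forall>n\<ge>N. \<forall>t\<in>{0..T}. W (\<rho> t) (scheme (map (\<lambda>i. real i * T / real (Suc n)) [0..<Suc (Suc n)]) \<rho>\<^sub>0 \<rho> t) \<le> e"
proof -
  show cont: "W_continuous_on {0..} \<rho>" using assms(1) by (simp add: mean_field_solution_def Pc_curves_iff)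
  define D where "D n = map (\<lambda>i. real i * T / real (Suc n)) [0..<Suc (Suc n)]" for n
  have D: "is_partition T (D n)" "mesh (D n) = T / real (Suc n)" for n
    unfolding D_def using uniform_partition[OF assms(3), of "Suc n"] by auto
  have "(\<lambda>n. T / real (Suc n)) \<longlonglongrightarrow> 0" by (rule LIMSEQ_Suc[OF lim_const_over_n])
  then have "\<exists>N. \<forall>n\<ge>N. \<forall>t\<in>{0..T}. W (\<rho> t) (scheme (D n) \<rho>\<^sub>0 \<rho> t) \<le> e"
    using assms(1,3,4) D stable_solution_iff[OF cont assms(2), of T] unfolding mean_field_solution_def by simp
  then show "\<exists>N. \<forall>n\<ge>N. \<forall>t\<in>{0..T}. W (\<rho> t) (scheme (map (\<lambda>i. real i * T / real (Suc n)) [0..<Suc (Suc n)]) \<rho>\<^sub>0 \<rho> t) \<le> e"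
    unfolding D_def .
qed

text \<open>Each solution is close to the scheme driven by itself, and the two schemes contract.
  Sampling later costs a factor 2, offset by the half in \<open>contraction\<close>; the
  \<open>b^2\<close> of the final triangle inequality is offset by the one in its hypothesis. What
  remains is \<open>\<theta> \<le> 1 / 2\<close>.\<close>

lemma solution_halving:
  assumes "mean_field_solution c \<A> \<rho>" "\<rho> 0 = \<rho>\<^sub>0" "mean_field_solution c \<A> \<sigma>" "\<sigma> 0 = \<rho>\<^sub>0" "T > 0" "0 \<le> M"
    and bound: "\<And>s. s \<in> {0..T} \<Longrightarrow> W (\<rho> s) (\<sigma> s) \<le> M * exp (\<omega> * s)" and t: "t \<in> {0..T}"
  shows "W (\<rho> t) (\<sigma> t) \<le> M / 2 * exp (\<omega> * t)"
proof (rule field_le_epsilon)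
  fix e :: real assume "e > 0"
  define a where "a = e / (2 * b\<^sup>2)"
  have "a > 0" using \<open>e > 0\<close> b_ge_1 by (simp add: a_def)
  define D where "D n = map (\<lambda>i. real i * T / real (Suc n)) [0..<Suc (Suc n)]" for n
  have D: "is_partition T (D n)" "mesh (D n) = T / real (Suc n)" for n
    unfolding D_def using uniform_partition[OF assms(5), of "Suc n"] by auto
  note \<rho> = mean_field_solution_approx[OF assms(1,2,5) \<open>a > 0\<close>, folded D_def]
  note \<sigma> = mean_field_solution_approx[OF assms(3,4,5) \<open>a > 0\<close>, folded D_def]
  obtain N1 where N1: "\<forall>n\<ge>N1. \<forall>t\<in>{0..T}. W (\<rho> t) (scheme (D n) \<rho>\<^sub>0 \<rho> t) \<le> a" using \<rho>(2) by blast
  obtain N2 where N2: "\<forall>n\<ge>N2. \<forall>t\<in>{0..T}. W (\<sigma> t) (scheme (D n) \<rho>\<^sub>0 \<sigma> t) \<le> a" using \<sigma>(2) by blast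
  \<comment> \<open>The assumed bound is read off at the next partition point, at most one mesh
    later, where the weight is larger by at most this factor.\<close>
  have "(\<lambda>n. exp (\<omega> * (T / real (Suc n)))) \<longlonglongrightarrow> exp (\<omega> * 0)"
    by (intro tendsto_intros LIMSEQ_Suc[OF lim_const_over_n])
  then have "eventually (\<lambda>n. exp (\<omega> * (T / real (Suc n))) < 2) sequentially"
    by (intro order_tendstoD) auto
  then obtain N3 where N3: "\<forall>n\<ge>N3. exp (\<omega> * (T / real (Suc n))) < 2" by (auto simp: eventually_sequentially)
  define n where "n = max N1 (max N2 N3)"
  have n: "N1 \<le> n" "N2 \<le> n" "N3 \<le> n" by (auto simp: n_def)
  have P: "\<rho> s \<in> Pc c" "\<sigma> s \<in> Pc c" if "s \<in> {0..T}" for s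
    using W_continuous_onD(1)[OF \<rho>(1)] W_continuous_onD(1)[OF \<sigma>(1)] that by auto
  then have PP: "\<rho> \<in> {0..T} \<rightarrow> Pc c" "\<sigma> \<in> {0..T} \<rightarrow> Pc c" by auto
  let ?R = "scheme (D n) \<rho>\<^sub>0 \<rho>" and ?S = "scheme (D n) \<rho>\<^sub>0 \<sigma>"
  have PR: "?R t \<in> Pc c" "?S t \<in> Pc c"
    using W_continuous_onD(1)[OF scheme(2)[OF D(1) \<rho>\<^sub>0 PP(1)]] W_continuous_onD(1)[OF scheme(2)[OF D(1) \<rho>\<^sub>0 PP(2)]] t by auto
  \<comment> \<open>Dividing by \<open>b^2\<close> in advance cancels the factor lost on returning
    from the schemes to the solutions.\<close>
  have "W (?R t) (?S t) \<le> \<theta> / 2 * (2 * M / b\<^sup>2) * exp (\<omega> * t)"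
  proof (rule contraction[OF D(1) D(1) order_refl order_refl \<rho>\<^sub>0 PP])
    fix s assume s: "0 \<le> s" "s < T"
    let ?p = "next_point (D n) s"
    note np = next_point[OF D(1)[of n] s]
    have "W (\<rho> ?p) (\<sigma> ?p) \<le> M * exp (\<omega> * ?p)" using np s by (intro bound) auto
    also have "\<dots> \<le> M * exp (\<omega> * (s + T / real (Suc n)))"
      using np(3) \<omega>(2) assms(6) unfolding D(2) by (intro mult_left_mono) (auto intro!: mult_left_mono simp del: of_nat_Suc)
    also have "\<dots> = M * exp (\<omega> * s) * exp (\<omega> * (T / real (Suc n)))" by (simp add: distrib_left exp_add)
    also have "\<dots> \<le> M * exp (\<omega> * s) * 2" using N3 n assms(6) by (intro mult_left_mono less_imp_le[of "exp _"]) auto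
    also have "\<dots> = b\<^sup>2 * (2 * M / b\<^sup>2) * exp (\<omega> * s)" using b_ge_1 by simp
    finally show "W (\<rho> ?p) (\<sigma> ?p) \<le> b\<^sup>2 * (2 * M / b\<^sup>2) * exp (\<omega> * s)" .
  qed (use t assms(6) in auto)
  then have RS: "W (?R t) (?S t) \<le> \<theta> * (M / b\<^sup>2) * exp (\<omega> * t)" by simp
  have "W (\<rho> t) (\<sigma> t) \<le> b\<^sup>2 * (W (\<rho> t) (?R t) + W (?R t) (?S t) + W (?S t) (\<sigma> t))"
    by (rule W_triangle3[OF P(1)[OF t] P(2)[OF t] PR])
  also have "\<dots> \<le> b\<^sup>2 * (a + \<theta> * (M / b\<^sup>2) * exp (\<omega> * t) + a)"
  proof (intro mult_left_mono add_mono RS)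
    show "W (\<rho> t) (?R t) \<le> a" using N1 n t by auto
    show "W (?S t) (\<sigma> t) \<le> a" using N2 n t by (subst W_commute) auto
  qed simp
  also have "\<dots> = \<theta> * M * exp (\<omega> * t) + e"
    using b_ge_1 by (simp add: a_def distrib_left)
  also have "\<dots> \<le> 1 / 2 * M * exp (\<omega> * t) + e"
    using \<theta> assms(6) by (intro add_right_mono mult_right_mono) auto
  finally show "W (\<rho> t) (\<sigma> t) \<le> M / 2 * exp (\<omega> * t) + e" by simp
qed

text \<open>On the interval up to t + 1 the distance of the solutions is bounded, which gives a
  first weighted bound; iterated halving drives it to 0.\<close>

lemma solution_unique:
  assumes "mean_field_solution c \<A> \<rho>" "\<rho> 0 = \<rho>\<^sub>0" "mean_field_solution c \<A> \<sigma>" "\<sigma> 0 = \<rho>\<^sub>0" "0 \<le> t"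
  shows "\<sigma> t = \<rho> t"
proof -
  define T where "T = t + 1"
  have T: "T > 0" "t \<in> {0..T}" using assms(5) by (auto simp: T_def)
  have cont: "W_continuous_on {0..} \<rho>" "W_continuous_on {0..} \<sigma>"
    using assms(1,3) by (auto simp: mean_field_solution_def Pc_curves_iff)
  then have "W_continuous_on {0..T} \<rho>" "W_continuous_on {0..T} \<sigma>"
    by (auto elim: W_continuous_on_subset)
  from W_bounded_curves[OF this] obtain C where C: "\<And>s. s \<in> {0..T} \<Longrightarrow> W (\<rho> s) (\<sigma> s) \<le> C" by blast
  define M where "M = max C 0"
  have "W (\<rho> s) (\<sigma> s) \<le> M / 2 ^ n * exp (\<omega> * s)" if "s \<in> {0..T}" for n s
    using that
  proof (induction n arbitrary: s)
    case 0
    have "W (\<rho> s) (\<sigma> s) \<le> M * 1" using C[OF 0] by (simp add: M_def)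
    also have "\<dots> \<le> M * exp (\<omega> * s)" using \<omega>(2) 0 by (intro mult_left_mono) (auto simp: M_def)
    finally show ?case by simp
  next
    case (Suc n)
    have "0 \<le> M / 2 ^ n" by (simp add: M_def)
    from solution_halving[OF assms(1-4) T(1) this Suc.IH Suc.prems] show ?case by simp
  qed
  from this[OF T(2)] have le: "W (\<rho> t) (\<sigma> t) \<le> M * exp (\<omega> * t) * (1 / 2) ^ n" for n
    by (simp add: power_divide)
  have "(\<lambda>n. M * exp (\<omega> * t) * (1 / 2) ^ n) \<longlonglongrightarrow> M * exp (\<omega> * t) * 0"
    by (intro tendsto_intros LIMSEQ_realpow_zero) auto
  then have "W (\<rho> t) (\<sigma> t) \<le> M * exp (\<omega> * t) * 0"
    using le by (intro LIMSEQ_le_const) auto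
  then have "W (\<rho> t) (\<sigma> t) = 0" by (intro antisym) auto
  then show ?thesis
    using W_eq_0_imp_eq[of "\<rho> t" "\<sigma> t"] W_continuous_onD(1)[OF cont(1), of t] W_continuous_onD(1)[OF cont(2), of t] assms(5)
    by simp
qed

end

end

theorem theorem4p5:
  fixes c :: "'a::topological_space \<Rightarrow> 'a \<Rightarrow> real"
    and B \<alpha> \<beta> :: real
    and \<A> :: "'a measure \<Rightarrow> 'a operator"
    and \<rho>\<^sub>0 :: "'a measure"
  assumes "semimetric c"
    and "generates_topology c"
    and "sm_complete c"
    and "separable_space (euclidean :: 'a topology)"
    and "locally_compact_space (euclidean :: 'a topology)"
    and "sm_continuous c"
    and "B \<ge> 1"
    and "\<And>x y z. c x y \<le> B * (c x z + c z y)"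
    and "\<And>\<mu>. \<mu> \<in> Pc c \<Longrightarrow> \<A> \<mu> \<in> Gc0 c"
    and "\<alpha> \<ge> 0" and "\<beta> \<ge> 0"
    and "\<And>\<mu> \<nu> \<mu>' \<nu>'. \<mu> \<in> Pc c \<Longrightarrow> \<nu> \<in> Pc c \<Longrightarrow> \<mu>' \<in> Pc c \<Longrightarrow> \<nu>' \<in> Pc c \<Longrightarrow>
      omega c \<mu> \<nu> (\<A> \<mu>') (\<A> \<nu>')
        \<le> ereal (\<alpha> * enn2real (transport_cost c \<mu>' \<nu>') + \<beta> * enn2real (transport_cost c \<mu> \<nu>))"
    and "\<rho>\<^sub>0 \<in> Pc c"
  shows "\<exists>\<rho>. mean_field_solution c \<A> \<rho> \<and> \<rho> 0 = \<rho>\<^sub>0 \<and>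
    (\<forall>\<sigma>. mean_field_solution c \<A> \<sigma> \<and> \<sigma> 0 = \<rho>\<^sub>0 \<longrightarrow> (\<forall>t\<ge>0. \<sigma> t = \<rho> t))"
proof -
  interpret mean_field_generator c B \<A> \<alpha> \<beta>
    by unfold_locales (fact assms)+
  note sol = picard_limit_solution[OF assms(13)] picard_limit_0[OF assms(13)]
  show ?thesis
    by (intro exI[of _ "picard_limit \<rho>\<^sub>0"] conjI allI impI sol)
      (elim conjE, rule solution_unique[OF assms(13) sol])
qed

end
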